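(* Suppose that $X$ is a scattered space such that for any $k < \omega$ and ordinals $\alpha_{1}, \dots, \alpha_{k} < \mathrm{CB}(X)$, whenever $(x_{1}, \dots, x_{k})$ and $(y_{1}, \dots, y_{k})$ are tuples of distinct points such that $x_{i}, y_{i} \in X^{(\alpha_{i})} \setminus X^{(\alpha_{i}+1)}$ for $1\le i\le k$, there is $g \in \mathrm{Homeo}(X)$ with $g(x_{i}) = y_{i}$ for $1 \le i \le k$. Then $\mathrm{Homeo}(X)$ is CAP, it embeds densely in $\prod_{\alpha<\mathrm{CB}(X)} \mathrm{Sym}\left(\left\lvert X^{(\alpha)} \setminus X^{(\alpha+1)} \right\rvert\right)$, and $$\mathrm{M}(\mathrm{Homeo}(X)) = \prod_{\alpha<\mathrm{CB}(X)} \mathrm{LO}\left(\left\lvert X^{(\alpha)} \setminus X^{(\alpha+1)} \right\rvert\right).$$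
   Context: All spaces and groups are Hausdorff. A topological space is scattered if it contains no (non-empty) perfect subspace, i.e. every non-empty subspace has an isolated point. $X^{(\alpha)}$ denotes the $\alpha$-th Cantor–Bendixson derivative: $X^{(0)}=X$, $X^{(\alpha+1)}$ is the set of non-isolated points of $X^{(\alpha)}$, and $X^{(\lambda)}=\bigcap_{\alpha<\lambda}X^{(\alpha)}$ for limit $\lambda$. $\mathrm{CB}(X)$ is the Cantor–Bendixson rank, the least $\alpha$ with $X^{(\alpha)}=X^{(\alpha+1)}$ (so $X^{(\mathrm{CB}(X))}=\emptyset$ when $X$ is scattered). $\mathrm{Homeo}(X)$ is the group of homeomorphisms of $X$ with the topology of pointwise convergence, which for scattered $X$ is a group topology coinciding with the topology of pointwise convergence for $X$ viewed as a discrete set. For a cardinal $\kappa$, $\mathrm{Sym}(\kappa)$ is the group of permutations of $\kappa$ with the topology of pointwise convergence ($\kappa$ discrete), and $\mathrm{LO}(\kappa)$ is the compact space of linear orders on $\kappa$, with basic open sets consisting of all linear orders extending a given linear order on a finite subset, with the natural action $a\,(g\cdot{<})\,b$ iff $g^{-1}a<g^{-1}b$. The embedding of $\mathrm{Homeo}(X)$ sends a homeomorphism to the tuple of its restrictions to the levels $X^{(\alpha)}\setminus X^{(\alpha+1)}$, each identified with its cardinality by a fixed bijection; $\mathrm{Homeo}(X)$ acts on the product of the spaces of linear orders coordinatewise via this embedding, and equality with $\mathrm{M}(\mathrm{Homeo}(X))$ means isomorphism of flows. For a topological group $G$, a $G$-flow is a (non-empty) compact Hausdorff space with a continuous left $G$-action;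 a $G$-map is a continuous $G$-equivariant map; a subflow is a non-empty closed invariant subset; a flow is minimal if it has no proper subflow. For a $G$-flow $Y$, $\mathrm{AP}_G(Y)=\{y\in Y:\overline{Gy}\text{ is minimal}\}$. $G$ is CAP if $\mathrm{AP}_G(Y)$ is closed in $Y$ for every $G$-flow $Y$. $\mathrm{M}(G)$ is the universal minimal flow of $G$: the minimal $G$-flow, unique up to isomorphism, admitting a $G$-map onto every minimal $G$-flow. *)

theory Defs
  imports
    "HOL-Analysis.Analysis"
    "HOL-Algebra.Group_Action"
    "HOL-Algebra.Product_Groups"
begin

section \<open>Ordinals\<close>

text \<open>
  HOL has no type of all ordinals. The type \<open>'a ordinal\<close> carries the well-order of minimal order type
  on \<open>(nat + 'a) set\<close>: it is the initial ordinal of cardinality \<open>2 ^ max \<aleph>\<^sub>0 |'a|\<close>, so its elements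
  represent exactly the ordinals below that one. This is a limit ordinal, and it lies strictly above
  every ordinal of cardinality at most \<open>|'a|\<close>; hence it contains the Cantor--Bendixson rank of every
  topology on \<open>'a\<close> (lemma \<open>CB_rank_attained\<close> below).
\<close>

typedef 'a ordinal = "UNIV :: (nat + 'a) set set"
  by simp

instantiation ordinal :: (type) wellorder
begin

definition less_eq_ordinal :: "'a ordinal \<Rightarrow> 'a ordinal \<Rightarrow> bool" where
  "\<alpha> \<le> \<beta> \<longleftrightarrow> (Rep_ordinal \<alpha>, Rep_ordinal \<beta>) \<in> card_of (UNIV :: (nat + 'a) set set)"

definition less_ordinal :: "'a ordinal \<Rightarrow> 'a ordinal \<Rightarrow> bool" where
  "(\<alpha> :: 'a ordinal) < \<beta> \<longleftrightarrow> \<alpha> \<le> \<beta> \<and> \<alpha> \<noteq> \<beta>"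

instance
proof -
  let ?r = "card_of (UNIV :: (nat + 'a) set set)"
  have wo: "well_order_on UNIV ?r"
    by (rule card_of_well_order_on)
  have refl: "refl ?r" and trans: "trans ?r" and antisym: "antisym ?r" and total: "total ?r"
    and wf: "wf (?r - Id)"
    using wo by (auto simp: order_on_defs)
  have 1: "\<alpha> \<le> \<alpha>" for \<alpha> :: "'a ordinal"
    using refl by (auto simp: less_eq_ordinal_def refl_on_def)
  have 2: "\<alpha> \<le> \<gamma>" if "\<alpha> \<le> \<beta>" "\<beta> \<le> \<gamma>" for \<alpha> \<beta> \<gamma> :: "'a ordinal"
    using that trans unfolding less_eq_ordinal_def by (meson transD)
  have 3: "\<alpha> = \<beta>" if "\<alpha> \<le> \<beta>" "\<beta> \<le> \<alpha>" for \<alpha> \<beta> :: "'a ordinal"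
    using that antisym unfolding less_eq_ordinal_def by (meson antisymD Rep_ordinal_inject)
  have 4: "\<alpha> \<le> \<beta> \<or> \<beta> \<le> \<alpha>" for \<alpha> \<beta> :: "'a ordinal"
    using total 1 unfolding less_eq_ordinal_def total_on_def by (metis UNIV_I)
  have 5: "P \<alpha>" if step: "\<And>\<alpha>. (\<And>\<beta>. \<beta> < \<alpha> \<Longrightarrow> P \<beta>) \<Longrightarrow> P \<alpha>"
    for P :: "'a ordinal \<Rightarrow> bool" and \<alpha>
  proof -
    have "wf (inv_image (?r - Id) Rep_ordinal)"
      using wf by (rule wf_inv_image)
    then show ?thesis
    proof (induction \<alpha> rule: wf_induct_rule)
      case (less \<alpha>)
      show ?case
        by (rule step, rule less)
          (auto simp: less_ordinal_def less_eq_ordinal_def Rep_ordinal_inject)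
    qed
  qed
  show "OFCLASS('a ordinal, wellorder_class)"
  proof
    fix \<alpha> \<beta> \<gamma> :: "'a ordinal" and P
    show "\<alpha> < \<beta> \<longleftrightarrow> \<alpha> \<le> \<beta> \<and> \<not> \<beta> \<le> \<alpha>"
      using 1 3 by (auto simp: less_ordinal_def)
    show "\<alpha> \<le> \<alpha>" by (rule 1)
    show "\<alpha> \<le> \<beta> \<Longrightarrow> \<beta> \<le> \<gamma> \<Longrightarrow> \<alpha> \<le> \<gamma>" by (rule 2)
    show "\<alpha> \<le> \<beta> \<Longrightarrow> \<beta> \<le> \<alpha> \<Longrightarrow> \<alpha> = \<beta>" by (rule 3)
    show "\<alpha> \<le> \<beta> \<or> \<beta> \<le> \<alpha>" by (rule 4)
    show "(\<And>\<alpha>. (\<And>\<beta>. \<beta> < \<alpha> \<Longrightarrow> P \<beta>) \<Longrightarrow> P \<alpha>) \<Longrightarrow> P \<alpha>"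
      using 5[of P \<alpha>] by blast
  qed
qed

end

lemma ordinal_no_top: "\<exists>\<beta>. (\<alpha> :: 'a ordinal) < \<beta>"
proof -
  let ?r = "card_of (UNIV :: (nat + 'a) set set)"
  have "infinite (UNIV :: (nat + 'a) set set)"
    by (simp add: Finite_Set.finite_set)
  then obtain b where "Rep_ordinal \<alpha> \<noteq> b" "(Rep_ordinal \<alpha>, b) \<in> ?r"
    using infinite_Card_order_limit[of ?r "Rep_ordinal \<alpha>"] by (auto simp: card_of_card_order_on Field_card_of)
  then have "\<alpha> < Abs_ordinal b"
    by (auto simp: less_ordinal_def less_eq_ordinal_def Abs_ordinal_inverse)
  then show ?thesis ..
qed

definition ord_zero :: "'a ordinal" where
  "ord_zero = (LEAST \<alpha>. True)"

definition ord_suc :: "'a ordinal \<Rightarrow> 'a ordinal" where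
  "ord_suc \<alpha> = (LEAST \<beta>. \<alpha> < \<beta>)"

lemma ord_zero_le: "ord_zero \<le> \<alpha>"
  unfolding ord_zero_def by (rule Least_le) simp

lemma less_ord_suc: "\<alpha> < ord_suc \<alpha>"
  unfolding ord_suc_def using ordinal_no_top by (rule LeastI_ex)

lemma ord_suc_le_iff: "ord_suc \<alpha> \<le> \<beta> \<longleftrightarrow> \<alpha> < \<beta>"
  using less_ord_suc[of \<alpha>] by (auto simp: ord_suc_def intro: Least_le)

lemma ord_suc_inject: "ord_suc \<alpha> = ord_suc \<beta> \<longleftrightarrow> \<alpha> = \<beta>"
  by (metis less_ord_suc not_less_iff_gr_or_eq ord_suc_le_iff leD)

lemma ord_suc_neq_zero: "ord_suc \<alpha> \<noteq> ord_zero"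
  by (metis less_ord_suc leD ord_zero_le)

section \<open>Cantor--Bendixson derivatives\<close>

definition scattered_space :: "'a topology \<Rightarrow> bool" where
  "scattered_space X \<longleftrightarrow>
     (\<forall>S \<subseteq> topspace X. S \<noteq> {} \<longrightarrow> (\<exists>x\<in>S. openin (subtopology X S) {x}))"

definition nonisolated_points :: "'a topology \<Rightarrow> 'a set \<Rightarrow> 'a set" where
  "nonisolated_points X S = {x \<in> S. \<not> openin (subtopology X S) {x}}"

function CB_deriv :: "'a topology \<Rightarrow> 'a ordinal \<Rightarrow> 'a set" where
  "CB_deriv X \<alpha> =
     (if \<alpha> = ord_zero then topspace X
      else if \<exists>\<beta>. \<alpha> = ord_suc \<beta> then nonisolated_points X (CB_deriv X (THE \<beta>. \<alpha> = ord_suc \<beta>))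
      else (\<Inter>\<beta>\<in>{..<\<alpha>}. CB_deriv X \<beta>))"
  by pat_completeness auto
termination
  by (relation "inv_image {(\<alpha>, \<beta>). \<alpha> < \<beta>} snd")
    (auto simp: ord_suc_inject less_ord_suc wf)

declare CB_deriv.simps [simp del]

lemma CB_deriv_zero: "CB_deriv X ord_zero = topspace X"
  by (simp add: CB_deriv.simps)

lemma CB_deriv_suc: "CB_deriv X (ord_suc \<alpha>) = nonisolated_points X (CB_deriv X \<alpha>)"
  by (subst CB_deriv.simps) (simp add: ord_suc_inject ord_suc_neq_zero)

lemma CB_deriv_limit:
  assumes "\<alpha> \<noteq> ord_zero" "\<nexists>\<beta>. \<alpha> = ord_suc \<beta>"
  shows "CB_deriv X \<alpha> = (\<Inter>\<beta>\<in>{..<\<alpha>}. CB_deriv X \<beta>)"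
  using assms by (subst CB_deriv.simps) simp

definition CB_rank :: "'a topology \<Rightarrow> 'a ordinal" where
  "CB_rank X = (LEAST \<alpha>. CB_deriv X \<alpha> = CB_deriv X (ord_suc \<alpha>))"

definition CB_level :: "'a topology \<Rightarrow> 'a ordinal \<Rightarrow> 'a set" where
  "CB_level X \<alpha> = CB_deriv X \<alpha> - CB_deriv X (ord_suc \<alpha>)"

lemma CB_deriv_antimono: "\<alpha> \<le> \<beta> \<Longrightarrow> CB_deriv X \<beta> \<subseteq> CB_deriv X \<alpha>"
proof (induction \<beta> rule: less_induct)
  case (less \<beta>)
  consider "\<beta> = \<alpha>" | "\<alpha> < \<beta>" "\<exists>\<gamma>. \<beta> = ord_suc \<gamma>" | "\<alpha> < \<beta>" "\<nexists>\<gamma>. \<beta> = ord_suc \<gamma>"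
    using less.prems by fastforce
  then show ?case
  proof cases
    case 2
    then obtain \<gamma> where \<gamma>: "\<beta> = ord_suc \<gamma>" by blast
    then have "\<gamma> < \<beta>" "\<alpha> \<le> \<gamma>"
      using 2 less_ord_suc ord_suc_le_iff[of \<gamma> \<alpha>] by (auto simp: not_le[symmetric])
    then show ?thesis
      using less.IH \<gamma> by (auto simp: CB_deriv_suc nonisolated_points_def)
  next
    case 3
    then have "\<beta> \<noteq> ord_zero"
      using ord_zero_le leD by blast
    then show ?thesis
      using 3 CB_deriv_limit by blast
  qed simp
qed

lemma CB_rank_attained: "CB_deriv X (CB_rank X) = CB_deriv X (ord_suc (CB_rank X))"
proof -
  have "\<exists>\<alpha>. CB_deriv X \<alpha> = CB_deriv X (ord_suc \<alpha>)"
  proof (rule ccontr)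
    assume "\<not> ?thesis"
    then have "\<exists>x. x \<in> CB_level X \<alpha>" for \<alpha>
      using CB_deriv_antimono[of \<alpha> "ord_suc \<alpha>" X] less_ord_suc[of \<alpha>]
      by (force simp: CB_level_def)
    then obtain p where p: "\<And>\<alpha>. p \<alpha> \<in> CB_level X \<alpha>" by metis
    have "p \<alpha> \<noteq> p \<beta>" if "\<alpha> < \<beta>" for \<alpha> \<beta>
      using p[of \<alpha>] p[of \<beta>] CB_deriv_antimono[of "ord_suc \<alpha>" \<beta> X] that
      by (auto simp: CB_level_def ord_suc_le_iff)
    then have "inj p"
      by (metis injI linorder_neqE)
    then have "inj (\<lambda>S :: (nat + 'a) set. Inr (p (Abs_ordinal S)) :: nat + 'a)"
      by (intro injI) (metis Abs_ordinal_inject UNIV_I injD sum.inject(2))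
    then show False
      by (metis Cantors_theorem inj_imp_surj_inv surj_def UNIV_I Pow_UNIV)
  qed
  then show ?thesis
    unfolding CB_rank_def by (rule LeastI_ex)
qed

section \<open>Topological groups and flows\<close>

locale topological_group = group G for G (structure) +
  fixes T
  assumes topspace_eq: "topspace T = carrier G"
    and Hausdorff: "Hausdorff_space T"
    and continuous_mult: "continuous_map (prod_topology T T) T (\<lambda>(x, y). x \<otimes> y)"
    and continuous_inv: "continuous_map T T (\<lambda>x. inv x)"

locale flow = topological_group G T + group_action G "topspace Y" act
  for G (structure) and T and Y and act +
  assumes nonempty: "topspace Y \<noteq> {}"
    and compact: "compact_space Y"
    and Hausdorff_flow: "Hausdorff_space Y"
    and continuous_act: "continuous_map (prod_topology T Y) Y (\<lambda>(g, y). act g y)"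

definition subflow where
  "subflow G Y act Z \<longleftrightarrow>
     Z \<noteq> {} \<and> closedin Y Z \<and> (\<forall>g\<in>carrier G. \<forall>z\<in>Z. act g z \<in> Z)"

definition minimal_subflow where
  "minimal_subflow G Y act Z \<longleftrightarrow>
     subflow G Y act Z \<and> (\<forall>W. subflow G Y act W \<and> W \<subseteq> Z \<longrightarrow> W = Z)"

definition minimal_flow where
  "minimal_flow G T Y act \<longleftrightarrow> flow G T Y act \<and> minimal_subflow G Y act (topspace Y)"

definition almost_periodic_points where
  "almost_periodic_points G Y act =
     {y \<in> topspace Y. minimal_subflow G Y act (Y closure_of orbit G act y)}"

definition flow_map where
  "flow_map G Y act Z act' f \<longleftrightarrow>
     continuous_map Y Z f \<and> (\<forall>g\<in>carrier G. \<forall>y\<in>topspace Y. f (act g y) = act' g (f y))"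

definition flows_isomorphic where
  "flows_isomorphic G Y act Z act' \<longleftrightarrow>
     (\<exists>f. homeomorphic_map Y Z f \<and> flow_map G Y act Z act' f)"

text \<open>
  HOL formulas cannot quantify over types. Notions that refer to all flows of a group therefore take
  the type \<open>'y\<close> of the points of these flows as a parameter; a theorem stated for a type variable
  \<open>'y\<close> covers flows of every size. As a hypothesis, universality with respect to one type is
  weaker than universality with respect to all flows.
\<close>

definition CAP :: "'y itself \<Rightarrow> ('g, 'm) monoid_scheme \<Rightarrow> 'g topology \<Rightarrow> bool" where
  "CAP _ G T \<longleftrightarrow> topological_group G T \<and>
     (\<forall>(Y :: 'y topology) act. flow G T Y act \<longrightarrow> closedin Y (almost_periodic_points G Y act))"

definition universal_minimal_flow ::
    "'y itself \<Rightarrow> ('g, 'm) monoid_scheme \<Rightarrow> 'g topology \<Rightarrow> 'p topology \<Rightarrow> ('g \<Rightarrow> 'p \<Rightarrow> 'p) \<Rightarrow> bool" where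
  "universal_minimal_flow _ G T P act \<longleftrightarrow> minimal_flow G T P act \<and>
     (\<forall>(Y :: 'y topology) act'. minimal_flow G T Y act' \<longrightarrow>
        (\<exists>f. flow_map G P act Y act' f \<and> f ` topspace P = topspace Y))"

section \<open>Homeomorphism groups, symmetric groups and spaces of linear orders\<close>

definition Homeo :: "'a topology \<Rightarrow> ('a \<Rightarrow> 'a) monoid" where
  "Homeo X = BijGroup (topspace X)
     \<lparr>carrier := {f \<in> Bij (topspace X). homeomorphic_map X X f}\<rparr>"

definition Homeo_topology :: "'a topology \<Rightarrow> ('a \<Rightarrow> 'a) topology" where
  "Homeo_topology X = subtopology (product_topology (\<lambda>_. X) (topspace X)) (carrier (Homeo X))"

abbreviation Sym :: "'k set \<Rightarrow> ('k \<Rightarrow> 'k) monoid" where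
  "Sym K \<equiv> BijGroup K"

definition Sym_topology :: "'k set \<Rightarrow> ('k \<Rightarrow> 'k) topology" where
  "Sym_topology K = subtopology (product_topology (\<lambda>_. discrete_topology K) K) (carrier (Sym K))"

text \<open>
  Linear orders are strict. The predicate \<open>strict_linear_order_on\<close> does not confine the relation to
  \<open>K\<close>.
\<close>

definition LO :: "'k set \<Rightarrow> 'k rel set" where
  "LO K = {r. r \<subseteq> K \<times> K \<and> strict_linear_order_on K r}"

definition LO_topology :: "'k set \<Rightarrow> 'k rel topology" where
  "LO_topology K =
     topology_generated_by {{r \<in> LO K. s \<subseteq> r} | F s. finite F \<and> F \<subseteq> K \<and> s \<in> LO F}"

definition LO_act :: "'k set \<Rightarrow> ('k \<Rightarrow> 'k) \<Rightarrow> 'k rel \<Rightarrow> 'k rel" where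
  "LO_act K g r = {(a, b) \<in> K \<times> K. ((inv\<^bsub>Sym K\<^esub> g) a, (inv\<^bsub>Sym K\<^esub> g) b) \<in> r}"

text \<open>
  Below, \<open>K \<alpha>\<close> stands for the cardinality of the level \<open>CB_level X \<alpha>\<close>, identified with that level
  by a bijection \<open>b \<alpha>\<close> from \<open>CB_level X \<alpha>\<close> to \<open>K \<alpha>\<close>.
\<close>

definition Sym_prod :: "'i set \<Rightarrow> ('i \<Rightarrow> 'k set) \<Rightarrow> ('i \<Rightarrow> 'k \<Rightarrow> 'k) monoid" where
  "Sym_prod I K = product_group I (\<lambda>\<alpha>. Sym (K \<alpha>))"

definition Sym_prod_topology :: "'i set \<Rightarrow> ('i \<Rightarrow> 'k set) \<Rightarrow> ('i \<Rightarrow> 'k \<Rightarrow> 'k) topology" where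
  "Sym_prod_topology I K = product_topology (\<lambda>\<alpha>. Sym_topology (K \<alpha>)) I"

definition LO_prod_topology :: "'i set \<Rightarrow> ('i \<Rightarrow> 'k set) \<Rightarrow> ('i \<Rightarrow> 'k rel) topology" where
  "LO_prod_topology I K = product_topology (\<lambda>\<alpha>. LO_topology (K \<alpha>)) I"

definition LO_prod_act ::
    "'i set \<Rightarrow> ('i \<Rightarrow> 'k set) \<Rightarrow> ('i \<Rightarrow> 'k \<Rightarrow> 'k) \<Rightarrow> ('i \<Rightarrow> 'k rel) \<Rightarrow> ('i \<Rightarrow> 'k rel)" where
  "LO_prod_act I K s =
     (\<lambda>r \<in> topspace (LO_prod_topology I K). \<lambda>\<alpha>\<in>I. LO_act (K \<alpha>) (s \<alpha>) (r \<alpha>))"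

definition Homeo_embedding ::
    "'a topology \<Rightarrow> ('a ordinal \<Rightarrow> 'k set) \<Rightarrow> ('a ordinal \<Rightarrow> 'a \<Rightarrow> 'k) \<Rightarrow> ('a \<Rightarrow> 'a)
       \<Rightarrow> ('a ordinal \<Rightarrow> 'k \<Rightarrow> 'k)" where
  "Homeo_embedding X K b g =
     (\<lambda>\<alpha>\<in>{..<CB_rank X}. \<lambda>a\<in>K \<alpha>. b \<alpha> (g (inv_into (CB_level X \<alpha>) (b \<alpha>) a)))"

definition Homeo_LO_act ::
    "'a topology \<Rightarrow> ('a ordinal \<Rightarrow> 'k set) \<Rightarrow> ('a ordinal \<Rightarrow> 'a \<Rightarrow> 'k) \<Rightarrow> ('a \<Rightarrow> 'a)
       \<Rightarrow> ('a ordinal \<Rightarrow> 'k rel) \<Rightarrow> ('a ordinal \<Rightarrow> 'k rel)" where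
  "Homeo_LO_act X K b g = LO_prod_act {..<CB_rank X} K (Homeo_embedding X K b g)"

end

theory Submission
  imports Defs "HOL-Library.Ramsey"
begin

text \<open>
  Homeomorphisms preserve the levels of the Cantor--Bendixson filtration, and every point is isolated
  in the derivative that it leaves at its own level. So the topology of \<open>X\<close> disappears from the group:
  pointwise convergence for \<open>X\<close> is pointwise convergence for the discrete set, and restriction to the
  levels is a topological embedding into the product of the groups \<open>Sym (K \<alpha>)\<close>. The transitivity
  hypothesis says precisely that the image is dense. What remains concerns an arbitrary dense subgroup
  \<open>G\<close> of a product of symmetric groups (locale \<open>dense_subgroup_of_Sym_prod\<close>), acting on the product \<open>P\<close>
  of the spaces of linear orders.

  The flow \<open>P\<close> is minimal because two linear orders of a finite set are isomorphic: whatever order \<open>q\<close>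
  induces on a finite set, an element of \<open>G\<close> makes \<open>p\<close> induce the same one (\<open>orbit_realizes_pattern\<close>).

  Let \<open>Y\<close> be a flow. By compactness, a continuous \<open>f : Y \<rightarrow> \<real>\<close> is moved by at most \<open>\<epsilon>\<close> under the pointwise
  stabilizer of some finite set \<open>F\<close> (\<open>ex_controls\<close>). Hence \<open>f (g y)\<close> depends, up to \<open>\<epsilon>\<close>, only on the
  restriction of \<open>g\<close> inverse to \<open>F\<close>, a finite injection, and rounding it gives a finite colouring of
  such injections. Call \<open>y\<close> aligned with \<open>p \<in> P\<close> if \<open>f (g y)\<close> and \<open>f y\<close> are close whenever \<open>g p\<close> and \<open>p\<close> induce
  the same order on \<open>F\<close>, for all such \<open>f\<close>, \<open>F\<close> and \<open>\<epsilon>\<close>. Ramsey's theorem yields points satisfying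
  finitely many of these conditions in every orbit (\<open>ex_nearly_fixed_translate\<close>), and compactness then
  yields an aligned point in every subflow.

  Alignment is a closed invariant relation between \<open>P\<close> and \<open>Y\<close>. If \<open>y\<close> is aligned with \<open>p\<close>, then the
  closure of the orbit of \<open>(p, y)\<close> is the graph of a \<open>G\<close>-map from \<open>P\<close> to \<open>Y\<close> (\<open>flow_map_of_aligned\<close>). Three
  conclusions follow. A minimal flow is the image of such a map, so \<open>P\<close> is universal. The almost periodic
  points of \<open>Y\<close> are exactly the points aligned with some \<open>p\<close>, and they form the projection of a compact
  set, so \<open>G\<close> is CAP. Finally, let \<open>M\<close> be a minimal flow with a \<open>G\<close>-map to \<open>P\<close>. Composing it with the
  map \<open>P \<rightarrow> M\<close> just constructed gives a surjection \<open>P \<rightarrow> P\<close> that acts on the orders of each suitable finite set, of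
  which there are finitely many. It therefore permutes them and is injective, so that \<open>P \<rightarrow> M\<close> is an
  isomorphism.
\<close>

section \<open>Finite linear orders\<close>

lemma strict_linear_order_on_subset:
  assumes "strict_linear_order_on A r" "B \<subseteq> A"
  shows "strict_linear_order_on B r"
  using assms unfolding strict_linear_order_on_def total_on_def by blast

lemma LO_nonempty: "LO K \<noteq> {}"
proof -
  obtain w where w: "well_order_on K w"
    using well_order_on by blast
  then have "strict_linear_order_on K (w - Id)"
    by (intro strict_linear_order_on_diff_Id) (simp add: well_order_on_def)
  moreover have "w \<subseteq> K \<times> K"
    using w by (auto dest: well_order_on_domain)
  ultimately have "w - Id \<in> LO K"
    by (auto simp: LO_def)
  then show ?thesis by blast
qed

definition rank_in :: "'b rel \<Rightarrow> 'b set \<Rightarrow> 'b \<Rightarrow> nat" where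
  "rank_in r A a = card {x \<in> A. (x, a) \<in> r}"

lemma rank_in_less_iff:
  assumes "finite A" "strict_linear_order_on A r" "a \<in> A" "b \<in> A"
  shows "rank_in r A a < rank_in r A b \<longleftrightarrow> (a, b) \<in> r"
proof -
  have less: "rank_in r A c < rank_in r A d" if "(c, d) \<in> r" "c \<in> A" for c d
    unfolding rank_in_def
  proof (rule psubset_card_mono)
    show "{x \<in> A. (x, c) \<in> r} \<subset> {x \<in> A. (x, d) \<in> r}"
      using assms(2) that unfolding strict_linear_order_on_def irrefl_def
      by (auto dest: transD)
  qed (use assms(1) in simp)
  show ?thesis
    using less[of a b] less[of b a] assms unfolding strict_linear_order_on_def total_on_def
    by (metis less_asym less_irrefl)
qed

lemma bij_betw_rank_in:
  assumes "finite A" "strict_linear_order_on A r"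
  shows "bij_betw (rank_in r A) A {..<card A}"
proof -
  have inj: "inj_on (rank_in r A) A"
    using rank_in_less_iff[OF assms] assms(2)
    unfolding strict_linear_order_on_def total_on_def inj_on_def by (metis less_irrefl)
  have "rank_in r A a < card A" if "a \<in> A" for a
    unfolding rank_in_def
    by (rule psubset_card_mono)
      (use assms that in \<open>auto simp: strict_linear_order_on_def irrefl_def\<close>)
  then have "rank_in r A ` A = {..<card A}"
    using inj by (intro card_subset_eq) (auto simp: card_image)
  with inj show ?thesis
    by (simp add: bij_betw_def)
qed

lemma finite_linear_orders_isomorphic:
  assumes "finite A" "strict_linear_order_on A r" "strict_linear_order_on A s"
  obtains m where "bij_betw m A A" "\<And>a b. a \<in> A \<Longrightarrow> b \<in> A \<Longrightarrow> (m a, m b) \<in> s \<longleftrightarrow> (a, b) \<in> r"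
proof -
  note R = bij_betw_rank_in[OF assms(1,2)] and S = bij_betw_rank_in[OF assms(1,3)]
  define m where "m = inv_into A (rank_in s A) \<circ> rank_in r A"
  have m: "bij_betw m A A"
    unfolding m_def by (rule bij_betw_trans[OF R bij_betw_inv_into[OF S]])
  have rank: "rank_in s A (m a) = rank_in r A a" if "a \<in> A" for a
    using that bij_betw_inv_into_right[OF S] bij_betwE[OF R] by (simp add: m_def)
  show ?thesis
  proof (rule that[OF m])
    fix a b assume "a \<in> A" "b \<in> A"
    then show "(m a, m b) \<in> s \<longleftrightarrow> (a, b) \<in> r"
      using rank_in_less_iff[OF assms(1,2)] rank_in_less_iff[OF assms(1,3)] rank bij_betwE[OF m]
      by metis
  qed
qed

text \<open>
  An automorphism preserves the number of predecessors of a point, and in a finite linear order this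
  number determines the point.
\<close>

lemma finite_linear_order_rigid:
  assumes "finite A" "strict_linear_order_on A r" "bij_betw m A A"
    and "\<And>a b. a \<in> A \<Longrightarrow> b \<in> A \<Longrightarrow> (m a, m b) \<in> r \<longleftrightarrow> (a, b) \<in> r" "a \<in> A"
  shows "m a = a"
proof -
  have "{x \<in> m ` A. (x, m a) \<in> r} = m ` {x \<in> A. (x, a) \<in> r}"
    using assms(4)[OF _ \<open>a \<in> A\<close>] by blast
  then have "{x \<in> A. (x, m a) \<in> r} = m ` {x \<in> A. (x, a) \<in> r}"
    using bij_betw_imp_surj_on[OF assms(3)] by simp
  moreover have "inj_on m {x \<in> A. (x, a) \<in> r}"
    using assms(3) by (auto simp: bij_betw_def inj_on_def)
  ultimately have "rank_in r A (m a) = rank_in r A a"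
    by (simp add: rank_in_def card_image)
  then show ?thesis
    using bij_betw_imp_inj_on[OF bij_betw_rank_in[OF assms(1,2)]] bij_betwE[OF assms(3)] assms(5)
    by (auto dest: inj_onD)
qed

text \<open>
  Thanks to this, a colouring of the increasing maps from \<open>A\<close> to \<open>nat\<close> is a colouring of the subsets of
  \<open>nat\<close> with \<open>card A\<close> elements, to which Ramsey's theorem applies.
\<close>

lemma increasing_map_determined_by_image:
  fixes t t' :: "'b \<Rightarrow> nat"
  assumes "finite A" "strict_linear_order_on A r" "t ` A = t' ` A"
    and "monotone_on A (\<lambda>a b. (a, b) \<in> r) (<) t" "monotone_on A (\<lambda>a b. (a, b) \<in> r) (<) t'"
    and "a \<in> A"
  shows "t a = t' a"
proof -
  have count: "card {n \<in> u ` A. n < u a} = rank_in r A a"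
    if u: "monotone_on A (\<lambda>a b. (a, b) \<in> r) (<) u" for u :: "'b \<Rightarrow> nat"
  proof -
    have iff: "u x < u y \<longleftrightarrow> (x, y) \<in> r" if "x \<in> A" "y \<in> A" for x y
      using that u assms(2) unfolding strict_linear_order_on_def total_on_def monotone_on_def
      by (metis less_asym less_irrefl)
    then have "{n \<in> u ` A. n < u a} = u ` {x \<in> A. (x, a) \<in> r}"
      using \<open>a \<in> A\<close> by blast
    moreover have "inj_on u {x \<in> A. (x, a) \<in> r}"
      using iff assms(2) unfolding strict_linear_order_on_def total_on_def inj_on_def
      by (metis (no_types, lifting) less_irrefl mem_Collect_eq)
    ultimately show ?thesis
      by (simp add: rank_in_def card_image)
  qed
  define N where "N = t ` A"
  have "rank_in less_than N (t a) = rank_in less_than N (t' a)"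
    using count[OF assms(4)] count[OF assms(5)] assms(3) by (simp add: rank_in_def N_def)
  moreover have "strict_linear_order_on N less_than"
    by (auto simp: strict_linear_order_on_def total_on_def irrefl_def)
  then have "inj_on (rank_in less_than N) N"
    using bij_betw_rank_in[of N less_than] assms(1) by (simp add: N_def bij_betw_def)
  moreover have "t a \<in> N" "t' a \<in> N"
    using assms(3,6) by (auto simp: N_def)
  ultimately show ?thesis
    by (auto dest: inj_onD)
qed

lemma ex_increasing_map_into_infinite:
  fixes Z :: "nat set"
  assumes "finite A" "strict_linear_order_on A r" "infinite Z"
  obtains t where "t ` A \<subseteq> Z" "monotone_on A (\<lambda>a b. (a, b) \<in> r) (<) t"
proof (rule that)
  show "(\<lambda>a. enumerate Z (rank_in r A a)) ` A \<subseteq> Z"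
    using enumerate_in_set[OF assms(3)] by blast
  show "monotone_on A (\<lambda>a b. (a, b) \<in> r) (<) (\<lambda>a. enumerate Z (rank_in r A a))"
    using rank_in_less_iff[OF assms(1,2)] assms(3) by (simp add: monotone_on_def enumerate_mono)
qed

text \<open>
  The sets \<open>m ` A - A\<close> and \<open>A - m ` A\<close> have the same size; any bijection from the first to the second
  closes up \<open>m\<close>.
\<close>

lemma finite_injection_extends_to_permutation:
  assumes "finite A" "A \<subseteq> S" "inj_on m A" "m ` A \<subseteq> S"
  obtains f where "f \<in> Bij S" "\<And>a. a \<in> A \<Longrightarrow> f a = m a"
proof -
  have "card (m ` A - A) = card (A - m ` A)"
    using assms card_image[OF assms(3)]
    by (metis card_Diff_subset_Int card_image finite_imageI inf_commute finite_Int)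
  then obtain h where h: "bij_betw h (m ` A - A) (A - m ` A)"
    using assms(1) finite_same_card_bij by (metis finite_Diff finite_imageI)
  define f where
    "f = (\<lambda>x\<in>S. if x \<in> A then m x else if x \<in> m ` A then h x else x)"
  have "bij_betw f (A \<union> (m ` A - A) \<union> (S - (A \<union> m ` A))) (m ` A \<union> (A - m ` A) \<union> (S - (A \<union> m ` A)))"
  proof (intro bij_betw_combine)
    show "bij_betw f A (m ` A)"
      using assms by (intro bij_betw_cong[THEN iffD1, OF _ inj_on_imp_bij_betw]) (auto simp: f_def)
    show "bij_betw f (m ` A - A) (A - m ` A)"
      using assms h by (intro bij_betw_cong[THEN iffD1, OF _ h]) (auto simp: f_def)
    show "bij_betw f (S - (A \<union> m ` A)) (S - (A \<union> m ` A))"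
      by (intro bij_betw_cong[THEN iffD1, OF _ bij_betw_id]) (auto simp: f_def)
  qed auto
  moreover have "A \<union> (m ` A - A) \<union> (S - (A \<union> m ` A)) = S" "m ` A \<union> (A - m ` A) \<union> (S - (A \<union> m ` A)) = S"
    using assms by auto
  ultimately have "f \<in> Bij S"
    by (simp add: Bij_def f_def)
  moreover have "f a = m a" if "a \<in> A" for a
    using that assms by (auto simp: f_def)
  ultimately show ?thesis
    using that by blast
qed

section \<open>Ramsey's theorem for several colourings\<close>

text \<open>
  Ramsey's theorem is applied once per colouring, each time inside the homogeneous set found before.
\<close>

lemma Ramsey_several_colourings:
  fixes c :: "'j \<Rightarrow> nat set \<Rightarrow> nat"
  assumes "finite J" and "\<And>j S. j \<in> J \<Longrightarrow> finite S \<Longrightarrow> card S = n j \<Longrightarrow> c j S < r j"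
  obtains Z where "infinite Z"
    "\<And>j S T. j \<in> J \<Longrightarrow> S \<subseteq> Z \<Longrightarrow> T \<subseteq> Z \<Longrightarrow> finite S \<Longrightarrow> finite T \<Longrightarrow> card S = n j \<Longrightarrow> card T = n j
      \<Longrightarrow> c j S = c j T"
proof -
  have "\<exists>Z. infinite Z \<and> (\<forall>j\<in>J. \<exists>u. \<forall>S\<subseteq>Z. finite S \<and> card S = n j \<longrightarrow> c j S = u)"
    using assms
  proof (induction J)
    case empty
    then show ?case
      using infinite_UNIV_nat by blast
  next
    case (insert j J)
    then obtain Z where Z: "infinite Z" "\<forall>j\<in>J. \<exists>u. \<forall>S\<subseteq>Z. finite S \<and> card S = n j \<longrightarrow> c j S = u"
      by auto
    have "\<forall>S. S \<subseteq> Z \<and> finite S \<and> card S = n j \<longrightarrow> c j S < r j"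
      using insert.prems by blast
    from Ramsey[OF Z(1) this] obtain Z' u where
      "Z' \<subseteq> Z" "infinite Z'" "\<forall>S. S \<subseteq> Z' \<and> finite S \<and> card S = n j \<longrightarrow> c j S = u"
      by blast
    with Z(2) have "\<forall>i\<in>insert j J. \<exists>u. \<forall>S\<subseteq>Z'. finite S \<and> card S = n i \<longrightarrow> c i S = u"
      by (metis insert_iff subset_trans)
    with \<open>infinite Z'\<close> show ?case by blast
  qed
  then show ?thesis
    using that by metis
qed

section \<open>Spaces of linear orders\<close>

lemma topspace_LO_topology [simp]: "topspace (LO_topology K) = LO K"
proof -
  have "LO K \<in> {{r \<in> LO K. s \<subseteq> r} | F s. finite F \<and> F \<subseteq> K \<and> s \<in> LO F}"
    using LO_nonempty[of "{} :: 'a set"] by (auto simp: LO_def intro!: exI[of _ "{}"])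
  then show ?thesis
    unfolding LO_topology_def topology_generated_by_topspace by blast
qed

text \<open>
  A basic open set of \<open>LO_topology K\<close> fixes finitely many comparisons, so the sets of all orders with \<open>a < b\<close>
  form a subbase.
\<close>

lemma continuous_map_into_LO:
  assumes "h \<in> topspace Z \<rightarrow> LO K"
    and open_less: "\<And>a b. a \<in> K \<Longrightarrow> b \<in> K \<Longrightarrow> openin Z {z \<in> topspace Z. (a, b) \<in> h z}"
  shows "continuous_map Z (LO_topology K) h"
  unfolding LO_topology_def
proof (rule continuous_on_generated_topo)
  show "h ` topspace Z \<subseteq> \<Union> {{r \<in> LO K. s \<subseteq> r} | F s. finite F \<and> F \<subseteq> K \<and> s \<in> LO F}"
    using assms(1) topspace_LO_topology[of K]
    unfolding LO_topology_def topology_generated_by_topspace by blast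
  fix U assume "U \<in> {{r \<in> LO K. s \<subseteq> r} | F s. finite F \<and> F \<subseteq> K \<and> s \<in> LO F}"
  then obtain F s where U: "U = {r \<in> LO K. s \<subseteq> r}" "finite F" "F \<subseteq> K" "s \<in> LO F"
    by blast
  then have "finite s" "s \<subseteq> K \<times> K"
    by (auto simp: LO_def intro: finite_subset[of s "F \<times> F"])
  then have "openin Z (topspace Z \<inter> (\<Inter>(a, b)\<in>s. {z \<in> topspace Z. (a, b) \<in> h z}))"
    by (cases "s = {}") (auto intro!: openin_Int openin_Inter open_less)
  moreover have "h -` U \<inter> topspace Z = topspace Z \<inter> (\<Inter>(a, b)\<in>s. {z \<in> topspace Z. (a, b) \<in> h z})"
    using U assms(1) by auto
  ultimately show "openin Z (h -` U \<inter> topspace Z)"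
    by simp
qed

lemma openin_LO_less:
  assumes "a \<in> K" "b \<in> K"
  shows "openin (LO_topology K) {r \<in> LO K. (a, b) \<in> r}"
proof (cases "a = b")
  case True
  then have "{r \<in> LO K. (a, b) \<in> r} = {}"
    by (auto simp: LO_def strict_linear_order_on_def irrefl_def)
  then show ?thesis
    by (simp only: openin_empty)
next
  case False
  then have "{(a, b)} \<in> LO {a, b}"
    by (auto simp: LO_def strict_linear_order_on_def irrefl_def total_on_def trans_def)
  with assms have "{r \<in> LO K. {(a, b)} \<subseteq> r} \<in> {{r \<in> LO K. s \<subseteq> r} | F s. finite F \<and> F \<subseteq> K \<and> s \<in> LO F}"
    by (intro CollectI exI[of _ "{a, b}"] exI[of _ "{(a, b)}"]) auto
  then show ?thesis
    unfolding LO_topology_def by (auto intro: topology_generated_by_Basis)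
qed

lemma LO_not_less_iff:
  assumes "r \<in> LO K" "a \<in> K" "b \<in> K"
  shows "(a, b) \<notin> r \<longleftrightarrow> a = b \<or> (b, a) \<in> r"
  using assms unfolding LO_def strict_linear_order_on_def total_on_def irrefl_def
  by (auto dest: transD)

lemma LO_asym: "r \<in> LO K \<Longrightarrow> (a, b) \<in> r \<Longrightarrow> (b, a) \<notin> r"
  unfolding LO_def strict_linear_order_on_def irrefl_def by (auto dest: transD)

lemma Hausdorff_LO_topology: "Hausdorff_space (LO_topology K)"
  unfolding Hausdorff_space_def topspace_LO_topology
proof (intro allI impI)
  fix r s assume rs: "r \<in> LO K \<and> s \<in> LO K \<and> r \<noteq> s"
  have diff: "\<exists>a b. a \<in> K \<and> b \<in> K \<and> (a, b) \<in> r \<and> (b, a) \<in> s"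
    if "r \<in> LO K" "s \<in> LO K" "\<not> r \<subseteq> s" for r s
  proof -
    from that obtain a b where "(a, b) \<in> r" "(a, b) \<notin> s" "a \<in> K" "b \<in> K" 
      by (auto simp: LO_def)
    moreover have "a \<noteq> b"
      using calculation that by (auto simp: LO_def strict_linear_order_on_def irrefl_def)
    ultimately show ?thesis
      using that LO_not_less_iff by metis
  qed
  have "\<exists>a b. a \<in> K \<and> b \<in> K \<and> (a, b) \<in> r \<and> (b, a) \<in> s"
    using rs diff[of r s] diff[of s r] by (cases "r \<subseteq> s") blast+
  then obtain a b where ab: "a \<in> K" "b \<in> K" "(a, b) \<in> r" "(b, a) \<in> s"
    by blast
  have "disjnt {r \<in> LO K. (a, b) \<in> r} {r \<in> LO K. (b, a) \<in> r}"
    unfolding disjnt_iff by (blast dest: LO_asym)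
  then show "\<exists>U V. openin (LO_topology K) U \<and> openin (LO_topology K) V \<and> r \<in> U \<and> s \<in> V \<and> disjnt U V"
    using ab rs openin_LO_less[OF ab(1,2)] openin_LO_less[OF ab(2,1)]
    by (intro exI[of _ "{r \<in> LO K. (a, b) \<in> r}"] exI[of _ "{r \<in> LO K. (b, a) \<in> r}"]) simp
qed

text \<open>
  The linear orders on \<open>K\<close> form a closed subset of the cube \<open>bool ^ (K \<times> K)\<close>.
\<close>

lemma compact_LO_topology: "compact_space (LO_topology (K :: 'a set))"
proof -
  define B where "B = product_topology (\<lambda>_. discrete_topology (UNIV :: bool set)) (K \<times> K)"
  define rel where "rel = (\<lambda>c. {x \<in> K \<times> K. c x})"
  define C where "C = {c \<in> topspace B. rel c \<in> LO K}"
  have compact: "compact_space B"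
    unfolding B_def by (simp add: compact_space_product_topology compact_space_discrete_topology)
  have clopen: "openin B {c \<in> topspace B. c x}" "closedin B {c \<in> topspace B. c x}" if "x \<in> K \<times> K" for x
  proof -
    have "continuous_map B (discrete_topology UNIV) (\<lambda>c. c x)"
      unfolding B_def using that by (rule continuous_map_product_projection)
    from openin_continuous_map_preimage[OF this, of "{True}"] closedin_continuous_map_preimage[OF this, of "{True}"]
    show "openin B {c \<in> topspace B. c x}" "closedin B {c \<in> topspace B. c x}"
      by auto
  qed
  have closed_not: "closedin B {c \<in> topspace B. \<not> c x}" if "x \<in> K \<times> K" for x
    using closedin_diff[OF closedin_topspace clopen(1)[OF that]]
    by (rule back_subst[of "closedin B"]) auto
  have closed_Ball: "closedin B {c \<in> topspace B. \<forall>x\<in>A. Q x c}"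
    if "\<And>x. x \<in> A \<Longrightarrow> closedin B {c \<in> topspace B. Q x c}" for A :: "'b set" and Q
  proof (cases "A = {}")
    case False
    then have "{c \<in> topspace B. \<forall>x\<in>A. Q x c} = (\<Inter>x\<in>A. {c \<in> topspace B. Q x c})" by auto
    then show ?thesis
      using that False by (auto intro: closedin_Inter)
  qed simp
  have closed_const: "closedin B {c \<in> topspace B. u}" for u
    by (cases u) simp_all
  have closed_disj: "closedin B {c \<in> topspace B. Q c \<or> R c}"
    if "closedin B {c \<in> topspace B. Q c}" "closedin B {c \<in> topspace B. R c}" for Q R
    using closedin_Un[OF that] by (simp add: Collect_disj_eq[symmetric] conj_disj_distribL)
  define Q where "Q = (\<lambda>(a, b, d) (c :: 'a \<times> 'a \<Rightarrow> bool). \<not> c (a, b) \<or> \<not> c (b, d) \<or> c (a, d))"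
  define R where "R = (\<lambda>(a, b) (c :: 'a \<times> 'a \<Rightarrow> bool). a = b \<or> c (a, b) \<or> c (b, a))"
  have "closedin B {c \<in> topspace B. \<forall>a\<in>K. \<not> c (a, a)}"
    by (intro closed_Ball closed_not) auto
  moreover have "closedin B {c \<in> topspace B. \<forall>x\<in>K \<times> K \<times> K. Q x c}"
    by (intro closed_Ball) (clarsimp simp only: Q_def prod.case mem_Times_iff fst_conv snd_conv split_paired_all,
        intro closed_disj closed_not clopen, auto)
  moreover have "closedin B {c \<in> topspace B. \<forall>x\<in>K \<times> K. R x c}"
    by (intro closed_Ball) (clarsimp simp only: R_def prod.case mem_Times_iff fst_conv snd_conv split_paired_all,
        intro closed_disj clopen closed_const, auto)
  moreover have "C = {c \<in> topspace B. \<forall>a\<in>K. \<not> c (a, a)} \<inter> {c \<in> topspace B. \<forall>x\<in>K \<times> K \<times> K. Q x c}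
      \<inter> {c \<in> topspace B. \<forall>x\<in>K \<times> K. R x c}"
  proof -
    have I: "irrefl (rel c) \<longleftrightarrow> (\<forall>a\<in>K. \<not> c (a, a))" for c
      by (auto simp: irrefl_def rel_def)
    have T: "trans (rel c) \<longleftrightarrow> (\<forall>x\<in>K \<times> K \<times> K. Q x c)" for c
      by (simp add: trans_def rel_def Q_def) blast
    have O: "total_on K (rel c) \<longleftrightarrow> (\<forall>x\<in>K \<times> K. R x c)" for c
      by (simp add: total_on_def rel_def R_def) blast
    have S: "rel c \<subseteq> K \<times> K" for c
      by (auto simp: rel_def)
    have "rel c \<in> LO K \<longleftrightarrow>
        (\<forall>a\<in>K. \<not> c (a, a)) \<and> (\<forall>x\<in>K \<times> K \<times> K. Q x c) \<and> (\<forall>x\<in>K \<times> K. R x c)" for c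
      by (simp only: LO_def strict_linear_order_on_def mem_Collect_eq I T O S simp_thms conj_ac)
    then show ?thesis
      unfolding C_def by (simp only: Collect_conj_eq[symmetric] conj_ac simp_thms)
  qed
  ultimately have "closedin B C"
    by (simp only: closedin_Int)
  then have "compact_space (subtopology B C)"
    using compact by (simp add: closedin_compact_space compact_space_subtopology)
  moreover have "continuous_map (subtopology B C) (LO_topology K) rel"
  proof (rule continuous_map_into_LO)
    fix a b assume "a \<in> K" "b \<in> K"
    then have "openin (subtopology B C) ({c \<in> topspace B. c (a, b)} \<inter> C)"
      using clopen(1) by (auto intro: openin_subtopology_Int)
    moreover have "{c \<in> topspace B. c (a, b)} \<inter> C = {c \<in> topspace (subtopology B C). (a, b) \<in> rel c}"
      using \<open>a \<in> K\<close> \<open>b \<in> K\<close> by (auto simp: rel_def)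
    ultimately show "openin (subtopology B C) {c \<in> topspace (subtopology B C). (a, b) \<in> rel c}"
      by simp
  qed (auto simp: C_def)
  moreover have "rel ` topspace (subtopology B C) = LO K"
  proof
    show "LO K \<subseteq> rel ` topspace (subtopology B C)"
    proof
      fix r assume "r \<in> LO K"
      then have "rel (\<lambda>x\<in>K \<times> K. x \<in> r) = r"
        by (auto simp: rel_def LO_def)
      moreover have "(\<lambda>x\<in>K \<times> K. x \<in> r) \<in> C"
        using calculation \<open>r \<in> LO K\<close> by (auto simp: C_def B_def)
      ultimately show "r \<in> rel ` topspace (subtopology B C)"
        by (intro image_eqI[of r rel "\<lambda>x\<in>K \<times> K. x \<in> r"]) (auto simp: C_def)
    qed
  qed (auto simp: C_def)
  ultimately show ?thesis
    using image_compactin[of "subtopology B C" "topspace (subtopology B C)" "LO_topology K" rel]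
    by (simp only: compact_space_def topspace_LO_topology)
qed

section \<open>Dense subgroups of products of symmetric groups\<close>

lemma openin_finite_Ball:
  assumes "finite F" "\<And>x. x \<in> F \<Longrightarrow> openin Z {z \<in> topspace Z. P x z}"
  shows "openin Z {z \<in> topspace Z. \<forall>x\<in>F. P x z}"
  using assms
proof (induction F)
  case (insert x F)
  have "{z \<in> topspace Z. \<forall>y\<in>insert x F. P y z} =
      {z \<in> topspace Z. P x z} \<inter> {z \<in> topspace Z. \<forall>y\<in>F. P y z}"
    by auto
  then show ?case
    using insert by (simp add: openin_Int)
qed simp

text \<open>
  Lifts a description of neighbourhoods by finite sets of points from the factors to the product. Here
  \<open>E i A y\<close> is to be read as: \<open>y\<close> agrees with \<open>x i\<close> on the finite set \<open>A\<close>.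
\<close>

lemma product_topology_finite_nbhd:
  assumes V: "openin (product_topology X I) V" "x \<in> V"
    and nbhd: "\<And>i U. i \<in> I \<Longrightarrow> openin (X i) U \<Longrightarrow> x i \<in> U \<Longrightarrow>
      \<exists>A. finite A \<and> A \<subseteq> K i \<and> (\<forall>y\<in>topspace (X i). E i A y \<longrightarrow> y \<in> U)"
  obtains F where "finite F" "F \<subseteq> Sigma I K"
    "\<And>y. y \<in> topspace (product_topology X I) \<Longrightarrow> (\<And>i. i \<in> I \<Longrightarrow> E i {a. (i, a) \<in> F} (y i)) \<Longrightarrow> y \<in> V"
proof -
  obtain U where U: "finite {i \<in> I. U i \<noteq> topspace (X i)}" "\<And>i. i \<in> I \<Longrightarrow> openin (X i) (U i)"
    "x \<in> Pi\<^sub>E I U" "Pi\<^sub>E I U \<subseteq> V"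
    using V unfolding openin_product_topology_alt by meson
  define J where "J = {i \<in> I. U i \<noteq> topspace (X i)}"
  have "\<exists>A. finite A \<and> A \<subseteq> K i \<and> (\<forall>y\<in>topspace (X i). E i A y \<longrightarrow> y \<in> U i)" if "i \<in> J" for i
    using that U(2,3) by (intro nbhd) (auto simp: J_def)
  then obtain A where A: "\<And>i. i \<in> J \<Longrightarrow> finite (A i)" "\<And>i. i \<in> J \<Longrightarrow> A i \<subseteq> K i"
    "\<And>i y. i \<in> J \<Longrightarrow> y \<in> topspace (X i) \<Longrightarrow> E i (A i) y \<Longrightarrow> y \<in> U i"
    by metis
  show ?thesis
  proof
    show "finite (Sigma J A)"
      using U(1) A(1) by (auto simp: J_def)
    show "Sigma J A \<subseteq> Sigma I K"
      using A(2) by (auto simp: J_def)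
    fix y assume y: "y \<in> topspace (product_topology X I)"
      "\<And>i. i \<in> I \<Longrightarrow> E i {a. (i, a) \<in> Sigma J A} (y i)"
    have "y i \<in> U i" if "i \<in> I" for i
    proof (cases "i \<in> J")
      case True
      then show ?thesis
        using A(3)[of i "y i"] y(1) y(2)[OF that] that by (simp add: PiE_iff)
    next
      case False
      then show ?thesis
        using y(1) that by (auto simp: J_def PiE_iff)
    qed
    then have "y \<in> Pi\<^sub>E I U"
      using y(1) by (simp add: PiE_iff)
    then show "y \<in> V"
      using U(4) by blast
  qed
qed

lemma topspace_Sym_topology [simp]: "topspace (Sym_topology K) = Bij K"
  unfolding Sym_topology_def by (auto simp: BijGroup_def Bij_def bij_betw_def PiE_iff extensional_def)

lemma Sym_nbhd:
  assumes "openin (Sym_topology K) U" "f \<in> U"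
  shows "\<exists>A. finite A \<and> A \<subseteq> K \<and> (\<forall>h\<in>topspace (Sym_topology K). (\<forall>a\<in>A. h a = f a) \<longrightarrow> h \<in> U)"
proof -
  obtain V where V: "openin (product_topology (\<lambda>_. discrete_topology K) K) V" "U = V \<inter> Bij K"
    using assms(1) unfolding Sym_topology_def openin_subtopology by (auto simp: BijGroup_def)
  then have "f \<in> V"
    using assms(2) by auto
  then obtain W where W: "finite {i \<in> K. W i \<noteq> topspace (discrete_topology K)}" 
    "f \<in> Pi\<^sub>E K W" "Pi\<^sub>E K W \<subseteq> V"
    using V(1) unfolding openin_product_topology_alt by meson
  show ?thesis
  proof (intro exI[of _ "{i \<in> K. W i \<noteq> topspace (discrete_topology K)}"] conjI ballI impI)
    fix h assume h: "h \<in> topspace (Sym_topology K)"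
      "\<forall>a\<in>{i \<in> K. W i \<noteq> topspace (discrete_topology K)}. h a = f a"
    have "h a \<in> W a" if "a \<in> K" for a
      using that h W(2) Bij_imp_funcset[of h K] by (cases "W a = K") (auto simp: PiE_iff)
    then have "h \<in> Pi\<^sub>E K W"
      using h by (auto simp: PiE_iff Bij_def)
    then show "h \<in> U"
      using h W(3) V(2) by auto
  qed (use W(1) in auto)
qed

lemma Sym_prod_nbhd:
  assumes "openin (Sym_prod_topology I K) V" "s \<in> V"
  obtains F where "finite F" "F \<subseteq> Sigma I K"
    "\<And>t. t \<in> topspace (Sym_prod_topology I K) \<Longrightarrow> (\<And>i a. (i, a) \<in> F \<Longrightarrow> t i a = s i a) \<Longrightarrow> t \<in> V"
proof (rule product_topology_finite_nbhd[OF assms(1)[unfolded Sym_prod_topology_def] assms(2),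
      where E = "\<lambda>i A f. \<forall>a\<in>A. f a = s i a" and K = K])
  show "\<exists>A. finite A \<and> A \<subseteq> K i \<and> (\<forall>f\<in>topspace (Sym_topology (K i)). (\<forall>a\<in>A. f a = s i a) \<longrightarrow> f \<in> U)"
    if "openin (Sym_topology (K i)) U" "s i \<in> U" for i U
    using Sym_nbhd[OF that] .
  fix F assume F: "finite F" "F \<subseteq> Sigma I K"
    "\<And>t. t \<in> topspace (product_topology (\<lambda>i. Sym_topology (K i)) I) \<Longrightarrow>
      (\<And>i. i \<in> I \<Longrightarrow> \<forall>a\<in>{a. (i, a) \<in> F}. t i a = s i a) \<Longrightarrow> t \<in> V"
  show thesis
    using F(1,2) by (rule that) (rule F(3), simp_all add: Sym_prod_topology_def)
qed

lemma LO_nbhd: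
  assumes "openin (LO_topology K) U" "r \<in> U"
  shows "\<exists>A. finite A \<and> A \<subseteq> K \<and> (\<forall>s\<in>topspace (LO_topology K). s \<inter> A \<times> A = r \<inter> A \<times> A \<longrightarrow> s \<in> U)"
proof -
  have "generate_topology_on {{r \<in> LO K. s \<subseteq> r} | F s. finite F \<and> F \<subseteq> K \<and> s \<in> LO F} U"
    using assms(1) unfolding LO_topology_def openin_topology_generated_by_iff .
  then show ?thesis
    using assms(2)
  proof (induction arbitrary: r)
    case (Int U V)
    have "r \<in> U" "r \<in> V"
      using Int.prems by auto
    from Int.IH(1)[OF this(1)] obtain A where A: "finite A" "A \<subseteq> K"
      and U: "\<forall>s\<in>topspace (LO_topology K). s \<inter> A \<times> A = r \<inter> A \<times> A \<longrightarrow> s \<in> U"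
      by (elim exE conjE) (rule that)
    from Int.IH(2)[OF \<open>r \<in> V\<close>] obtain B where B: "finite B" "B \<subseteq> K"
      and V: "\<forall>s\<in>topspace (LO_topology K). s \<inter> B \<times> B = r \<inter> B \<times> B \<longrightarrow> s \<in> V"
      by (elim exE conjE) (rule that)
    have "s \<in> U \<inter> V"
      if s: "s \<in> topspace (LO_topology K)" "s \<inter> (A \<union> B) \<times> (A \<union> B) = r \<inter> (A \<union> B) \<times> (A \<union> B)" for s
    proof -
      have restrict: "s \<inter> C \<times> C = r \<inter> C \<times> C" if "C \<subseteq> A \<union> B" for C
      proof -
        have "C \<times> C = (A \<union> B) \<times> (A \<union> B) \<inter> C \<times> C"
          using that by auto
        then show ?thesis
          using s(2) by (metis inf_assoc)
      qed
      show ?thesis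
        using U V s(1) restrict[of A] restrict[of B] by simp
    qed
    with A B show ?case
      by (intro exI[of _ "A \<union> B"]) simp
  next
    case (UN \<U>)
    then obtain U where U: "U \<in> \<U>" "r \<in> U" by blast
    from UN.IH[OF this] obtain A where "finite A" "A \<subseteq> K"
      "\<forall>s\<in>topspace (LO_topology K). s \<inter> A \<times> A = r \<inter> A \<times> A \<longrightarrow> s \<in> U"
      by (elim exE conjE) (rule that)
    with U show ?case
      by (intro exI[of _ A] conjI ballI impI UnionI[of U]) simp_all
  next
    case (Basis U)
    from Basis.hyps obtain F s where U: "U = {r \<in> LO K. s \<subseteq> r}" "finite F" "F \<subseteq> K" "s \<in> LO F"
      by (elim CollectE exE conjE) (rule that)
    have "s' \<in> U" if "s' \<in> LO K" "s' \<inter> F \<times> F = r \<inter> F \<times> F" for s'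
    proof -
      have "s \<subseteq> r \<inter> F \<times> F"
        using Basis.prems U by (simp add: LO_def)
      then show ?thesis
        using that U(1) by blast
    qed
    with U(2,3) show ?case
      by (intro exI[of _ F]) simp
  qed simp
qed

lemma openin_Sym_prod_value:
  assumes "i \<in> I" "a \<in> K i"
  shows "openin (Sym_prod_topology I K) {s \<in> topspace (Sym_prod_topology I K). s i a = c}"
proof -
  have "continuous_map (Sym_prod_topology I K) (Sym_topology (K i)) (\<lambda>s. s i)"
    unfolding Sym_prod_topology_def using assms(1) by (rule continuous_map_product_projection)
  moreover have "continuous_map (Sym_topology (K i)) (discrete_topology (K i)) (\<lambda>f. f a)"
    unfolding Sym_topology_def using assms(2)
    by (intro continuous_map_from_subtopology continuous_map_product_projection)
  ultimately have "continuous_map (Sym_prod_topology I K) (discrete_topology (K i)) ((\<lambda>f. f a) \<circ> (\<lambda>s. s i))"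
    by (rule continuous_map_compose)
  from openin_continuous_map_preimage[OF this, of "{c} \<inter> K i"] 
  have "openin (Sym_prod_topology I K) {s \<in> topspace (Sym_prod_topology I K). s i a \<in> {c} \<inter> K i}"
    by simp
  moreover have "s i a \<in> K i" if "s \<in> topspace (Sym_prod_topology I K)" for s
    using that assms Bij_imp_funcset[of "s i" "K i"] by (auto simp: Sym_prod_topology_def PiE_iff)
  then have "{s \<in> topspace (Sym_prod_topology I K). s i a \<in> {c} \<inter> K i} =
      {s \<in> topspace (Sym_prod_topology I K). s i a = c}"
    by auto
  ultimately show ?thesis
    by simp
qed

lemma group_actionI:
  fixes G (structure)
  assumes "group G"
    and "\<And>g. g \<in> carrier G \<Longrightarrow> act g \<in> extensional E"
    and "\<And>g x. g \<in> carrier G \<Longrightarrow> x \<in> E \<Longrightarrow> act g x \<in> E"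
    and "\<And>x. x \<in> E \<Longrightarrow> act \<one> x = x"
    and "\<And>g h x. g \<in> carrier G \<Longrightarrow> h \<in> carrier G \<Longrightarrow> x \<in> E \<Longrightarrow> act (g \<otimes> h) x = act g (act h x)"
  shows "group_action G E act"
proof -
  interpret group G by fact
  have bij: "act g \<in> Bij E" if g: "g \<in> carrier G" for g
  proof -
    have "act (inv g) (act g x) = x" "act g (act (inv g) x) = x" if "x \<in> E" for x
      using assms(4)[OF that] assms(5)[of "inv g" g x] assms(5)[of g "inv g" x] g that by auto
    then have "bij_betw (act g) E E"
      using assms(3) g by (intro bij_betw_byWitness[where f' = "act (inv g)"]) auto
    then show ?thesis
      using assms(2)[OF g] by (simp add: Bij_def)
  qed
  have "act \<in> hom G (BijGroup E)"
  proof (rule homI)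
    fix g h assume gh: "g \<in> carrier G" "h \<in> carrier G"
    have "act (g \<otimes> h) = compose E (act g) (act h)"
      using gh assms by (intro extensionalityI[of _ E]) (auto simp: compose_def)
    then show "act (g \<otimes> h) = act g \<otimes>\<^bsub>BijGroup E\<^esub> act h"
      using bij gh by (simp add: BijGroup_def)
  qed (simp add: bij BijGroup_def)
  then show ?thesis
    by (simp add: group_action_def group_hom_def group_hom_axioms_def group_BijGroup assms(1))
qed

text \<open>
  The group is given abstractly with an embedding, because the group of homeomorphisms consists of
  functions on \<open>X\<close> and not of families of permutations.
\<close>

locale dense_subgroup_of_Sym_prod = group G for G (structure) +
  fixes T :: "'g topology" and I :: "'i set" and K :: "'i \<Rightarrow> 'k set" and emb :: "'g \<Rightarrow> 'i \<Rightarrow> 'k \<Rightarrow> 'k"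
  assumes topspace_T: "topspace T = carrier G"
    and emb_hom: "emb \<in> hom G (Sym_prod I K)"
    and emb_embedding: "embedding_map T (Sym_prod_topology I K) emb"
    and emb_dense: "Sym_prod_topology I K closure_of (emb ` carrier G) = topspace (Sym_prod_topology I K)"
begin

definition pts :: "('i \<times> 'k) set" where
  "pts = Sigma I K"

definition perm :: "'g \<Rightarrow> 'i \<times> 'k \<Rightarrow> 'i \<times> 'k" where
  "perm g x = (fst x, emb g (fst x) (snd x))"

lemma fst_perm [simp]: "fst (perm g x) = fst x"
  by (simp add: perm_def)

lemma topspace_Sym_prod: "topspace (Sym_prod_topology I K) = (\<Pi>\<^sub>E i\<in>I. Bij (K i))"
  by (simp add: Sym_prod_topology_def)

lemma emb_in: "g \<in> carrier G \<Longrightarrow> emb g \<in> (\<Pi>\<^sub>E i\<in>I. Bij (K i))"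
  using hom_in_carrier[OF emb_hom, of g] by (simp add: Sym_prod_def BijGroup_def)

lemma emb_Bij: "g \<in> carrier G \<Longrightarrow> i \<in> I \<Longrightarrow> emb g i \<in> Bij (K i)"
  using emb_in by (auto simp: PiE_iff)

lemma group_Sym_prod: "group (Sym_prod I K)"
  by (simp add: Sym_prod_def group_BijGroup)

lemma group_hom_emb: "group_hom G (Sym_prod I K) emb"
  by (simp add: group_hom_def group_hom_axioms_def group_Sym_prod emb_hom)

lemma emb_mult:
  assumes "g \<in> carrier G" "h \<in> carrier G" "i \<in> I" "a \<in> K i"
  shows "emb (g \<otimes> h) i a = emb g i (emb h i a)"
  using hom_mult[OF emb_hom assms(1,2)] emb_Bij assms
  by (simp add: Sym_prod_def BijGroup_def compose_def)

lemma emb_one: "i \<in> I \<Longrightarrow> a \<in> K i \<Longrightarrow> emb \<one> i a = a"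
  using group_hom.hom_one[OF group_hom_emb] by (simp add: Sym_prod_def BijGroup_def)

lemma emb_inv: "g \<in> carrier G \<Longrightarrow> i \<in> I \<Longrightarrow> inv\<^bsub>Sym (K i)\<^esub> (emb g i) = emb (inv g) i"
  using group_hom.hom_inv[OF group_hom_emb] emb_in
  by (simp add: Sym_prod_def group_BijGroup BijGroup_def[of "K _", THEN arg_cong[of _ _ carrier]])

lemma perm_closed [simp]: "g \<in> carrier G \<Longrightarrow> x \<in> pts \<Longrightarrow> perm g x \<in> pts"
  using emb_Bij Bij_imp_funcset by (fastforce simp: pts_def perm_def)

lemma perm_mult: "g \<in> carrier G \<Longrightarrow> h \<in> carrier G \<Longrightarrow> x \<in> pts \<Longrightarrow> perm (g \<otimes> h) x = perm g (perm h x)"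
  by (auto simp: pts_def perm_def emb_mult)

lemma perm_one [simp]: "x \<in> pts \<Longrightarrow> perm \<one> x = x"
  by (auto simp: pts_def perm_def emb_one)

lemma perm_inv [simp]:
  assumes "g \<in> carrier G" "x \<in> pts"
  shows "perm (inv g) (perm g x) = x" "perm g (perm (inv g) x) = x"
  using assms perm_mult[of "inv g" g x] perm_mult[of g "inv g" x] by auto

lemma inj_on_perm: "g \<in> carrier G \<Longrightarrow> inj_on (perm g) pts"
  by (metis inj_on_inverseI perm_inv(1))

lemma openin_perm:
  assumes "x \<in> pts"
  shows "openin T {g \<in> carrier G. perm g x = y}"
proof (cases "fst y = fst x")
  case True
  have "continuous_map T (Sym_prod_topology I K) emb"
    using emb_embedding homeomorphic_imp_continuous_map continuous_map_in_subtopology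
    unfolding embedding_map_def by blast
  then have "openin T {g \<in> topspace T. emb g \<in> {s \<in> topspace (Sym_prod_topology I K). s (fst x) (snd x) = snd y}}"
    using openin_continuous_map_preimage[OF _ openin_Sym_prod_value[of "fst x" I "snd x" K "snd y"]] assms
    by (auto simp: pts_def)
  moreover have "{g \<in> topspace T. emb g \<in> {s \<in> topspace (Sym_prod_topology I K). s (fst x) (snd x) = snd y}} =
      {g \<in> carrier G. perm g x = y}"
    using True emb_in by (auto simp: topspace_T topspace_Sym_prod perm_def prod_eq_iff)
  ultimately show ?thesis
    by simp
next
  case False
  then have "{g \<in> carrier G. perm g x = y} = {}"
    by (auto simp: perm_def)
  then show ?thesis
    by (simp only: openin_empty)
qed

lemma T_nbhd:
  assumes "openin T U" "g \<in> U"
  obtains F where "finite F" "F \<subseteq> pts" "\<And>h. h \<in> carrier G \<Longrightarrow> (\<And>x. x \<in> F \<Longrightarrow> perm h x = perm g x) \<Longrightarrow> h \<in> U"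
proof -
  have U: "U \<subseteq> carrier G" "g \<in> carrier G"
    using assms openin_subset[OF assms(1)] by (auto simp: topspace_T)
  have hm: "homeomorphic_map T (subtopology (Sym_prod_topology I K) (emb ` topspace T)) emb"
    using emb_embedding by (simp add: embedding_map_def)
  then have "openin (subtopology (Sym_prod_topology I K) (emb ` topspace T)) (emb ` U)"
    using assms(1) U homeomorphic_map_openness by (metis topspace_T)
  then obtain V where V: "openin (Sym_prod_topology I K) V" "emb ` U = V \<inter> emb ` carrier G"
    by (auto simp: openin_subtopology topspace_T)
  have inj: "inj_on emb (carrier G)"
    using homeomorphic_imp_injective_map[OF hm] by (simp add: topspace_T)
  have "emb g \<in> V"
    using V(2) assms(2) by blast
  obtain F where F: "finite F" "F \<subseteq> Sigma I K"
    "\<And>t. t \<in> topspace (Sym_prod_topology I K) \<Longrightarrow> (\<And>i a. (i, a) \<in> F \<Longrightarrow> t i a = emb g i a) \<Longrightarrow> t \<in> V"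
    using Sym_prod_nbhd[OF V(1) \<open>emb g \<in> V\<close>] by blast
  show ?thesis
  proof
    show "finite F" "F \<subseteq> pts"
      using F by (auto simp: pts_def)
    fix h assume h: "h \<in> carrier G" "\<And>x. x \<in> F \<Longrightarrow> perm h x = perm g x"
    have "emb h i a = emb g i a" if "(i, a) \<in> F" for i a
      using h(2)[OF that] by (simp add: perm_def)
    then have "emb h \<in> V"
      using emb_in[OF h(1)] by (intro F(3)) (auto simp: topspace_Sym_prod)
    then have "emb h \<in> emb ` U"
      using V(2) h(1) by blast
    then show "h \<in> U"
      using inj h(1) U(1) by (auto dest: inj_onD)
  qed
qed

text \<open>
  The topology of \<open>G\<close> is the topology of pointwise convergence on the discrete set \<open>pts\<close>.
\<close>

lemma continuous_map_into_T:
  assumes "h \<in> topspace Z \<rightarrow> carrier G"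
    and op: "\<And>x y. x \<in> pts \<Longrightarrow> y \<in> pts \<Longrightarrow> openin Z {z \<in> topspace Z. perm (h z) x = y}"
  shows "continuous_map Z T h"
  unfolding continuous_map
proof (intro conjI allI impI)
  show "h ` topspace Z \<subseteq> topspace T"
    using assms(1) by (auto simp: topspace_T)
  fix U assume U: "openin T U"
  show "openin Z {z \<in> topspace Z. h z \<in> U}"
  proof (subst openin_subopen, intro ballI)
    fix z assume z: "z \<in> {z \<in> topspace Z. h z \<in> U}"
    then obtain F where F: "finite F" "F \<subseteq> pts"
      "\<And>g. g \<in> carrier G \<Longrightarrow> (\<And>x. x \<in> F \<Longrightarrow> perm g x = perm (h z) x) \<Longrightarrow> g \<in> U"
      using T_nbhd[OF U, of "h z"] by blast
    have "openin Z {w \<in> topspace Z. \<forall>x\<in>F. perm (h w) x = perm (h z) x}"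
      using F(1,2) z assms(1) by (intro openin_finite_Ball op perm_closed) auto
    moreover have "{w \<in> topspace Z. \<forall>x\<in>F. perm (h w) x = perm (h z) x} \<subseteq> {z \<in> topspace Z. h z \<in> U}"
      using F(3) assms(1) by blast
    ultimately show "\<exists>V. openin Z V \<and> z \<in> V \<and> V \<subseteq> {z \<in> topspace Z. h z \<in> U}"
      using z by (intro exI[of _ "{w \<in> topspace Z. \<forall>x\<in>F. perm (h w) x = perm (h z) x}"]) auto
  qed
qed

lemma perm_separates:
  assumes "g \<in> carrier G" "h \<in> carrier G" "\<And>x. x \<in> pts \<Longrightarrow> perm g x = perm h x"
  shows "g = h"
proof -
  have "emb g i a = emb h i a" if "i \<in> I" "a \<in> K i" for i a
    using assms(3)[of "(i, a)"] that by (simp add: pts_def perm_def)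
  then have "emb g = emb h"
    using emb_in[OF assms(1)] emb_in[OF assms(2)] emb_Bij assms
    by (intro PiE_ext[of _ I "\<lambda>i. Bij (K i)"] extensionalityI[of _ "K _"]) (auto simp: Bij_def)
  moreover have "inj_on emb (carrier G)"
    using emb_embedding homeomorphic_imp_injective_map by (fastforce simp: embedding_map_def topspace_T)
  ultimately show ?thesis
    using assms by (auto dest: inj_onD)
qed

lemma topological_group: "topological_group G T"
proof
  show "topspace T = carrier G" by (rule topspace_T)
  show "Hausdorff_space T"
    unfolding Hausdorff_space_def topspace_T
  proof (intro allI impI)
    fix g h assume gh: "g \<in> carrier G \<and> h \<in> carrier G \<and> g \<noteq> h"
    then obtain x where x: "x \<in> pts" "perm g x \<noteq> perm h x"
      using perm_separates by blast
    show "\<exists>U V. openin T U \<and> openin T V \<and> g \<in> U \<and> h \<in> V \<and> disjnt U V"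
      using gh x openin_perm[OF x(1), of "perm g x"] openin_perm[OF x(1), of "perm h x"]
      by (intro exI[of _ "{k \<in> carrier G. perm k x = perm g x}"] exI[of _ "{k \<in> carrier G. perm k x = perm h x}"])
        (auto simp: disjnt_iff)
  qed
  show "continuous_map (prod_topology T T) T (\<lambda>(g, h). g \<otimes> h)"
  proof (rule continuous_map_into_T)
    fix x y assume x: "x \<in> pts"
    (* For a product to send x to y, the right factor sends x to some w and the left one sends w to y. *)
    have "openin (prod_topology T T) (\<Union>w\<in>pts. {g \<in> carrier G. perm g w = y} \<times> {g \<in> carrier G. perm g x = w})"
      using x by (intro openin_Union) (auto simp: openin_prod_Times_iff openin_perm)
    moreover have "(\<Union>w\<in>pts. {g \<in> carrier G. perm g w = y} \<times> {g \<in> carrier G. perm g x = w}) =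
        {z \<in> topspace (prod_topology T T). perm (case z of (g, h) \<Rightarrow> g \<otimes> h) x = y}"
      using x by (auto simp: topspace_T perm_mult)
    ultimately show "openin (prod_topology T T) {z \<in> topspace (prod_topology T T). perm (case z of (g, h) \<Rightarrow> g \<otimes> h) x = y}"
      by simp
  qed (auto simp: topspace_T)
  show "continuous_map T T (\<lambda>g. inv g)"
  proof (rule continuous_map_into_T)
    fix x y assume "x \<in> pts" "y \<in> pts"
    then have "{z \<in> topspace T. perm (inv z) x = y} = {g \<in> carrier G. perm g y = x}"
      by (auto simp: topspace_T)
    then show "openin T {z \<in> topspace T. perm (inv z) x = y}"
      using openin_perm[OF \<open>y \<in> pts\<close>] by simp
  qed (auto simp: topspace_T)
qed

text \<open>
  The finite injection extends to a permutation in each factor separately; density then yields an element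
  of \<open>G\<close> that agrees with this family of permutations on \<open>F\<close>.
\<close>

lemma finite_partial_permutation_extends:
  assumes "finite F" "F \<subseteq> pts" "inj_on m F" "m ` F \<subseteq> pts" "\<And>x. x \<in> F \<Longrightarrow> fst (m x) = fst x"
  obtains g where "g \<in> carrier G" "\<And>x. x \<in> F \<Longrightarrow> perm g x = m x"
proof -
  have "\<exists>f. f \<in> Bij (K i) \<and> (\<forall>a. (i, a) \<in> F \<longrightarrow> f a = snd (m (i, a)))" if "i \<in> I" for i
  proof -
    have "finite {a. (i, a) \<in> F}"
      using finite_vimageI[OF assms(1), of "Pair i"] by (simp add: vimage_def inj_def)
    moreover have "inj_on (\<lambda>a. snd (m (i, a))) {a. (i, a) \<in> F}"
      using assms(3,5) by (auto simp: inj_on_def prod_eq_iff)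
    moreover have "m (i, a) \<in> pts" "fst (m (i, a)) = i" if "(i, a) \<in> F" for a
      using that assms(4,5) by auto
    then have "(\<lambda>a. snd (m (i, a))) ` {a. (i, a) \<in> F} \<subseteq> K i"
      by (fastforce simp: pts_def)
    moreover have "{a. (i, a) \<in> F} \<subseteq> K i"
      using assms(2) by (auto simp: pts_def)
    ultimately obtain f where "f \<in> Bij (K i)" "\<And>a. a \<in> {a. (i, a) \<in> F} \<Longrightarrow> f a = snd (m (i, a))"
      using finite_injection_extends_to_permutation[of "{a. (i, a) \<in> F}" "K i" "\<lambda>a. snd (m (i, a))"] by blast
    then show ?thesis by blast
  qed
  then obtain f where f: "\<And>i. i \<in> I \<Longrightarrow> f i \<in> Bij (K i)"
    "\<And>i a. i \<in> I \<Longrightarrow> (i, a) \<in> F \<Longrightarrow> f i a = snd (m (i, a))"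
    by metis
  define s where "s = (\<lambda>i\<in>I. f i)"
  have s: "s \<in> topspace (Sym_prod_topology I K)"
    using f(1) by (auto simp: s_def topspace_Sym_prod)
  let ?V = "{t \<in> topspace (Sym_prod_topology I K). \<forall>x\<in>F. t (fst x) (snd x) = s (fst x) (snd x)}"
  have "openin (Sym_prod_topology I K) ?V"
    using assms(1,2) by (intro openin_finite_Ball openin_Sym_prod_value) (auto simp: pts_def)
  moreover have "s \<in> Sym_prod_topology I K closure_of (emb ` carrier G)"
    using s emb_dense by simp
  moreover have "s \<in> ?V"
    using s by simp
  ultimately have "\<exists>t. t \<in> emb ` carrier G \<and> t \<in> ?V"
    unfolding in_closure_of by (elim conjE allE[where x = ?V]) simp
  then obtain g where g: "g \<in> carrier G" "\<And>x. x \<in> F \<Longrightarrow> emb g (fst x) (snd x) = s (fst x) (snd x)"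
    by auto
  have "perm g x = m x" if "x \<in> F" for x
    using g(2)[OF that] that f(2)[of "fst x" "snd x"] assms(2,5)
    by (auto simp: perm_def s_def pts_def prod_eq_iff)
  with g(1) show ?thesis
    using that by blast
qed

end

section \<open>The flow of linear orders\<close>

context dense_subgroup_of_Sym_prod
begin

abbreviation ords_space :: "('i \<Rightarrow> 'k rel) topology" where
  "ords_space \<equiv> LO_prod_topology I K"

abbreviation ords :: "('i \<Rightarrow> 'k rel) set" where
  "ords \<equiv> topspace ords_space"

definition oact :: "'g \<Rightarrow> ('i \<Rightarrow> 'k rel) \<Rightarrow> ('i \<Rightarrow> 'k rel)" where
  "oact g = LO_prod_act I K (emb g)"

text \<open>
  The disjoint sum of the orders \<open>p i\<close>.
\<close>

definition flat :: "('i \<Rightarrow> 'k rel) \<Rightarrow> ('i \<times> 'k) rel" where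
  "flat p = {(x, y) \<in> pts \<times> pts. fst x = fst y \<and> (snd x, snd y) \<in> p (fst x)}"

definition pattern :: "('i \<times> 'k) set \<Rightarrow> ('i \<Rightarrow> 'k rel) \<Rightarrow> ('i \<times> 'k) rel" where
  "pattern F p = flat p \<inter> F \<times> F"

lemma ords_iff: "p \<in> ords \<longleftrightarrow> p \<in> (\<Pi>\<^sub>E i\<in>I. LO (K i))"
  by (simp add: LO_prod_topology_def)

lemma ords_LO: "p \<in> ords \<Longrightarrow> i \<in> I \<Longrightarrow> p i \<in> LO (K i)"
  by (auto simp: ords_iff PiE_iff)

lemma flat_injective:
  assumes "p \<in> ords" "q \<in> ords" "flat p = flat q"
  shows "p = q"
proof (rule PiE_ext[of _ I "\<lambda>i. LO (K i)"])
  fix i assume i: "i \<in> I"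
  have "p i \<subseteq> K i \<times> K i" "q i \<subseteq> K i \<times> K i"
    using ords_LO[OF _ i] assms by (auto simp: LO_def)
  moreover have "(a, b) \<in> p i \<longleftrightarrow> (a, b) \<in> q i" if "a \<in> K i" "b \<in> K i" for a b
  proof -
    have "((i, a), (i, b)) \<in> flat p \<longleftrightarrow> ((i, a), (i, b)) \<in> flat q"
      using assms(3) by simp
    then show ?thesis
      using that i by (simp add: flat_def pts_def)
  qed
  ultimately show "p i = q i"
    by blast
qed (use assms ords_iff in auto)

lemma oact_apply:
  assumes "p \<in> ords" "g \<in> carrier G" "i \<in> I"
  shows "oact g p i = {(a, b) \<in> K i \<times> K i. (emb (inv g) i a, emb (inv g) i b) \<in> p i}"
  using assms by (simp add: oact_def LO_prod_act_def LO_act_def emb_inv)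

lemma oact_closed:
  assumes p: "p \<in> ords" and g: "g \<in> carrier G"
  shows "oact g p \<in> ords"
proof -
  have "oact g p i \<in> LO (K i)" if i: "i \<in> I" for i
  proof -
    define f where "f = emb (inv g) i"
    have f: "inj_on f (K i)" "f ` K i = K i"
      using emb_Bij[of "inv g" i] g i by (auto simp: f_def Bij_def bij_betw_def)
    have r: "trans (p i)" "irrefl (p i)" "total_on (K i) (p i)"
      using ords_LO[OF p i] by (auto simp: LO_def strict_linear_order_on_def)
    have "trans {(a, b) \<in> K i \<times> K i. (f a, f b) \<in> p i}"
      using r(1) by (auto simp: trans_def)
    moreover have "irrefl {(a, b) \<in> K i \<times> K i. (f a, f b) \<in> p i}"
      using r(2) by (auto simp: irrefl_def)
    moreover have "total_on (K i) {(a, b) \<in> K i \<times> K i. (f a, f b) \<in> p i}"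
      unfolding total_on_def
    proof (intro ballI impI)
      fix a b assume ab: "a \<in> K i" "b \<in> K i" "a \<noteq> b"
      then have "f a \<in> K i" "f b \<in> K i" "f a \<noteq> f b"
        using f by (auto dest: inj_onD)
      then have "(f a, f b) \<in> p i \<or> (f b, f a) \<in> p i"
        using r(3) by (simp add: total_on_def)
      then show "(a, b) \<in> {(a, b) \<in> K i \<times> K i. (f a, f b) \<in> p i} \<or>
          (b, a) \<in> {(a, b) \<in> K i \<times> K i. (f a, f b) \<in> p i}"
        using ab by simp
    qed
    ultimately show ?thesis
      using oact_apply[OF p g i] by (auto simp: LO_def strict_linear_order_on_def f_def)
  qed
  moreover have "oact g p \<in> extensional I"
    using p by (simp add: oact_def LO_prod_act_def)
  ultimately show ?thesis
    by (simp add: ords_iff PiE_iff)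
qed

lemma flat_oact_iff:
  assumes "p \<in> ords" "g \<in> carrier G" "x \<in> pts" "y \<in> pts"
  shows "(x, y) \<in> flat (oact g p) \<longleftrightarrow> (perm (inv g) x, perm (inv g) y) \<in> flat p"
proof -
  have "perm (inv g) x \<in> pts" "perm (inv g) y \<in> pts"
    using assms by simp_all
  then show ?thesis
    using assms oact_apply[OF assms(1,2), of "fst x"]
    by (auto simp: flat_def perm_def pts_def)
qed

lemma flat_subset: "flat p \<subseteq> pts \<times> pts"
  by (auto simp: flat_def)

lemma oact_eqI:
  assumes "p \<in> ords" "q \<in> ords" "\<And>x y. x \<in> pts \<Longrightarrow> y \<in> pts \<Longrightarrow> (x, y) \<in> flat p \<longleftrightarrow> (x, y) \<in> flat q"
  shows "p = q"
  using assms flat_subset by (intro flat_injective) blast+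

lemma oact_mult:
  assumes "g \<in> carrier G" "h \<in> carrier G" "p \<in> ords"
  shows "oact (g \<otimes> h) p = oact g (oact h p)"
  using assms by (intro oact_eqI) (simp_all add: oact_closed flat_oact_iff inv_mult_group perm_mult)

lemma oact_one: "p \<in> ords \<Longrightarrow> oact \<one> p = p"
  by (intro oact_eqI) (simp_all add: oact_closed flat_oact_iff)

lemma group_action_oact: "group_action G ords oact"
  using oact_closed oact_mult oact_one
  by (intro group_actionI) (auto simp: oact_def LO_prod_act_def is_group)

lemma openin_flat:
  assumes "x \<in> pts" "y \<in> pts"
  shows "openin ords_space {p \<in> ords. (x, y) \<in> flat p}"
proof (cases "fst x = fst y")
  case True
  have "continuous_map ords_space (LO_topology (K (fst x))) (\<lambda>p. p (fst x))"
    unfolding LO_prod_topology_def using assms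
    by (intro continuous_map_product_projection) (auto simp: pts_def)
  from openin_continuous_map_preimage[OF this openin_LO_less[of "snd x" _ "snd y"]] assms True
  have "openin ords_space {p \<in> ords. p (fst x) \<in> {r \<in> LO (K (fst x)). (snd x, snd y) \<in> r}}"
    by (auto simp: pts_def)
  moreover have "{p \<in> ords. p (fst x) \<in> {r \<in> LO (K (fst x)). (snd x, snd y) \<in> r}} = {p \<in> ords. (x, y) \<in> flat p}"
    using assms True ords_LO[of _ "fst x"] by (auto simp: flat_def pts_def)
  ultimately show ?thesis
    by simp
next
  case False
  then have "{p \<in> ords. (x, y) \<in> flat p} = {}"
    by (auto simp: flat_def)
  then show ?thesis
    by (simp only: openin_empty)
qed

lemma flat_trans:
  assumes "p \<in> ords"
  shows "trans (flat p)"
proof (rule transI)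
  fix x y z assume xyz: "(x, y) \<in> flat p" "(y, z) \<in> flat p"
  then have "trans (p (fst x))"
    using ords_LO[OF assms] by (auto simp: flat_def pts_def LO_def strict_linear_order_on_def)
  with xyz show "(x, z) \<in> flat p"
    using transD[of "p (fst x)" "snd x" "snd y" "snd z"] by (auto simp: flat_def)
qed

lemma flat_irrefl: "p \<in> ords \<Longrightarrow> (x, x) \<notin> flat p"
  using ords_LO by (auto simp: flat_def pts_def LO_def strict_linear_order_on_def irrefl_def)

lemma flat_total:
  assumes "p \<in> ords" "x \<in> pts" "y \<in> pts" "fst x = fst y" "x \<noteq> y"
  shows "(x, y) \<in> flat p \<or> (y, x) \<in> flat p"
proof -
  have "fst x \<in> I" "snd x \<in> K (fst x)" "snd y \<in> K (fst x)" "snd x \<noteq> snd y"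
    using assms by (auto simp: pts_def prod_eq_iff)
  moreover have "total_on (K (fst x)) (p (fst x))"
    using ords_LO[OF assms(1) calculation(1)] by (simp add: LO_def strict_linear_order_on_def)
  ultimately show ?thesis
    using assms by (simp add: total_on_def flat_def)
qed

lemma openin_not_flat:
  assumes "x \<in> pts" "y \<in> pts"
  shows "openin ords_space {p \<in> ords. (x, y) \<notin> flat p}"
proof (cases "x = y \<or> fst x \<noteq> fst y")
  case True
  then have "{p \<in> ords. (x, y) \<notin> flat p} = ords"
    using flat_irrefl by (auto simp: flat_def)
  then show ?thesis
    by (simp only: openin_topspace)
next
  case False
  have "(x, y) \<notin> flat p \<longleftrightarrow> (y, x) \<in> flat p" if "p \<in> ords" for p
    using False flat_total[OF that assms] flat_irrefl[OF that] transD[OF flat_trans[OF that], of x y x]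
    by auto
  then have "{p \<in> ords. (x, y) \<notin> flat p} = {p \<in> ords. (y, x) \<in> flat p}"
    by (intro Collect_cong conj_cong refl)
  then show ?thesis
    using openin_flat[OF assms(2,1)] by simp
qed

lemma continuous_map_pattern:
  assumes "finite F" "F \<subseteq> pts"
  shows "continuous_map ords_space (discrete_topology UNIV) (pattern F)"
proof -
  have op: "openin ords_space {p \<in> ords. pattern F p = s}" for s
  proof (cases "s \<subseteq> F \<times> F")
    case True
    have "openin ords_space {p \<in> ords. (z \<in> flat p) = (z \<in> s)}" if "z \<in> F \<times> F" for z
    proof -
      have "fst z \<in> pts" "snd z \<in> pts"
        using that assms(2) by auto
      then show ?thesis
        using openin_flat[of "fst z" "snd z"] openin_not_flat[of "fst z" "snd z"] by (cases "z \<in> s") auto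
    qed
    then have "openin ords_space {p \<in> ords. \<forall>z\<in>F \<times> F. (z \<in> flat p) = (z \<in> s)}"
      using assms(1) by (intro openin_finite_Ball) auto
    moreover have "pattern F p = s \<longleftrightarrow> (\<forall>z\<in>F \<times> F. (z \<in> flat p) = (z \<in> s))" for p
      using True unfolding pattern_def by blast
    ultimately show ?thesis
      by simp
  next
    case False
    then have "{p \<in> ords. pattern F p = s} = {}"
      by (auto simp: pattern_def)
    then show ?thesis
      by (simp only: openin_empty)
  qed
  have "openin ords_space {p \<in> ords. pattern F p \<in> S}" for S
  proof -
    have "openin ords_space (\<Union>s\<in>S. {p \<in> ords. pattern F p = s})"
      using op by (intro openin_Union) auto
    moreover have "(\<Union>s\<in>S. {p \<in> ords. pattern F p = s}) = {p \<in> ords. pattern F p \<in> S}"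
      by auto
    ultimately show ?thesis by simp
  qed
  then show ?thesis
    by (auto simp: continuous_map_def)
qed

lemma ords_nbhd:
  assumes "openin ords_space U" "p \<in> U"
  obtains F where "finite F" "F \<subseteq> pts" "\<And>q. q \<in> ords \<Longrightarrow> pattern F q = pattern F p \<Longrightarrow> q \<in> U"
proof -
  obtain F where F: "finite F" "F \<subseteq> Sigma I K"
    "\<And>q. q \<in> topspace (product_topology (\<lambda>i. LO_topology (K i)) I) \<Longrightarrow>
      (\<And>i. i \<in> I \<Longrightarrow> q i \<inter> {a. (i, a) \<in> F} \<times> {a. (i, a) \<in> F} = p i \<inter> {a. (i, a) \<in> F} \<times> {a. (i, a) \<in> F}) \<Longrightarrow> q \<in> U"
  proof (rule product_topology_finite_nbhd[OF assms(1)[unfolded LO_prod_topology_def] assms(2),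
        where E = "\<lambda>i A r. r \<inter> A \<times> A = p i \<inter> A \<times> A" and K = K])
    show "\<exists>A. finite A \<and> A \<subseteq> K i \<and> (\<forall>r\<in>topspace (LO_topology (K i)). r \<inter> A \<times> A = p i \<inter> A \<times> A \<longrightarrow> r \<in> U)"
      if "openin (LO_topology (K i)) U" "p i \<in> U" for i U
      using LO_nbhd[OF that] .
    fix F assume F: "finite F" "F \<subseteq> Sigma I K"
      "\<And>q. q \<in> topspace (product_topology (\<lambda>i. LO_topology (K i)) I) \<Longrightarrow>
        (\<And>i. i \<in> I \<Longrightarrow> q i \<inter> {a. (i, a) \<in> F} \<times> {a. (i, a) \<in> F} = p i \<inter> {a. (i, a) \<in> F} \<times> {a. (i, a) \<in> F}) \<Longrightarrow> q \<in> U"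
    show thesis
      by (rule that[OF F])
  qed
  show thesis
  proof (rule that)
    fix q assume q: "q \<in> ords" "pattern F q = pattern F p"
    show "q \<in> U"
    proof (rule F(3))
      show "q \<in> topspace (product_topology (\<lambda>i. LO_topology (K i)) I)"
        using q(1) by (simp add: LO_prod_topology_def)
      fix i assume "i \<in> I"
      have "(a, b) \<in> q i \<longleftrightarrow> (a, b) \<in> p i" if "(i, a) \<in> F" "(i, b) \<in> F" for a b
      proof -
        have "((i, a), (i, b)) \<in> pattern F q \<longleftrightarrow> ((i, a), (i, b)) \<in> pattern F p"
          using q(2) by simp
        then show ?thesis
          using that F(2) by (auto simp: pattern_def flat_def pts_def)
      qed
      then show "q i \<inter> {a. (i, a) \<in> F} \<times> {a. (i, a) \<in> F} = p i \<inter> {a. (i, a) \<in> F} \<times> {a. (i, a) \<in> F}"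
        by auto
    qed
  qed (use F in \<open>auto simp: pts_def\<close>)
qed

lemma continuous_map_into_ords:
  assumes h: "h \<in> topspace Z \<rightarrow> ords"
    and op: "\<And>x y. x \<in> pts \<Longrightarrow> y \<in> pts \<Longrightarrow> openin Z {z \<in> topspace Z. (x, y) \<in> flat (h z)}"
  shows "continuous_map Z ords_space h"
  unfolding LO_prod_topology_def continuous_map_componentwise
proof (intro conjI ballI)
  show "h ` topspace Z \<subseteq> extensional I"
    using h by (auto simp: ords_iff PiE_iff)
  fix i assume i: "i \<in> I"
  show "continuous_map Z (LO_topology (K i)) (\<lambda>z. h z i)"
  proof (rule continuous_map_into_LO)
    show "(\<lambda>z. h z i) \<in> topspace Z \<rightarrow> LO (K i)"
      using h i ords_LO by auto
    fix a b assume "a \<in> K i" "b \<in> K i"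
    then show "openin Z {z \<in> topspace Z. (a, b) \<in> h z i}"
      using op[of "(i, a)" "(i, b)"] i by (simp add: flat_def pts_def)
  qed
qed

lemma continuous_map_oact: "continuous_map (prod_topology T ords_space) ords_space (\<lambda>(g, p). oact g p)"
proof (rule continuous_map_into_ords)
  show "(\<lambda>(g, p). oact g p) \<in> topspace (prod_topology T ords_space) \<rightarrow> ords"
    using oact_closed by (auto simp: topspace_T)
  fix x y assume xy: "x \<in> pts" "y \<in> pts"
  have "openin (prod_topology T ords_space) (\<Union>(v, w)\<in>pts \<times> pts.
      ({g \<in> carrier G. perm g v = x} \<inter> {g \<in> carrier G. perm g w = y}) \<times> {p \<in> ords. (v, w) \<in> flat p})"
    by (intro openin_Union) (auto simp: openin_prod_Times_iff openin_perm openin_flat openin_Int)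
  moreover have "(\<Union>(v, w)\<in>pts \<times> pts.
      ({g \<in> carrier G. perm g v = x} \<inter> {g \<in> carrier G. perm g w = y}) \<times> {p \<in> ords. (v, w) \<in> flat p}) =
      {z \<in> topspace (prod_topology T ords_space). (x, y) \<in> flat (case z of (g, p) \<Rightarrow> oact g p)}" (is "?L = ?R")
  proof
    show "?L \<subseteq> ?R"
      using xy by (auto simp: topspace_T flat_oact_iff)
    show "?R \<subseteq> ?L"
    proof
      fix z assume "z \<in> ?R"
      then obtain g p where z: "z = (g, p)" "g \<in> carrier G" "p \<in> ords" "(x, y) \<in> flat (oact g p)"
        by (auto simp: topspace_T)
      then show "z \<in> ?L"
        using xy by (intro UN_I[of "(perm (inv g) x, perm (inv g) y)"]) (auto simp: flat_oact_iff)
    qed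
  qed
  ultimately show "openin (prod_topology T ords_space)
      {z \<in> topspace (prod_topology T ords_space). (x, y) \<in> flat (case z of (g, p) \<Rightarrow> oact g p)}"
    by simp
qed

lemma ords_nonempty: "ords \<noteq> {}"
  by (simp add: LO_prod_topology_def PiE_eq_empty_iff LO_nonempty)

lemma compact_ords: "compact_space ords_space"
  by (simp add: LO_prod_topology_def compact_space_product_topology compact_LO_topology)

lemma Hausdorff_ords: "Hausdorff_space ords_space"
  by (simp add: LO_prod_topology_def Hausdorff_space_product_topology Hausdorff_LO_topology)

lemma flow_ords: "flow G T ords_space oact"
  by (intro flow.intro flow_axioms.intro topological_group group_action_oact ords_nonempty
      compact_ords Hausdorff_ords continuous_map_oact)

text \<open>
  On each level, \<open>p\<close> and \<open>q\<close> induce isomorphic orders on the finite set of points of \<open>F\<close>. The isomorphisms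
  together form a permutation of \<open>F\<close>, which some element of \<open>G\<close> extends.
\<close>

lemma orbit_realizes_pattern:
  assumes p: "p \<in> ords" and q: "q \<in> ords" and F: "finite F" "F \<subseteq> pts"
  obtains g where "g \<in> carrier G" "pattern F (oact g p) = pattern F q"
proof -
  have "\<exists>m. bij_betw m {a. (i, a) \<in> F} {a. (i, a) \<in> F} \<and>
      (\<forall>a b. (i, a) \<in> F \<longrightarrow> (i, b) \<in> F \<longrightarrow> (m a, m b) \<in> p i \<longleftrightarrow> (a, b) \<in> q i)" if "i \<in> I" for i
  proof -
    have "finite {a. (i, a) \<in> F}"
      using finite_vimageI[OF F(1), of "Pair i"] by (simp add: vimage_def inj_def)
    moreover have "{a. (i, a) \<in> F} \<subseteq> K i"
      using F(2) by (auto simp: pts_def)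
    then have "strict_linear_order_on {a. (i, a) \<in> F} (p i)" "strict_linear_order_on {a. (i, a) \<in> F} (q i)"
      using ords_LO[OF p that] ords_LO[OF q that] by (auto simp: LO_def intro: strict_linear_order_on_subset)
    ultimately obtain m where "bij_betw m {a. (i, a) \<in> F} {a. (i, a) \<in> F}"
      "\<And>a b. a \<in> {a. (i, a) \<in> F} \<Longrightarrow> b \<in> {a. (i, a) \<in> F} \<Longrightarrow> (m a, m b) \<in> p i \<longleftrightarrow> (a, b) \<in> q i"
      using finite_linear_orders_isomorphic[of _ "q i" "p i"] by blast
    then show ?thesis
      by (intro exI[of _ m]) simp
  qed
  then obtain m where m: "\<And>i. i \<in> I \<Longrightarrow> bij_betw (m i) {a. (i, a) \<in> F} {a. (i, a) \<in> F}"
    "\<And>i a b. i \<in> I \<Longrightarrow> (i, a) \<in> F \<Longrightarrow> (i, b) \<in> F \<Longrightarrow> (m i a, m i b) \<in> p i \<longleftrightarrow> (a, b) \<in> q i"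
    by metis
  define M where "M = (\<lambda>x. (fst x, m (fst x) (snd x)))"
  have M_in: "M x \<in> F" if "x \<in> F" for x
  proof -
    have "fst x \<in> I" "snd x \<in> {a. (fst x, a) \<in> F}"
      using that F(2) by (auto simp: pts_def)
    then show ?thesis
      using bij_betwE[OF m(1)] by (simp add: M_def)
  qed
  have "inj_on M F"
  proof (rule inj_onI)
    fix x y assume xy: "x \<in> F" "y \<in> F" "M x = M y"
    then have "fst x = fst y" "m (fst x) (snd x) = m (fst x) (snd y)" "fst x \<in> I"
      using F(2) by (auto simp: M_def pts_def)
    moreover have "snd x \<in> {a. (fst x, a) \<in> F}" "snd y \<in> {a. (fst x, a) \<in> F}"
      using xy calculation(1) by (cases x; cases y; simp)+
    ultimately show "x = y"
      using bij_betw_imp_inj_on[OF m(1)[of "fst x"]] by (auto simp: prod_eq_iff dest: inj_onD)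
  qed
  then obtain k where k: "k \<in> carrier G" "\<And>x. x \<in> F \<Longrightarrow> perm k x = M x"
    using M_in F by (elim finite_partial_permutation_extends[OF F, of M]) (auto simp: M_def)
  have "(x, y) \<in> flat (oact (inv k) p) \<longleftrightarrow> (x, y) \<in> flat q" if "x \<in> F" "y \<in> F" for x y
  proof -
    have xy: "x \<in> pts" "y \<in> pts" "M x \<in> pts" "M y \<in> pts"
      using that M_in[OF that(1)] M_in[OF that(2)] F(2) by auto
    then have "(x, y) \<in> flat (oact (inv k) p) \<longleftrightarrow> (M x, M y) \<in> flat p"
      using that k p by (simp add: flat_oact_iff)
    also have "\<dots> \<longleftrightarrow> fst x = fst y \<and> (m (fst x) (snd x), m (fst x) (snd y)) \<in> p (fst x)"
      using xy by (auto simp: flat_def M_def)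
    also have "\<dots> \<longleftrightarrow> (x, y) \<in> flat q"
    proof (cases "fst x = fst y")
      case True
      moreover have "fst x \<in> I" "(fst x, snd x) \<in> F" "(fst x, snd y) \<in> F"
        using that xy(1) True by (auto simp: pts_def)
      ultimately show ?thesis
        using m(2)[of "fst x" "snd x" "snd y"] xy by (simp add: flat_def)
    qed (simp add: flat_def)
    finally show ?thesis .
  qed
  then have "pattern F (oact (inv k) p) = pattern F q"
    unfolding pattern_def by auto
  then show ?thesis
    using k(1) that by blast
qed

lemma orbit_closure_ords:
  assumes "p \<in> ords"
  shows "ords_space closure_of orbit G oact p = ords"
proof -
  have "q \<in> ords_space closure_of orbit G oact p" if q: "q \<in> ords" for q
    unfolding in_closure_of
  proof (intro conjI allI impI q)
    fix U assume U: "q \<in> U \<and> openin ords_space U"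
    then obtain F where F: "finite F" "F \<subseteq> pts" "\<And>r. r \<in> ords \<Longrightarrow> pattern F r = pattern F q \<Longrightarrow> r \<in> U"
      using ords_nbhd by metis
    then obtain g where "g \<in> carrier G" "pattern F (oact g p) = pattern F q"
      using orbit_realizes_pattern[OF assms q] by metis
    then show "\<exists>r. r \<in> orbit G oact p \<and> r \<in> U"
      using F(3) oact_closed[OF assms] by (auto simp: orbit_def)
  qed
  then show ?thesis
    by (auto simp: in_closure_of)
qed

lemma minimal_flow_ords: "minimal_flow G T ords_space oact"
  unfolding minimal_flow_def minimal_subflow_def
proof (intro conjI allI impI flow_ords)
  show "subflow G ords_space oact ords"
    using ords_nonempty oact_closed by (auto simp: subflow_def)
  fix W assume W: "subflow G ords_space oact W \<and> W \<subseteq> ords"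
  then obtain p where p: "p \<in> W" "p \<in> ords"
    by (auto simp: subflow_def)
  then have "orbit G oact p \<subseteq> W"
    using W by (auto simp: subflow_def orbit_def)
  then have "ords_space closure_of orbit G oact p \<subseteq> W"
    using W by (intro closure_of_minimal) (auto simp: subflow_def)
  then show "W = ords"
    using W orbit_closure_ords[OF p(2)] by auto
qed

end

section \<open>Uniform continuity along the group and the Ramsey argument\<close>

lemma eq_floor_close:
  fixes a b \<epsilon> :: real
  assumes "0 < \<epsilon>" "\<lfloor>a / \<epsilon>\<rfloor> = \<lfloor>b / \<epsilon>\<rfloor>"
  shows "\<bar>a - b\<bar> \<le> \<epsilon>"
proof -
  have "\<bar>a / \<epsilon> - b / \<epsilon>\<bar> \<le> 1"
    using assms(2) by linarith
  then show ?thesis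
    using assms(1) by (simp add: diff_divide_distrib[symmetric] abs_divide)
qed

lemma (in flow) continuous_map_act:
  assumes "g \<in> carrier G"
  shows "continuous_map Y Y (act g)"
proof -
  have "continuous_map Y (prod_topology T Y) (\<lambda>y. (g, y))"
    using assms by (intro continuous_map_pairedI continuous_map_id[unfolded id_def])
      (simp add: topspace_eq)
  from continuous_map_compose[OF this continuous_act] show ?thesis
    by (simp add: o_def)
qed

lemma (in flow) act_closed: "g \<in> carrier G \<Longrightarrow> y \<in> topspace Y \<Longrightarrow> act g y \<in> topspace Y"
  using element_image by blast

lemma (in flow) act_mult:
  "g \<in> carrier G \<Longrightarrow> h \<in> carrier G \<Longrightarrow> y \<in> topspace Y \<Longrightarrow> act (g \<otimes> h) y = act g (act h y)"
  by (rule composition_rule)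

lemma (in flow) act_one: "y \<in> topspace Y \<Longrightarrow> act \<one> y = y"
  using id_eq_one by (metis restrict_apply')

context dense_subgroup_of_Sym_prod
begin

text \<open>
  On a finite level there is no room for Ramsey's theorem. Requiring \<open>F\<close> to contain every finite level that
  it meets avoids the need for it: an element that preserves the order induced on \<open>F\<close> then fixes the points of
  these levels, since a finite linear order is rigid (\<open>perm_eq_of_pattern_finite_level\<close>).
\<close>

definition full :: "('i \<times> 'k) set \<Rightarrow> bool" where
  "full F \<longleftrightarrow> finite F \<and> F \<subseteq> pts \<and> (\<forall>x\<in>F. finite (K (fst x)) \<longrightarrow> {fst x} \<times> K (fst x) \<subseteq> F)"

lemma ex_full_superset:
  assumes "finite F" "F \<subseteq> pts"
  obtains F' where "full F'" "F \<subseteq> F'"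
proof
  let ?F = "F \<union> (SIGMA i:{i \<in> fst ` F. finite (K i)}. K i)"
  show "F \<subseteq> ?F" by blast
  have "finite (SIGMA i:{i \<in> fst ` F. finite (K i)}. K i)"
    using assms(1) by (intro finite_SigmaI) auto
  then show "full ?F"
    using assms by (force simp: full_def pts_def)
qed

lemma full_perm_image:
  assumes "full F" "g \<in> carrier G"
  shows "full (perm g ` F)"
proof -
  have F: "finite F" "F \<subseteq> pts" and fill: "\<And>x. x \<in> F \<Longrightarrow> finite (K (fst x)) \<Longrightarrow> {fst x} \<times> K (fst x) \<subseteq> F"
    using assms(1) by (auto simp: full_def)
  have "{fst x} \<times> K (fst x) \<subseteq> perm g ` F" if x: "x \<in> F" "finite (K (fst x))" for x
  proof
    fix y assume y: "y \<in> {fst x} \<times> K (fst x)"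
    then have "y \<in> pts"
      using x(1) F(2) by (auto simp: pts_def)
    then have "perm (inv g) y \<in> pts" "fst (perm (inv g) y) = fst x"
      using y assms(2) by auto
    then have "perm (inv g) y \<in> {fst x} \<times> K (fst x)"
      by (cases "perm (inv g) y") (auto simp: pts_def)
    then have "perm (inv g) y \<in> F"
      by (rule subsetD[OF fill[OF x]])
    then have "perm g (perm (inv g) y) \<in> perm g ` F"
      by (rule imageI)
    then show "y \<in> perm g ` F"
      using \<open>y \<in> pts\<close> assms(2) by simp
  qed
  then show ?thesis
    using F assms(2) by (auto simp: full_def)
qed

lemma pattern_oact_eq_iff:
  assumes "p \<in> ords" "q \<in> ords" "k \<in> carrier G" "F \<subseteq> pts"
  shows "pattern F (oact k p) = pattern F (oact k q) \<longleftrightarrow>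
    pattern (perm (inv k) ` F) p = pattern (perm (inv k) ` F) q"
proof -
  have eq: "pattern F r = pattern F s \<longleftrightarrow> (\<forall>x\<in>F. \<forall>y\<in>F. (x, y) \<in> flat r \<longleftrightarrow> (x, y) \<in> flat s)" for F r s
    unfolding pattern_def set_eq_iff by auto
  have "x \<in> pts" if "x \<in> F" for x
    using that assms(4) by blast
  then show ?thesis
    unfolding eq using assms(1-3) by (simp add: flat_oact_iff)
qed

lemma perm_eq_of_pattern_finite_level:
  assumes "p \<in> ords" "g \<in> carrier G" "full F" "pattern F (oact g p) = pattern F p"
    and "x \<in> F" "finite (K (fst x))"
  shows "perm (inv g) x = x"
proof -
  let ?i = "fst x"
  have x: "?i \<in> I" "snd x \<in> K ?i" and F: "F \<subseteq> pts" "{?i} \<times> K ?i \<subseteq> F"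
    using assms(3,5,6) by (auto simp: full_def pts_def)
  have "emb (inv g) ?i (snd x) = snd x"
  proof (rule finite_linear_order_rigid[OF assms(6) _ _ _ x(2), of "p ?i"])
    show "strict_linear_order_on (K ?i) (p ?i)"
      using ords_LO[OF assms(1) x(1)] by (simp add: LO_def)
    show "bij_betw (emb (inv g) ?i) (K ?i) (K ?i)"
      using emb_Bij[of "inv g"] assms(2) x(1) by (auto simp: Bij_def)
    fix a b assume ab: "a \<in> K ?i" "b \<in> K ?i"
    then have "(?i, a) \<in> F" "(?i, b) \<in> F"
      using F(2) by auto
    moreover have "((?i, a), (?i, b)) \<in> pattern F (oact g p) \<longleftrightarrow> ((?i, a), (?i, b)) \<in> pattern F p"
      using assms(4) by simp
    ultimately have "((?i, a), (?i, b)) \<in> flat (oact g p) \<longleftrightarrow> ((?i, a), (?i, b)) \<in> flat p"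
      by (simp add: pattern_def)
    moreover have "(?i, a) \<in> pts" "(?i, b) \<in> pts"
      using ab x(1) by (auto simp: pts_def)
    moreover have "emb (inv g) ?i a \<in> K ?i" "emb (inv g) ?i b \<in> K ?i"
      using ab emb_Bij[of "inv g"] assms(2) x(1) Bij_imp_funcset by blast+
    ultimately show "(emb (inv g) ?i a, emb (inv g) ?i b) \<in> p ?i \<longleftrightarrow> (a, b) \<in> p ?i"
      using oact_apply[OF assms(1,2) x(1)] x(1) ab by (simp add: flat_def pts_def)
  qed
  then show ?thesis
    by (simp add: perm_def)
qed

end

locale flow_of_dense_subgroup =
  dense_subgroup_of_Sym_prod G T I K emb + Y: flow G T Y act
  for G (structure) and T I and K :: "'i \<Rightarrow> 'k set" and emb and Y :: "'y topology" and act
begin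

definition controls :: "('y \<Rightarrow> real) \<Rightarrow> ('i \<times> 'k) set \<Rightarrow> real \<Rightarrow> bool" where
  "controls f F \<epsilon> \<longleftrightarrow> continuous_map Y euclideanreal f \<and> full F \<and> 0 < \<epsilon> \<and>
     (\<forall>g\<in>carrier G. (\<forall>x\<in>F. perm g x = x) \<longrightarrow> (\<forall>y\<in>topspace Y. \<bar>f (act g y) - f y\<bar> \<le> \<epsilon>))"

text \<open>
  The set of pairs \<open>(g, y)\<close> with \<open>\<bar>f (g y) - f y\<bar> < \<epsilon>\<close> is open and contains \<open>{\<one>} \<times> Y\<close>. As \<open>Y\<close> is compact, it
  contains \<open>U \<times> Y\<close> for a neighbourhood \<open>U\<close> of \<open>\<one>\<close>, and \<open>U\<close> contains the pointwise stabilizer of a finite set.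
\<close>

lemma ex_controls:
  assumes f: "continuous_map Y euclideanreal f" and "0 < \<epsilon>"
  obtains F where "controls f F \<epsilon>"
proof -
  let ?W = "{z \<in> topspace (prod_topology T Y). (case z of (g, y) \<Rightarrow> f (act g y) - f y) \<in> {-\<epsilon><..<\<epsilon>}}"
  have "continuous_map (prod_topology T Y) euclideanreal (\<lambda>z. f (case z of (g, y) \<Rightarrow> act g y) - f (snd z))"
    by (intro continuous_map_diff continuous_map_compose[OF Y.continuous_act f, unfolded o_def]
        continuous_map_compose[OF continuous_map_snd f, unfolded o_def])
  from openin_continuous_map_preimage[OF this, of "{-\<epsilon><..<\<epsilon>}"]
  have W: "openin (prod_topology T Y) ?W"
    by (simp add: case_prod_beta)
  have one_W: "{\<one>} \<times> topspace Y \<subseteq> ?W"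
    using \<open>0 < \<epsilon>\<close> by (auto simp: topspace_T Y.act_one)
  have compact: "compactin T {\<one>}" "compactin Y (topspace Y)"
    using Y.compact by (simp_all add: topspace_T compact_space_def)
  obtain U V where U: "openin T U" "openin Y V" "{\<one>} \<subseteq> U" "topspace Y \<subseteq> V" "U \<times> V \<subseteq> ?W"
    by (rule Wallace_theorem_prod_topology[OF compact W one_W])
  obtain F where F: "finite F" "F \<subseteq> pts" 
    "\<And>h. h \<in> carrier G \<Longrightarrow> (\<And>x. x \<in> F \<Longrightarrow> perm h x = perm \<one> x) \<Longrightarrow> h \<in> U"
    using T_nbhd[OF U(1), of \<one>] U(3) by blast
  obtain F' where F': "full F'" "F \<subseteq> F'"
    using ex_full_superset[OF F(1,2)] by blast
  have "controls f F' \<epsilon>"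
    unfolding controls_def
  proof (intro conjI ballI impI f F'(1) \<open>0 < \<epsilon>\<close>)
    fix g y assume g: "g \<in> carrier G" "\<forall>x\<in>F'. perm g x = x" and y: "y \<in> topspace Y"
    have "g \<in> U"
      using g F' F(2) by (intro F(3)) (auto simp: subset_iff)
    then have "(g, y) \<in> ?W"
      using y U(4,5) by blast
    then show "\<bar>f (act g y) - f y\<bar> \<le> \<epsilon>"
      by (auto simp: abs_le_iff)
  qed
  then show ?thesis
    by (rule that)
qed

lemma controls_translate:
  assumes "controls f F \<epsilon>" "k \<in> carrier G"
  shows "controls (\<lambda>y. f (act k y)) (perm (inv k) ` F) \<epsilon>"
  unfolding controls_def
proof (intro conjI ballI impI)
  show "continuous_map Y euclideanreal (\<lambda>y. f (act k y))"
    using assms continuous_map_compose[OF Y.continuous_map_act, of k _ f]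
    by (simp add: controls_def o_def)
  show "full (perm (inv k) ` F)" "0 < \<epsilon>"
    using assms by (auto simp: controls_def full_perm_image)
  fix g y assume g: "g \<in> carrier G" "\<forall>x\<in>perm (inv k) ` F. perm g x = x" and y: "y \<in> topspace Y"
  have "perm (k \<otimes> g \<otimes> inv k) x = x" if x: "x \<in> F" for x
  proof -
    have "x \<in> pts"
      using assms(1) x by (auto simp: controls_def full_def)
    then show ?thesis
      using g assms(2) x by (simp add: perm_mult)
  qed
  then have "\<bar>f (act (k \<otimes> g \<otimes> inv k) (act k y)) - f (act k y)\<bar> \<le> \<epsilon>"
    using assms g(1) y Y.act_closed by (auto simp: controls_def)
  moreover have "act (k \<otimes> g \<otimes> inv k) (act k y) = act k (act g y)"
    using assms(2) g(1) y by (simp add: Y.act_mult[symmetric] Y.act_closed m_assoc)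
  ultimately show "\<bar>f (act k (act g y)) - f (act k y)\<bar> \<le> \<epsilon>"
    by simp
qed

text \<open>
  The elements \<open>k\<close> and \<open>k'\<close> differ by the factor \<open>k \<otimes> inv k'\<close> on the left, which fixes \<open>F\<close> pointwise.
\<close>

lemma controls_close:
  assumes "controls f F \<epsilon>" "k \<in> carrier G" "k' \<in> carrier G" "y \<in> topspace Y"
    and eq: "\<And>x. x \<in> F \<Longrightarrow> perm (inv k) x = perm (inv k') x"
  shows "\<bar>f (act k y) - f (act k' y)\<bar> \<le> \<epsilon>"
proof -
  have F: "F \<subseteq> pts"
    using assms(1) by (auto simp: controls_def full_def)
  have "perm (k \<otimes> inv k') x = x" if "x \<in> F" for x
  proof -
    have "x \<in> pts"
      using F that by blast
    then show ?thesis
      using eq[OF that, symmetric] assms(2,3) by (simp add: perm_mult)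
  qed
  then have "\<bar>f (act (k \<otimes> inv k') (act k' y)) - f (act k' y)\<bar> \<le> \<epsilon>"
    using assms(1-4) Y.act_closed by (auto simp: controls_def)
  moreover have "act (k \<otimes> inv k') (act k' y) = act k y"
    using assms(2-4) by (simp add: Y.act_mult[symmetric] Y.act_closed m_assoc)
  ultimately show ?thesis
    by simp
qed

lemma bounded_continuous_function:
  assumes "continuous_map Y euclideanreal f"
  obtains B where "\<And>y. y \<in> topspace Y \<Longrightarrow> \<bar>f y\<bar> \<le> B"
proof -
  have "compact (f ` topspace Y)"
    using image_compactin[OF _ assms] Y.compact by (simp add: compact_space_def)
  then have "bounded (f ` topspace Y)"
    by (rule compact_imp_bounded)
  then obtain B where "\<forall>z\<in>f ` topspace Y. norm z \<le> B"
    unfolding bounded_iff by blast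
  then show ?thesis
    by (intro that[of B]) simp
qed

text \<open>
  By \<open>controls_close\<close>, the numbers \<open>f (act k y)\<close>, rounded to multiples of \<open>\<epsilon>\<close>, colour the injections of
  \<open>F\<close> into \<open>pts\<close> that arise as restrictions of \<open>inv k\<close>. A fixed injective sequence in every infinite level
  turns an increasing map from \<open>F\<close> to \<open>nat\<close> into such an injection. If \<open>inv h\<close> places a finite set \<open>A\<close>,
  large enough for all conditions in \<open>Q\<close>, along an infinite homogeneous set \<open>Z\<close>, then \<open>h\<close> and \<open>g \<otimes> h\<close> both
  place \<open>F\<close> increasingly along \<open>Z\<close>, because \<open>g\<close> preserves the order that \<open>p\<close> induces on \<open>F\<close>. So they get
  the same colour. The bound is \<open>3 * \<epsilon>\<close>: one \<open>\<epsilon>\<close> comes from the rounding and one from each use of \<open>controls_close\<close>.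
  
  The points of all infinite levels are placed along the same set \<open>Z\<close>, with the blocks of different
  levels one after the other. This makes the usual Ramsey theorem suffice where a product version might be
  expected.
\<close>

lemma ex_nearly_fixed_translate:
  assumes p: "p \<in> ords" and y: "y \<in> topspace Y" and "finite Q"
    and Q: "\<And>f F \<epsilon> g. (f, F, \<epsilon>, g) \<in> Q \<Longrightarrow>
      controls f F \<epsilon> \<and> g \<in> carrier G \<and> pattern F (oact g p) = pattern F p"
  obtains h where "h \<in> carrier G"
    "\<And>f F \<epsilon> g. (f, F, \<epsilon>, g) \<in> Q \<Longrightarrow> \<bar>f (act g (act h y)) - f (act h y)\<bar> \<le> 3 * \<epsilon>"
proof -
  obtain \<rho> where \<rho>: "\<rho> \<subseteq> I \<times> I" "trans \<rho>" "irrefl \<rho>" "total_on I \<rho>"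
    using LO_nonempty[of I] by (auto simp: LO_def strict_linear_order_on_def)
  (* The points are ordered lexicographically, by level and then by p. *)
  define lt where "lt = {(x, y) \<in> pts \<times> pts. (fst x, fst y) \<in> \<rho>} \<union> flat p"
  have flat_fst: "fst x = fst y" if "(x, y) \<in> flat p" for x y
    using that by (simp add: flat_def)
  have "strict_linear_order_on pts lt"
    unfolding strict_linear_order_on_def
  proof (intro conjI)
    show "trans lt"
    proof (rule transI)
      fix x y z assume xyz: "(x, y) \<in> lt" "(y, z) \<in> lt"
      then have "x \<in> pts" "z \<in> pts"
        using flat_subset by (auto simp: lt_def)
      with xyz show "(x, z) \<in> lt"
        using flat_fst[of x y] flat_fst[of y z] transD[OF \<rho>(2), of "fst x" "fst y" "fst z"]
          transD[OF flat_trans[OF p], of x y z]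
        by (auto simp: lt_def)
    qed
    show "irrefl lt"
      using \<rho>(3) flat_irrefl[OF p] by (auto simp: lt_def irrefl_def)
    show "total_on pts lt"
      unfolding total_on_def
    proof (intro ballI impI)
      fix x y assume xy: "x \<in> pts" "y \<in> pts" "x \<noteq> y"
      show "(x, y) \<in> lt \<or> (y, x) \<in> lt"
      proof (cases "fst x = fst y")
        case True
        then show ?thesis
          using flat_total[OF p xy(1,2)] xy(3) by (auto simp: lt_def)
      next
        case False
        have "fst x \<in> I" "fst y \<in> I"
          using xy by (auto simp: pts_def)
        then show ?thesis
          using False \<rho>(4) xy by (auto simp: lt_def total_on_def)
      qed
    qed
  qed
  note lt = strict_linear_order_on_subset[OF this]
  have "\<forall>i. infinite (K i) \<longrightarrow> (\<exists>s :: nat \<Rightarrow> 'k. inj s \<and> range s \<subseteq> K i)"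
    using infinite_countable_subset by blast
  then obtain s :: "'i \<Rightarrow> nat \<Rightarrow> 'k" where s: "\<And>i. infinite (K i) \<Longrightarrow> inj (s i) \<and> range (s i) \<subseteq> K i"
    by metis
  define infpart where "infpart F = {x \<in> F. infinite (K (fst x))}" for F :: "('i \<times> 'k) set"
  (* A map t tells which term of the sequence of its level a point moves to;
     points of finite levels stay where they are. *)
  define place where "place t x = (if finite (K (fst x)) then x else (fst x, s (fst x) (t x)))"
    for t :: "'i \<times> 'k \<Rightarrow> nat" and x
  (* The inverse of k places F along the set S, in increasing order.
     By the fact close below, S then determines f (act k y) up to an error of eps. *)
  define witness where "witness F k S \<longleftrightarrow> k \<in> carrier G \<and>
      (\<exists>t. monotone_on (infpart F) (\<lambda>x y. (x, y) \<in> lt) (<) t \<and> t ` infpart F = S \<and>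
        (\<forall>x\<in>F. perm (inv k) x = place t x))" for F k S
  have infpart: "finite (infpart F)" "infpart F \<subseteq> pts" if "finite F" "F \<subseteq> pts" for F
    using that by (auto simp: infpart_def)
  have close: "\<bar>f (act k y) - f (act k' y)\<bar> \<le> \<epsilon>"
    if c: "controls f F \<epsilon>" and w: "witness F k S" "witness F k' S" for f F \<epsilon> k k' S
  proof -
    have F: "finite F" "F \<subseteq> pts"
      using c by (auto simp: controls_def full_def)
    obtain t where t: "monotone_on (infpart F) (\<lambda>x y. (x, y) \<in> lt) (<) t" "t ` infpart F = S"
        "\<forall>x\<in>F. perm (inv k) x = place t x"
      using w(1) by (auto simp: witness_def)
    obtain t' where t': "monotone_on (infpart F) (\<lambda>x y. (x, y) \<in> lt) (<) t'" "t' ` infpart F = S"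
        "\<forall>x\<in>F. perm (inv k') x = place t' x"
      using w(2) by (auto simp: witness_def)
    have "t x = t' x" if "x \<in> infpart F" for x
      using increasing_map_determined_by_image[OF infpart(1)[OF F] lt[OF infpart(2)[OF F]] _ t(1) t'(1) that]
        t(2) t'(2) by simp
    then have "place t x = place t' x" if "x \<in> F" for x
      using that by (simp add: place_def infpart_def)
    then show ?thesis
      using c w t(3) t'(3) y by (intro controls_close[OF c]) (simp_all add: witness_def)
  qed
  have "\<exists>B. \<forall>w\<in>topspace Y. \<bar>f w\<bar> \<le> B" if "(f, F, \<epsilon>, g) \<in> Q" for f F \<epsilon> g
    using bounded_continuous_function[of f] Q[OF that] unfolding controls_def by metis
  then obtain B where B: "\<And>f F \<epsilon> g w. (f, F, \<epsilon>, g) \<in> Q \<Longrightarrow> w \<in> topspace Y \<Longrightarrow> \<bar>f w\<bar> \<le> B f"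
    by metis
  define col where "col = (\<lambda>(f, F, \<epsilon> :: real, g :: 'a) S. if \<exists>k. witness F k S
      then nat \<lfloor>(f (act (SOME k. witness F k S) y) + B f) / \<epsilon>\<rfloor> else 0)"
  have col_less: "col c S < (\<lambda>(f, F, \<epsilon>, g). nat \<lfloor>2 * B f / \<epsilon>\<rfloor> + 1) c" if "c \<in> Q" for c S
  proof -
    obtain f F \<epsilon> g where c: "c = (f, F, \<epsilon>, g)"
      by (cases c)
    have "0 < \<epsilon>"
      using Q that by (auto simp: c controls_def)
    have "nat \<lfloor>(f (act k y) + B f) / \<epsilon>\<rfloor> \<le> nat \<lfloor>2 * B f / \<epsilon>\<rfloor>" if k: "k \<in> carrier G" for k
    proof (intro nat_mono floor_mono divide_right_mono)
      show "f (act k y) + B f \<le> 2 * B f"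
        using B[OF \<open>c \<in> Q\<close>[unfolded c] Y.act_closed[OF k y]] by simp
    qed (use \<open>0 < \<epsilon>\<close> in simp)
    moreover have "(SOME k. witness F k S) \<in> carrier G" if "\<exists>k. witness F k S"
      using someI_ex[OF that] by (simp add: witness_def)
    ultimately show ?thesis
      unfolding c col_def by (simp add: less_Suc_eq_le)
  qed
  obtain Z :: "nat set" where Z: "infinite Z" and Zcol:
    "\<And>c S S'. c \<in> Q \<Longrightarrow> S \<subseteq> Z \<Longrightarrow> S' \<subseteq> Z \<Longrightarrow> finite S \<Longrightarrow> finite S' \<Longrightarrow>
      card S = (\<lambda>(f, F, \<epsilon>, g). card (infpart F)) c \<Longrightarrow> card S' = (\<lambda>(f, F, \<epsilon>, g). card (infpart F)) c \<Longrightarrow>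
      col c S = col c S'"
    using Ramsey_several_colourings[OF \<open>finite Q\<close>, of "\<lambda>(f, F, \<epsilon>, g). card (infpart F)" col,
        OF col_less] by blast
  define A where "A = (\<Union>(f, F, \<epsilon>, g)\<in>Q. F \<union> perm (inv g) ` F)"
  have A: "finite A" "A \<subseteq> pts"
    using \<open>finite Q\<close> Q by (fastforce simp: A_def controls_def full_def)+
  obtain \<tau> where \<tau>: "\<tau> ` infpart A \<subseteq> Z" "monotone_on (infpart A) (\<lambda>x y. (x, y) \<in> lt) (<) \<tau>"
    using ex_increasing_map_into_infinite[OF infpart(1)[OF A] lt[OF infpart(2)[OF A]] Z] by blast
  have \<tau>_inj: "inj_on \<tau> (infpart A)"
  proof (rule inj_onI, rule ccontr)
    fix x y assume xy: "x \<in> infpart A" "y \<in> infpart A" "\<tau> x = \<tau> y" "x \<noteq> y"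
    then have "(x, y) \<in> lt \<or> (y, x) \<in> lt"
      using lt[OF infpart(2)[OF A]] by (auto simp: strict_linear_order_on_def total_on_def)
    then show False
      using monotone_onD[OF \<tau>(2), of x y] monotone_onD[OF \<tau>(2), of y x] xy by auto
  qed
  have place_pts: "place \<tau> x \<in> pts" if "x \<in> pts" for x
    using that s[of "fst x"] by (auto simp: place_def pts_def)
  have place_inj: "inj_on (place \<tau>) A"
  proof (rule inj_onI)
    fix x y assume xy: "x \<in> A" "y \<in> A" "place \<tau> x = place \<tau> y"
    have fst_eq: "fst x = fst y"
      using arg_cong[OF xy(3), of fst] by (simp add: place_def split: if_splits)
    show "x = y"
    proof (cases "finite (K (fst x))")
      case True
      then show ?thesis
        using xy(3) fst_eq by (simp add: place_def)
    next
      case False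
      then have "s (fst x) (\<tau> x) = s (fst x) (\<tau> y)" "x \<in> infpart A" "y \<in> infpart A"
        using xy fst_eq by (simp_all add: place_def infpart_def)
      then show ?thesis
        using s[OF False] \<tau>_inj by (auto dest: injD inj_onD)
    qed
  qed
  have place_image: "place \<tau> ` A \<subseteq> pts"
    using place_pts A(2) by blast
  have place_fst: "fst (place \<tau> x) = fst x" for x
    by (simp add: place_def)
  obtain k where k: "k \<in> carrier G" "\<And>x. x \<in> A \<Longrightarrow> perm k x = place \<tau> x"
    using finite_partial_permutation_extends[OF A place_inj place_image place_fst] by blast
  define h where "h = inv k"
  have h: "h \<in> carrier G" "\<And>x. x \<in> A \<Longrightarrow> perm (inv h) x = place \<tau> x"
    using k by (simp_all add: h_def)
  show ?thesis
  proof (rule that[OF h(1)])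
    fix f F \<epsilon> g assume c: "(f, F, \<epsilon>, g) \<in> Q"
    then have ctrl: "controls f F \<epsilon>" and g: "g \<in> carrier G" and pat: "pattern F (oact g p) = pattern F p"
      using Q by blast+
    have F: "finite F" "F \<subseteq> pts" "full F"
      using ctrl by (auto simp: controls_def full_def)
    have FA: "F \<subseteq> A" "perm (inv g) ` F \<subseteq> A"
      using c by (auto simp: A_def)
    have infA: "infpart F \<subseteq> infpart A" "perm (inv g) ` infpart F \<subseteq> infpart A"
      using FA by (auto simp: infpart_def)
    define S where "S = \<tau> ` infpart F"
    define S' where "S' = (\<lambda>x. \<tau> (perm (inv g) x)) ` infpart F"
    have "inj_on (\<lambda>x. \<tau> (perm (inv g) x)) (infpart F)"
      using comp_inj_on[of "perm (inv g)" "infpart F" \<tau>] inj_on_perm[of "inv g"] g infpart(2)[OF F(1,2)]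
        infA(2) \<tau>_inj by (auto simp: o_def intro: inj_on_subset)
    then have card: "card S = card (infpart F)" "card S' = card (infpart F)"
      unfolding S_def S'_def using \<tau>_inj infA(1) by (auto intro!: card_image intro: inj_on_subset)
    have wit: "witness F h S"
      unfolding witness_def
    proof (intro conjI h(1) exI[of _ \<tau>])
      show "monotone_on (infpart F) (\<lambda>x y. (x, y) \<in> lt) (<) \<tau>"
        using \<tau>(2) infA(1) by (rule monotone_on_subset)
    qed (use h FA in \<open>auto simp: S_def\<close>)
    have wit': "witness F (g \<otimes> h) S'"
      unfolding witness_def
    proof (intro conjI exI[of _ "\<lambda>x. \<tau> (perm (inv g) x)"])
      show "monotone_on (infpart F) (\<lambda>x y. (x, y) \<in> lt) (<) (\<lambda>x. \<tau> (perm (inv g) x))"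
      proof (rule monotone_onI)
        fix x y assume xy: "x \<in> infpart F" "y \<in> infpart F" "(x, y) \<in> lt"
        then have xyF: "x \<in> F" "y \<in> F" "x \<in> pts" "y \<in> pts"
          using F(2) by (auto simp: infpart_def)
        have "(x, y) \<in> pattern F (oact g p) \<longleftrightarrow> (x, y) \<in> pattern F p"
          using pat by simp
        then have "(perm (inv g) x, perm (inv g) y) \<in> flat p \<longleftrightarrow> (x, y) \<in> flat p"
          using xyF p g by (simp add: pattern_def flat_oact_iff)
        then have "(perm (inv g) x, perm (inv g) y) \<in> lt"
          using xy(3) xyF g by (auto simp: lt_def)
        then show "\<tau> (perm (inv g) x) < \<tau> (perm (inv g) y)"
          using \<tau>(2) xy(1,2) infA(2) by (auto simp: monotone_on_def)
      qed
      show "\<forall>x\<in>F. perm (inv (g \<otimes> h)) x = place (\<lambda>x. \<tau> (perm (inv g) x)) x"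
      proof
        fix x assume x: "x \<in> F"
        have "perm (inv (g \<otimes> h)) x = perm (inv h) (perm (inv g) x)"
          using subsetD[OF F(2) x] g h(1) by (simp add: inv_mult_group perm_mult)
        also have "\<dots> = place \<tau> (perm (inv g) x)"
          using x FA(2) by (intro h(2)) auto
        also have "\<dots> = place (\<lambda>x. \<tau> (perm (inv g) x)) x"
          using perm_eq_of_pattern_finite_level[OF p g F(3) pat x] by (simp add: place_def)
        finally show "perm (inv (g \<otimes> h)) x = place (\<lambda>x. \<tau> (perm (inv g) x)) x" .
      qed
    qed (use g h in \<open>auto simp: S'_def\<close>)
    (* The colours of S and S' were computed with k1 and k2, not with h and g h themselves. *)
    define k1 where "k1 = (SOME k. witness F k S)"
    define k2 where "k2 = (SOME k. witness F k S')"
    have kw: "witness F k1 S" "witness F k2 S'"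
      using wit wit' unfolding k1_def k2_def by (auto intro: someI)
    have "col (f, F, \<epsilon>, g) S = col (f, F, \<epsilon>, g) S'"
    proof (rule Zcol[OF c])
      show "S \<subseteq> Z" "S' \<subseteq> Z"
        unfolding S_def S'_def using \<tau>(1) infA by blast+
      show "finite S" "finite S'"
        using infpart(1)[OF F(1,2)] by (simp_all add: S_def S'_def)
    qed (use card in simp_all)
    then have "nat \<lfloor>(f (act k1 y) + B f) / \<epsilon>\<rfloor> = nat \<lfloor>(f (act k2 y) + B f) / \<epsilon>\<rfloor>"
    proof -
      have "\<exists>k. witness F k S" "\<exists>k. witness F k S'"
        using wit wit' by blast+
      with \<open>col (f, F, \<epsilon>, g) S = col (f, F, \<epsilon>, g) S'\<close> show ?thesis
        by (simp only: col_def prod.case if_True k1_def k2_def)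
    qed
    moreover have "0 \<le> f (act j y) + B f" if "j \<in> carrier G" for j
      using B[OF c Y.act_closed[OF that y]] by simp
    then have "0 \<le> \<lfloor>(f (act k1 y) + B f) / \<epsilon>\<rfloor>" "0 \<le> \<lfloor>(f (act k2 y) + B f) / \<epsilon>\<rfloor>"
      using kw ctrl by (auto simp: witness_def controls_def)
    ultimately have "\<lfloor>(f (act k1 y) + B f) / \<epsilon>\<rfloor> = \<lfloor>(f (act k2 y) + B f) / \<epsilon>\<rfloor>"
      by (simp only: eq_nat_nat_iff)
    then have "\<bar>(f (act k1 y) + B f) - (f (act k2 y) + B f)\<bar> \<le> \<epsilon>"
      using ctrl by (intro eq_floor_close) (auto simp: controls_def)
    moreover have "\<bar>f (act h y) - f (act k1 y)\<bar> \<le> \<epsilon>" "\<bar>f (act (g \<otimes> h) y) - f (act k2 y)\<bar> \<le> \<epsilon>"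
      using close[OF ctrl wit kw(1)] close[OF ctrl wit' kw(2)] .
    ultimately show "\<bar>f (act g (act h y)) - f (act h y)\<bar> \<le> 3 * \<epsilon>"
      using Y.act_mult[OF g h(1) y] by (simp add: abs_le_iff)
  qed
qed

end

section \<open>Aligned points\<close>

text \<open>
  The preimage of a closed set \<open>C\<close> is the projection of the closed set \<open>R \<inter> (X \<times> C)\<close> along the compact space \<open>Y\<close>.
\<close>

lemma continuous_map_from_closed_graph:
  assumes "compact_space Y" "closedin (prod_topology X Y) R"
    and graph: "\<And>x y. x \<in> topspace X \<Longrightarrow> (x, y) \<in> R \<longleftrightarrow> y \<in> topspace Y \<and> y = f x"
    and f: "f \<in> topspace X \<rightarrow> topspace Y"
  shows "continuous_map X Y f"
  unfolding continuous_map_closedin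
proof (intro conjI ballI allI impI)
  fix C assume C: "closedin Y C"
  have "closedin (prod_topology X Y) (R \<inter> topspace X \<times> C)"
    using assms(2) C by (intro closedin_Int) (auto simp: closedin_prod_Times_iff)
  then have "closedin X (fst ` (R \<inter> topspace X \<times> C))"
    using closed_map_fst[OF assms(1), of X] by (simp add: closed_map_def)
  moreover have "fst ` (R \<inter> topspace X \<times> C) = {x \<in> topspace X. f x \<in> C}"
  proof
    show "fst ` (R \<inter> topspace X \<times> C) \<subseteq> {x \<in> topspace X. f x \<in> C}"
      using graph by auto
    show "{x \<in> topspace X. f x \<in> C} \<subseteq> fst ` (R \<inter> topspace X \<times> C)"
    proof
      fix x assume "x \<in> {x \<in> topspace X. f x \<in> C}"
      then have "(x, f x) \<in> R \<inter> topspace X \<times> C"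
        using graph[of x "f x"] f by auto
      then show "x \<in> fst ` (R \<inter> topspace X \<times> C)"
        by force
    qed
  qed
  ultimately show "closedin X {x \<in> topspace X. f x \<in> C}"
    by simp
qed (use f in auto)

lemma (in flow) subflow_closure_of_orbit:
  assumes "y \<in> topspace Y"
  shows "subflow G Y act (Y closure_of orbit G act y)"
  unfolding subflow_def
proof (intro conjI ballI)
  have orbit: "orbit G act y \<subseteq> topspace Y"
    using assms act_closed by (auto simp: orbit_def)
  have "y \<in> orbit G act y"
    using assms by (rule orbit_refl)
  then show "Y closure_of orbit G act y \<noteq> {}"
    using closure_of_subset[OF orbit] by blast
  fix g z assume g: "g \<in> carrier G" and z: "z \<in> Y closure_of orbit G act y"
  have "act g ` orbit G act y \<subseteq> orbit G act y"
    using assms g by (auto simp: orbit_def act_mult[symmetric])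
  then have "Y closure_of (act g ` orbit G act y) \<subseteq> Y closure_of orbit G act y"
    by (rule closure_of_mono)
  moreover have "act g ` (Y closure_of orbit G act y) \<subseteq> Y closure_of (act g ` orbit G act y)"
    using continuous_map_image_closure_subset[OF continuous_map_act[OF g]] .
  ultimately show "act g z \<in> Y closure_of orbit G act y"
    using z by blast
qed simp

lemma (in flow) closure_of_orbit_subset:
  assumes "subflow G Y act M" "y \<in> M"
  shows "Y closure_of orbit G act y \<subseteq> M"
  using assms by (intro closure_of_minimal) (auto simp: subflow_def orbit_def)

context flow_of_dense_subgroup
begin

text \<open>
  Up to the unavoidable error, the elements of \<open>G\<close> that preserve the order induced by \<open>p\<close> on \<open>F\<close> do not
  change the value of \<open>f\<close> at \<open>y\<close>. An exact stabilizer of \<open>p\<close> would not do: it can be trivial, since \<open>p\<close> is arbitrary.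
\<close>

definition aligned :: "('i \<Rightarrow> 'k rel) \<Rightarrow> 'y \<Rightarrow> bool" where
  "aligned p y \<longleftrightarrow> p \<in> ords \<and> y \<in> topspace Y \<and>
     (\<forall>f F \<epsilon> g. controls f F \<epsilon> \<longrightarrow> g \<in> carrier G \<longrightarrow> pattern F (oact g p) = pattern F p \<longrightarrow>
        \<bar>f (act g y) - f y\<bar> \<le> 3 * \<epsilon>)"

lemma closedin_deviation:
  assumes "continuous_map Y euclideanreal f" "g \<in> carrier G"
  shows "closedin Y {y \<in> topspace Y. \<bar>f (act g y) - f y\<bar> \<le> \<epsilon>}"
proof -
  have "continuous_map Y euclideanreal (\<lambda>y. f (act g y))"
    using continuous_map_compose[OF Y.continuous_map_act[OF assms(2)] assms(1)] by (simp add: o_def)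
  then have "continuous_map Y euclideanreal (\<lambda>y. \<bar>f (act g y) - f y\<bar>)"
    using assms(1) by (intro continuous_map_real_abs continuous_map_diff)
  from closedin_continuous_map_preimage[OF this, of "{..\<epsilon>}"] show ?thesis
    by simp
qed

lemma closedin_aligned: "closedin (prod_topology ords_space Y) {(p, y). aligned p y}"
  unfolding closedin_def
proof
  show "{(p, y). aligned p y} \<subseteq> topspace (prod_topology ords_space Y)"
    by (auto simp: aligned_def)
  show "openin (prod_topology ords_space Y) (topspace (prod_topology ords_space Y) - {(p, y). aligned p y})"
  proof (subst openin_subopen, intro ballI)
    fix z assume "z \<in> topspace (prod_topology ords_space Y) - {(p, y). aligned p y}"
    then obtain p y f F \<epsilon> g where z: "z = (p, y)" and py: "p \<in> ords" "y \<in> topspace Y"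
      and c: "controls f F \<epsilon>" "g \<in> carrier G" "pattern F (oact g p) = pattern F p"
      and big: "\<not> \<bar>f (act g y) - f y\<bar> \<le> 3 * \<epsilon>"
    proof -
      obtain p y where z: "z = (p, y)" "p \<in> ords" "y \<in> topspace Y" "\<not> aligned p y"
        using \<open>z \<in> _\<close> by auto
      then obtain f F \<epsilon> g where "controls f F \<epsilon>" "g \<in> carrier G" "pattern F (oact g p) = pattern F p"
        "\<not> \<bar>f (act g y) - f y\<bar> \<le> 3 * \<epsilon>"
        unfolding aligned_def by blast
      with z show thesis
        by (intro that)
    qed
    define U where "U = {q \<in> ords. oact g q \<in> {r \<in> ords. pattern F r \<in> {pattern F p}}} \<inter> {q \<in> ords. pattern F q \<in> {pattern F p}}"
    define V where "V = topspace Y - {y \<in> topspace Y. \<bar>f (act g y) - f y\<bar> \<le> 3 * \<epsilon>}"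
    have F: "finite F" "F \<subseteq> pts"
      using c(1) by (auto simp: controls_def full_def)
    interpret ords: flow G T ords_space oact
      by (rule flow_ords)
    have op: "openin ords_space {r \<in> ords. pattern F r \<in> {pattern F p}}"
      using openin_continuous_map_preimage[OF continuous_map_pattern[OF F]] by (simp del: insert_iff)
    then have "openin ords_space U"
      unfolding U_def by (intro openin_Int openin_continuous_map_preimage[OF ords.continuous_map_act[OF c(2)]])
    moreover have "openin Y V"
      unfolding V_def using c(1,2) by (intro openin_diff openin_topspace closedin_deviation) (simp_all add: controls_def)
    ultimately have "openin (prod_topology ords_space Y) (U \<times> V)"
      by (simp add: openin_prod_Times_iff)
    moreover have "z \<in> U \<times> V"
      using z py c(2,3) big by (simp add: U_def V_def oact_closed)
    moreover have "U \<times> V \<subseteq> topspace (prod_topology ords_space Y) - {(p, y). aligned p y}"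
    proof
      fix w assume "w \<in> U \<times> V"
      then obtain q u where w: "w = (q, u)" "q \<in> ords" "u \<in> topspace Y" "pattern F (oact g q) = pattern F q"
        "\<not> \<bar>f (act g u) - f u\<bar> \<le> 3 * \<epsilon>"
        by (auto simp: U_def V_def)
      then have "\<not> aligned q u"
        using c(1,2) unfolding aligned_def by blast
      then show "w \<in> topspace (prod_topology ords_space Y) - {(p, y). aligned p y}"
        using w by simp
    qed
    ultimately show "\<exists>W. openin (prod_topology ords_space Y) W \<and> z \<in> W \<and>
        W \<subseteq> topspace (prod_topology ords_space Y) - {(p, y). aligned p y}"
      by blast
  qed
qed

text \<open>
  Conjugation by \<open>k\<close> translates the condition for \<open>f\<close>, \<open>F\<close> and \<open>g\<close> at \<open>act k y\<close> into a condition at \<open>y\<close>.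
\<close>

lemma aligned_act:
  assumes "aligned p y" "k \<in> carrier G"
  shows "aligned (oact k p) (act k y)"
  unfolding aligned_def
proof (intro conjI allI impI)
  have py: "p \<in> ords" "y \<in> topspace Y"
    using assms(1) by (auto simp: aligned_def)
  show "oact k p \<in> ords" "act k y \<in> topspace Y"
    using py assms(2) by (simp_all add: oact_closed Y.act_closed)
  fix f F \<epsilon> g
  assume c: "controls f F \<epsilon>" and g: "g \<in> carrier G" and pat: "pattern F (oact g (oact k p)) = pattern F (oact k p)"
  let ?g = "inv k \<otimes> g \<otimes> k"
  have kg: "?g \<in> carrier G" "k \<otimes> ?g = g \<otimes> k"
    using g assms(2) by (simp_all add: m_assoc[symmetric])
  have F: "F \<subseteq> pts"
    using c by (auto simp: controls_def full_def)
  have "oact g (oact k p) = oact k (oact ?g p)"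
    using py g assms(2) kg by (simp add: oact_mult[symmetric])
  then have "pattern (perm (inv k) ` F) (oact ?g p) = pattern (perm (inv k) ` F) p"
    using pat pattern_oact_eq_iff[OF oact_closed[OF py(1) kg(1)] py(1) assms(2) F] by simp
  then have "\<bar>f (act k (act ?g y)) - f (act k y)\<bar> \<le> 3 * \<epsilon>"
    using assms(1) controls_translate[OF c assms(2)] kg(1) unfolding aligned_def by blast
  moreover have "act k (act ?g y) = act g (act k y)"
    using py g assms(2) kg by (simp add: Y.act_mult[symmetric])
  ultimately show "\<bar>f (act g (act k y)) - f (act k y)\<bar> \<le> 3 * \<epsilon>"
    by simp
qed

text \<open>
  Each condition in the definition of \<open>aligned\<close> defines a closed set of points \<open>y\<close>. Any finitely many of
  these sets have a common point in every orbit, by \<open>ex_nearly_fixed_translate\<close>, so by compactness all of them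
  have a common point in \<open>M\<close>.
\<close>

lemma ex_aligned_in_subflow:
  assumes p: "p \<in> ords" and M: "subflow G Y act M"
  obtains y where "y \<in> M" "aligned p y"
proof -
  define Cond where "Cond = {(f, F, \<epsilon>, g). controls f F \<epsilon> \<and> g \<in> carrier G \<and> pattern F (oact g p) = pattern F p}"
  define C where "C = (\<lambda>(f, F :: ('i \<times> 'k) set, \<epsilon> :: real, g). {y \<in> topspace Y. \<bar>f (act g y) - f y\<bar> \<le> 3 * \<epsilon>})"
  have M': "closedin Y M" "M \<noteq> {}" "M \<subseteq> topspace Y" "\<And>g z. g \<in> carrier G \<Longrightarrow> z \<in> M \<Longrightarrow> act g z \<in> M"
    using M closedin_subset by (auto simp: subflow_def)
  have closed: "\<forall>D\<in>insert M (C ` Cond). closedin Y D"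
    using M'(1) by (auto simp: Cond_def C_def controls_def intro: closedin_deviation)
  have fip: "\<Inter>\<D> \<noteq> {}" if \<D>: "finite \<D>" "\<D> \<subseteq> insert M (C ` Cond)" for \<D>
  proof -
    have "finite (\<D> - {M})" "\<D> - {M} \<subseteq> C ` Cond"
      using \<D> by auto
    then obtain Q where Q: "Q \<subseteq> Cond" "finite Q" "\<D> - {M} = C ` Q"
      by (meson finite_subset_image)
    obtain y where y: "y \<in> M"
      using M'(2) by blast
    obtain h where h: "h \<in> carrier G"
      "\<And>f F \<epsilon> g. (f, F, \<epsilon>, g) \<in> Q \<Longrightarrow> \<bar>f (act g (act h y)) - f (act h y)\<bar> \<le> 3 * \<epsilon>"
    proof (rule ex_nearly_fixed_translate[OF p _ Q(2)])
      show "y \<in> topspace Y"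
        using y M'(3) by blast
      show "controls f F \<epsilon> \<and> g \<in> carrier G \<and> pattern F (oact g p) = pattern F p" if "(f, F, \<epsilon>, g) \<in> Q" for f F \<epsilon> g
        using that Q(1) by (auto simp: Cond_def)
    qed blast
    have hy: "act h y \<in> M" "act h y \<in> topspace Y"
      using M'(3,4) h(1) y by blast+
    have "act h y \<in> D" if "D \<in> \<D>" for D
    proof (cases "D = M")
      case False
      then have "D \<in> C ` Q"
        using that Q(3) by blast
      then show ?thesis
        using h(2) hy(2) by (auto simp: C_def)
    qed (use hy in simp)
    then show ?thesis
      by blast
  qed
  have "\<Inter>(insert M (C ` Cond)) \<noteq> {}"
    using Y.compact[unfolded compact_space_fip, rule_format, of "insert M (C ` Cond)"] closed fip by blast
  then obtain y where y: "y \<in> M" "\<And>c. c \<in> Cond \<Longrightarrow> y \<in> C c"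
    by auto
  have "aligned p y"
    unfolding aligned_def
  proof (intro conjI allI impI p)
    show "y \<in> topspace Y"
      using y(1) M'(3) by blast
    fix f F \<epsilon> g
    assume "controls f F \<epsilon>" "g \<in> carrier G" "pattern F (oact g p) = pattern F p"
    then show "\<bar>f (act g y) - f y\<bar> \<le> 3 * \<epsilon>"
      using y(2)[of "(f, F, \<epsilon>, g)"] by (simp add: Cond_def C_def)
  qed
  with y(1) show ?thesis
    by (rule that)
qed

text \<open>
  With the tolerance 1/10, the error 3/10 of alignment together with errors of 1/10 at both ends stays
  below the distance 1 of the two values.
\<close>

lemma ex_controlled_separation:
  assumes "z \<in> topspace Y" "z' \<in> topspace Y" "z \<noteq> z'"
  obtains f F where "controls f F (1/10)" "f z = 0" "f z' = 1"
proof -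
  have "normal_space Y"
    using Y.compact Y.Hausdorff_flow by (simp add: compact_Hausdorff_or_regular_imp_normal_space)
  moreover have "closedin Y {z}" "closedin Y {z'}"
    using assms Y.Hausdorff_flow by (simp_all add: closedin_Hausdorff_sing_eq)
  moreover have "disjnt {z} {z'}"
    using assms(3) by simp
  ultimately obtain f where f: "continuous_map Y (top_of_set {0..1::real}) f" "f ` {z} \<subseteq> {0}" "f ` {z'} \<subseteq> {1}"
    using Urysohn_lemma[of Y "{z}" "{z'}" 0 1] by auto
  have "continuous_map Y euclideanreal f"
    using f(1) by (simp add: continuous_map_in_subtopology)
  then obtain F where "controls f F (1/10)"
    using ex_controls[of f "1/10"] by auto
  with f show ?thesis
    by (intro that[of f F]) auto
qed

definition limit_graph :: "('i \<Rightarrow> 'k rel) \<Rightarrow> 'y \<Rightarrow> (('i \<Rightarrow> 'k rel) \<times> 'y) set" where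
  "limit_graph p y = prod_topology ords_space Y closure_of ((\<lambda>g. (oact g p, act g y)) ` carrier G)"

lemma limit_graph_aligned:
  assumes "aligned p y" "(q, z) \<in> limit_graph p y"
  shows "aligned q z"
proof -
  have "(\<lambda>g. (oact g p, act g y)) ` carrier G \<subseteq> {(p, y). aligned p y}"
    using aligned_act[OF assms(1)] by auto
  then have "limit_graph p y \<subseteq> {(p, y). aligned p y}"
    unfolding limit_graph_def by (rule closure_of_minimal[OF _ closedin_aligned])
  with assms(2) show ?thesis
    by blast
qed

lemma aligned_close:
  assumes "aligned p y" "controls f F \<epsilon>" "g \<in> carrier G" "h \<in> carrier G"
    "pattern F (oact g p) = pattern F (oact h p)"
  shows "\<bar>f (act h y) - f (act g y)\<bar> \<le> 3 * \<epsilon>"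
proof -
  have py: "p \<in> ords" "y \<in> topspace Y"
    using assms(1) by (auto simp: aligned_def)
  have eq: "h \<otimes> inv g \<otimes> g = h"
    using assms(3,4) by (simp add: m_assoc)
  have "oact (h \<otimes> inv g) (oact g p) = oact h p" "act (h \<otimes> inv g) (act g y) = act h y"
    using assms(3,4) py eq by (simp_all add: oact_mult[symmetric] Y.act_mult[symmetric])
  moreover have "aligned (oact g p) (act g y)"
    using aligned_act assms(1,3) by blast
  then have "pattern F (oact (h \<otimes> inv g) (oact g p)) = pattern F (oact g p) \<longrightarrow>
      \<bar>f (act (h \<otimes> inv g) (act g y)) - f (act g y)\<bar> \<le> 3 * \<epsilon>"
    using assms(2-4) unfolding aligned_def by (meson inv_closed m_closed)
  ultimately show ?thesis
    using assms(5) by simp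
qed

text \<open>
  Suppose that a continuous \<open>f\<close>, controlled by \<open>F\<close>, takes the values 0 at \<open>z\<close> and 1 at \<open>z'\<close>. There are \<open>g\<close> and \<open>h\<close>
  such that \<open>oact g p\<close> and \<open>oact h p\<close> both induce the same order as \<open>q\<close> on \<open>F\<close>, while \<open>f (act g y)\<close> is near 0 and
  \<open>f (act h y)\<close> is near 1. This contradicts alignment.
\<close>

lemma limit_graph_functional:
  assumes "aligned p y" "(q, z) \<in> limit_graph p y" "(q, z') \<in> limit_graph p y"
  shows "z = z'"
proof (rule ccontr)
  assume "z \<noteq> z'"
  have q: "q \<in> ords" "z \<in> topspace Y" "z' \<in> topspace Y"
    using limit_graph_aligned[OF assms(1)] assms(2,3) by (auto simp: aligned_def)
  obtain f F where f: "controls f F (1/10)" "f z = 0" "f z' = 1"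
    using ex_controlled_separation[OF q(2,3) \<open>z \<noteq> z'\<close>] .
  have F: "finite F" "F \<subseteq> pts" and cont: "continuous_map Y euclideanreal f"
    using f(1) by (auto simp: controls_def full_def)
  have near: "\<exists>g\<in>carrier G. pattern F (oact g p) = pattern F q \<and> f (act g y) \<in> D"
    if w: "(q, w) \<in> limit_graph p y" "f w \<in> D" "open D" for w D
  proof -
    let ?N = "{r \<in> ords. pattern F r \<in> {pattern F q}} \<times> {u \<in> topspace Y. f u \<in> D}"
    have "openin ords_space {r \<in> ords. pattern F r \<in> {pattern F q}}"
      using openin_continuous_map_preimage[OF continuous_map_pattern[OF F]] by (simp del: insert_iff)
    moreover have "openin Y {u \<in> topspace Y. f u \<in> D}"
      using openin_continuous_map_preimage[OF cont] w(3) by simp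
    ultimately have "openin (prod_topology ords_space Y) ?N"
      by (simp add: openin_prod_Times_iff)
    moreover have "(q, w) \<in> ?N"
      using w limit_graph_aligned[OF assms(1) w(1)] by (simp add: aligned_def)
    ultimately have "\<exists>v. v \<in> (\<lambda>g. (oact g p, act g y)) ` carrier G \<and> v \<in> ?N"
      using w(1) unfolding limit_graph_def in_closure_of by (elim conjE allE[where x = ?N]) simp
    then show ?thesis
      by auto
  qed
  obtain g where g: "g \<in> carrier G" "pattern F (oact g p) = pattern F q" "f (act g y) \<in> {..<1/10}"
    using near[OF assms(2), of "{..<1/10}"] f(2) by auto
  obtain h where h: "h \<in> carrier G" "pattern F (oact h p) = pattern F q" "f (act h y) \<in> {9/10<..}"
    using near[OF assms(3), of "{9/10<..}"] f(3) by auto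
  show False
    using aligned_close[OF assms(1) f(1) g(1) h(1)] g h by auto
qed

text \<open>
  The projection to \<open>ords\<close> is closed, because \<open>Y\<close> is compact, and it contains the dense orbit of \<open>p\<close>.
\<close>

lemma limit_graph_total:
  assumes "aligned p y" "q \<in> ords"
  shows "\<exists>z. (q, z) \<in> limit_graph p y"
proof -
  have py: "p \<in> ords" "y \<in> topspace Y"
    using assms(1) by (auto simp: aligned_def)
  have "closedin ords_space (fst ` limit_graph p y)"
    using closed_map_fst[OF Y.compact, of ords_space] by (simp add: closed_map_def limit_graph_def)
  moreover have "orbit G oact p \<subseteq> fst ` limit_graph p y"
  proof
    fix r assume "r \<in> orbit G oact p"
    then obtain g where g: "g \<in> carrier G" "r = oact g p"
      by (auto simp: orbit_def)
    have "(\<lambda>g. (oact g p, act g y)) ` carrier G \<subseteq> limit_graph p y"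
      unfolding limit_graph_def using py by (intro closure_of_subset) (auto simp: oact_closed Y.act_closed)
    then show "r \<in> fst ` limit_graph p y"
      using g by force
  qed
  ultimately have "ords_space closure_of orbit G oact p \<subseteq> fst ` limit_graph p y"
    by (intro closure_of_minimal)
  then show ?thesis
    using assms(2) orbit_closure_ords[OF py(1)] by force
qed

lemma limit_graph_act:
  assumes "aligned p y" "(q, z) \<in> limit_graph p y" "k \<in> carrier G"
  shows "(oact k q, act k z) \<in> limit_graph p y"
proof -
  interpret ords: flow G T ords_space oact
    by (rule flow_ords)
  have py: "p \<in> ords" "y \<in> topspace Y"
    using assms(1) by (auto simp: aligned_def)
  let ?S = "(\<lambda>g. (oact g p, act g y)) ` carrier G"
  let ?h = "\<lambda>(q, z). (oact k q, act k z)"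
  have "continuous_map (prod_topology ords_space Y) (prod_topology ords_space Y) ?h"
    using ords.continuous_map_act[OF assms(3)] Y.continuous_map_act[OF assms(3)]
    by (simp add: continuous_map_prod_top)
  from continuous_map_image_closure_subset[OF this]
  have "?h ` limit_graph p y \<subseteq> prod_topology ords_space Y closure_of (?h ` ?S)"
    by (simp add: limit_graph_def)
  also have "?h ` ?S \<subseteq> ?S"
    using assms(3) py by (auto simp: oact_mult[symmetric] Y.act_mult[symmetric])
  then have "prod_topology ords_space Y closure_of (?h ` ?S) \<subseteq> limit_graph p y"
    unfolding limit_graph_def by (rule closure_of_mono)
  finally show ?thesis
    using assms(2) by auto
qed

lemma flow_map_of_aligned:
  assumes "aligned p y"
  obtains \<phi> where "flow_map G ords_space oact Y act \<phi>" "\<phi> p = y" "\<And>q. q \<in> ords \<Longrightarrow> aligned q (\<phi> q)"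
proof -
  have py: "p \<in> ords" "y \<in> topspace Y"
    using assms by (auto simp: aligned_def)
  define \<phi> where "\<phi> q = (THE z. (q, z) \<in> limit_graph p y)" for q
  have \<phi>: "(q, z) \<in> limit_graph p y \<longleftrightarrow> z = \<phi> q" if q: "q \<in> ords" for q z
  proof -
    have "\<exists>!z. (q, z) \<in> limit_graph p y"
      using limit_graph_total[OF assms q] limit_graph_functional[OF assms] by blast
    then show ?thesis
      unfolding \<phi>_def by (metis theI')
  qed
  have al: "aligned q (\<phi> q)" if "q \<in> ords" for q
    using \<phi>[OF that] limit_graph_aligned[OF assms] by blast
  have in_Y: "\<phi> q \<in> topspace Y" if "q \<in> ords" for q
    using al[OF that] by (simp add: aligned_def)
  have cont: "continuous_map ords_space Y \<phi>"
  proof (rule continuous_map_from_closed_graph[OF Y.compact])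
    show "closedin (prod_topology ords_space Y) (limit_graph p y)"
      by (simp add: limit_graph_def)
  qed (use \<phi> in_Y in auto)
  have equiv: "\<phi> (oact g q) = act g (\<phi> q)" if "g \<in> carrier G" "q \<in> ords" for g q
    using limit_graph_act[OF assms _ that(1), of q "\<phi> q"] that \<phi> oact_closed by metis
  have "(\<lambda>g. (oact g p, act g y)) ` carrier G \<subseteq> limit_graph p y"
    unfolding limit_graph_def using py by (intro closure_of_subset) (auto simp: oact_closed Y.act_closed)
  then have "(oact \<one> p, act \<one> y) \<in> limit_graph p y"
    by blast
  then have "\<phi> p = y"
    using \<phi> py by (simp add: oact_one Y.act_one)
  with cont equiv al show ?thesis
    by (intro that[of \<phi>]) (auto simp: flow_map_def)
qed

end

section \<open>Almost periodic points and the universal minimal flow\<close>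

lemma flow_map_image_subflow:
  assumes "flow G T X a" "flow G T Y b" "flow_map G X a Y b f"
  shows "subflow G Y b (f ` topspace X)"
proof -
  interpret X: flow G T X a by fact
  interpret Y: flow G T Y b by fact
  have f: "continuous_map X Y f" and eq: "\<And>g x. g \<in> carrier G \<Longrightarrow> x \<in> topspace X \<Longrightarrow> f (a g x) = b g (f x)"
    using assms(3) by (auto simp: flow_map_def)
  have "compactin Y (f ` topspace X)"
    using image_compactin[OF _ f] X.compact by (simp add: compact_space_def)
  then have "closedin Y (f ` topspace X)"
    using Y.Hausdorff_flow by (simp add: compactin_imp_closedin)
  moreover have "b g z \<in> f ` topspace X" if "g \<in> carrier G" "z \<in> f ` topspace X" for g z
    using that eq X.act_closed by (auto simp flip: eq)
  ultimately show ?thesis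
    using X.nonempty by (auto simp: subflow_def)
qed

context flow_of_dense_subgroup
begin

lemma flow_Y: "flow G T Y act"
  by (rule Y.flow_axioms)

lemma flow_map_image_minimal:
  assumes "flow_map G ords_space oact Y act \<phi>"
  shows "minimal_subflow G Y act (\<phi> ` ords)"
  unfolding minimal_subflow_def
proof (intro conjI allI impI)
  show "subflow G Y act (\<phi> ` ords)"
    using flow_ords flow_Y assms by (rule flow_map_image_subflow)
  have \<phi>: "continuous_map ords_space Y \<phi>"
      "\<And>g q. g \<in> carrier G \<Longrightarrow> q \<in> ords \<Longrightarrow> \<phi> (oact g q) = act g (\<phi> q)"
    using assms by (auto simp: flow_map_def)
  fix W assume W: "subflow G Y act W \<and> W \<subseteq> \<phi> ` ords"
  let ?V = "{q \<in> ords. \<phi> q \<in> W}"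
  have "subflow G ords_space oact ?V"
    unfolding subflow_def
  proof (intro conjI ballI)
    show "?V \<noteq> {}"
      using W unfolding subflow_def by blast
    show "closedin ords_space ?V"
      using W \<phi>(1) by (intro closedin_continuous_map_preimage) (auto simp: subflow_def)
    show "oact g q \<in> ?V" if "g \<in> carrier G" "q \<in> ?V" for g q
      using that W \<phi>(2) by (simp add: subflow_def oact_closed)
  qed
  then have "?V = ords"
    using minimal_flow_ords unfolding minimal_flow_def minimal_subflow_def by blast
  then show "W = \<phi> ` ords"
    using W by blast
qed

text \<open>
  The image of the map belonging to an aligned point of \<open>M\<close> is itself minimal and meets \<open>M\<close>.
\<close>

lemma minimal_subflow_eq_image:
  assumes p: "p \<in> ords" and M: "minimal_subflow G Y act M"
  obtains \<phi> where "flow_map G ords_space oact Y act \<phi>" "\<phi> ` ords = M" "\<And>q. q \<in> ords \<Longrightarrow> aligned q (\<phi> q)"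
proof -
  have sM: "subflow G Y act M"
    using M by (simp add: minimal_subflow_def)
  obtain y where y: "y \<in> M" "aligned p y"
    using ex_aligned_in_subflow[OF p sM] by blast
  obtain \<phi> where \<phi>: "flow_map G ords_space oact Y act \<phi>" "\<phi> p = y" "\<And>q. q \<in> ords \<Longrightarrow> aligned q (\<phi> q)"
    using flow_map_of_aligned[OF y(2)] by blast
  have min: "minimal_subflow G Y act (\<phi> ` ords)"
    using \<phi>(1) by (rule flow_map_image_minimal)
  have "subflow G Y act (\<phi> ` ords \<inter> M)"
    using min sM y(1) \<phi>(2) p unfolding minimal_subflow_def subflow_def by (auto intro: closedin_Int)
  then have "\<phi> ` ords \<inter> M = \<phi> ` ords" "\<phi> ` ords \<inter> M = M"
    using min M unfolding minimal_subflow_def by blast+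
  then have "\<phi> ` ords = M"
    by simp
  with \<phi> show ?thesis
    using that by blast
qed

text \<open>
  An almost periodic point lies in a minimal subflow, all of whose points are values of a map \<open>\<phi>\<close> that
  sends every \<open>q\<close> to a point aligned with \<open>q\<close>. Conversely, an aligned point is a value of a \<open>G\<close>-map
  defined on the minimal flow \<open>ords\<close>, and images of minimal flows are minimal.
\<close>

lemma almost_periodic_iff_aligned:
  "z \<in> almost_periodic_points G Y act \<longleftrightarrow> (\<exists>p. aligned p z)"
proof
  assume "z \<in> almost_periodic_points G Y act"
  then have z: "z \<in> topspace Y" "minimal_subflow G Y act (Y closure_of orbit G act z)"
    by (auto simp: almost_periodic_points_def)
  obtain p where "p \<in> ords"
    using ords_nonempty by blast
  then obtain \<phi> where \<phi>: "\<phi> ` ords = Y closure_of orbit G act z" "\<And>q. q \<in> ords \<Longrightarrow> aligned q (\<phi> q)"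
    using minimal_subflow_eq_image[OF _ z(2)] by metis
  have "orbit G act z \<subseteq> topspace Y"
    using z(1) Y.act_closed by (auto simp: orbit_def)
  then have "z \<in> \<phi> ` ords"
    using closure_of_subset[of _ Y] Y.orbit_refl[OF z(1)] \<phi>(1) by blast
  then show "\<exists>p. aligned p z"
    using \<phi>(2) by blast
next
  assume "\<exists>p. aligned p z"
  then obtain p where p: "aligned p z" ..
  then have pz: "p \<in> ords" "z \<in> topspace Y"
    by (auto simp: aligned_def)
  obtain \<phi> where \<phi>: "flow_map G ords_space oact Y act \<phi>" "\<phi> p = z"
    using flow_map_of_aligned[OF p] by blast
  have min: "minimal_subflow G Y act (\<phi> ` ords)"
    using \<phi>(1) by (rule flow_map_image_minimal)
  have "Y closure_of orbit G act z \<subseteq> \<phi> ` ords"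
    using min \<phi>(2) pz by (intro Y.closure_of_orbit_subset) (auto simp: minimal_subflow_def)
  moreover have "subflow G Y act (Y closure_of orbit G act z)"
    using pz(2) by (rule Y.subflow_closure_of_orbit)
  ultimately have "Y closure_of orbit G act z = \<phi> ` ords"
    using min by (simp add: minimal_subflow_def)
  then show "z \<in> almost_periodic_points G Y act"
    using min pz(2) by (simp add: almost_periodic_points_def)
qed

lemma closedin_almost_periodic_points: "closedin Y (almost_periodic_points G Y act)"
proof -
  have "closedin Y (snd ` {(p, y). aligned p y})"
    using closed_map_snd[OF compact_ords, of Y] closedin_aligned by (simp add: closed_map_def)
  moreover have "snd ` {(p, y). aligned p y} = almost_periodic_points G Y act"
    by (force simp: almost_periodic_iff_aligned)
  ultimately show ?thesis
    by simp
qed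

text \<open>
  The indicator function of the clopen set of all \<open>y\<close> such that \<open>f y\<close> induces a given order on \<open>F\<close> is
  invariant under the pointwise stabilizer of \<open>F\<close>, hence controlled by \<open>F\<close> with every \<open>\<epsilon>\<close>. For \<open>\<epsilon> = 1/4\<close>
  alignment leaves it no room to change its value.
\<close>

lemma flow_map_to_ords_determines_pattern:
  assumes f: "flow_map G Y act ords_space oact f" and \<phi>: "flow_map G ords_space oact Y act \<phi>"
    and aligned: "\<And>q. q \<in> ords \<Longrightarrow> aligned q (\<phi> q)" and F: "full F"
    and qr: "q \<in> ords" "r \<in> ords" "pattern F q = pattern F r"
  shows "pattern F (f (\<phi> q)) = pattern F (f (\<phi> r))"
proof -
  have fin: "finite F" "F \<subseteq> pts"
    using F by (auto simp: full_def)
  have f': "continuous_map Y ords_space f" "\<And>g y. g \<in> carrier G \<Longrightarrow> y \<in> topspace Y \<Longrightarrow> f (act g y) = oact g (f y)"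
    using f by (auto simp: flow_map_def)
  have \<phi>': "continuous_map ords_space Y \<phi>" "\<And>g q. g \<in> carrier G \<Longrightarrow> q \<in> ords \<Longrightarrow> \<phi> (oact g q) = act g (\<phi> q)"
    using \<phi> by (auto simp: flow_map_def)
  have fY: "f y \<in> ords" if "y \<in> topspace Y" for y
    using f'(1) that by (auto simp: continuous_map_def)
  have \<phi>Y: "\<phi> q \<in> topspace Y" if "q \<in> ords" for q
    using aligned[OF that] by (simp add: aligned_def)
  define ind where "ind y = (if pattern F (f y) = pattern F (f (\<phi> q)) then 1 else (0 :: real))" for y
  have "continuous_map (discrete_topology UNIV) euclideanreal (\<lambda>s. if s = pattern F (f (\<phi> q)) then 1 else (0 :: real))"
    by simp
  from continuous_map_compose[OF continuous_map_compose[OF f'(1) continuous_map_pattern[OF fin]] this]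
  have ind: "continuous_map Y euclideanreal ind"
    by (simp add: o_def ind_def[abs_def])
  have "controls ind F (1/4)"
    unfolding controls_def
  proof (intro conjI ballI impI ind F)
    fix g y assume g: "g \<in> carrier G" "\<forall>x\<in>F. perm g x = x" and y: "y \<in> topspace Y"
    have "perm (inv g) x = x" if "x \<in> F" for x
      using g that fin(2) perm_inv(1)[OF g(1), of x] by auto
    then have "(x, z) \<in> flat (oact g (f y)) \<longleftrightarrow> (x, z) \<in> flat (f y)" if "x \<in> F" "z \<in> F" for x z
      using that flat_oact_iff[OF fY[OF y] g(1) subsetD[OF fin(2) that(1)] subsetD[OF fin(2) that(2)]] by simp
    then have "pattern F (oact g (f y)) = pattern F (f y)"
      by (auto simp: pattern_def)
    then show "\<bar>ind (act g y) - ind y\<bar> \<le> 1/4"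
      using f'(2)[OF g(1) y] by (simp add: ind_def)
  qed simp
  note ctrl = this
  have near: "\<exists>g\<in>carrier G. pattern F (oact g q) = pattern F u \<and> pattern F (f (\<phi> (oact g q))) = pattern F (f (\<phi> u))"
    if u: "u \<in> ords" for u
  proof -
    let ?N = "{v \<in> ords. pattern F v \<in> {pattern F u}} \<inter> {v \<in> ords. (pattern F \<circ> (f \<circ> \<phi>)) v \<in> {pattern F (f (\<phi> u))}}"
    have cont: "continuous_map ords_space (discrete_topology UNIV) (pattern F \<circ> (f \<circ> \<phi>))"
      by (intro continuous_map_compose[OF _ continuous_map_pattern[OF fin]] continuous_map_compose[OF \<phi>'(1) f'(1)])
    have "openin ords_space ?N"
      by (intro openin_Int openin_continuous_map_preimage[OF continuous_map_pattern[OF fin]]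
          openin_continuous_map_preimage[OF cont]) (simp_all del: insert_iff)
    moreover have "u \<in> ords_space closure_of orbit G oact q"
      using u qr(1) by (simp add: orbit_closure_ords)
    moreover have "u \<in> ?N"
      using u by simp
    ultimately have "\<exists>v. v \<in> orbit G oact q \<and> v \<in> ?N"
      unfolding in_closure_of by (elim conjE allE[where x = ?N]) simp
    then show ?thesis
      by (auto simp: orbit_def)
  qed
  obtain h where h: "h \<in> carrier G" "pattern F (oact h q) = pattern F r"
    "pattern F (f (\<phi> (oact h q))) = pattern F (f (\<phi> r))"
    using near[OF qr(2)] by blast
  have "\<bar>ind (act h (\<phi> q)) - ind (act \<one> (\<phi> q))\<bar> \<le> 3 * (1/4)"
    using h qr by (intro aligned_close[OF aligned[OF qr(1)] ctrl]) (simp_all add: oact_one)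
  then have "ind (act h (\<phi> q)) = 1"
    using \<phi>Y[OF qr(1)] by (auto simp: Y.act_one ind_def split: if_splits)
  then have "pattern F (f (act h (\<phi> q))) = pattern F (f (\<phi> q))"
    by (simp add: ind_def split: if_splits)
  then show ?thesis
    using h(3) \<phi>'(2)[OF h(1) qr(1)] by simp
qed

text \<open>
  The map \<open>f \<circ> \<phi>\<close> is onto because \<open>ords\<close> is minimal. By the previous lemma it induces a map on the finite set of
  patterns on each full \<open>F\<close>, again onto and therefore injective. Patterns on all full \<open>F\<close> separate the points of \<open>ords\<close>.
\<close>

lemma aligned_flow_map_injective:
  assumes f: "flow_map G Y act ords_space oact f" and \<phi>: "flow_map G ords_space oact Y act \<phi>"
    and aligned: "\<And>q. q \<in> ords \<Longrightarrow> aligned q (\<phi> q)"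
  shows "inj_on \<phi> ords"
proof (rule inj_onI)
  fix q r assume qr: "q \<in> ords" "r \<in> ords" "\<phi> q = \<phi> r"
  let ?\<psi> = "f \<circ> \<phi>"
  have \<phi>Y: "\<phi> u \<in> topspace Y" if "u \<in> ords" for u
    using aligned[OF that] by (simp add: aligned_def)
  have cont: "continuous_map ords_space ords_space ?\<psi>"
    using f \<phi> unfolding flow_map_def by (blast intro: continuous_map_compose)
  moreover have "?\<psi> (oact g u) = oact g (?\<psi> u)" if "g \<in> carrier G" "u \<in> ords" for g u
    using f \<phi> that \<phi>Y[OF that(2)] by (simp add: flow_map_def)
  ultimately have "flow_map G ords_space oact ords_space oact ?\<psi>"
    by (simp only: flow_map_def) blast
  then have "subflow G ords_space oact (?\<psi> ` ords)"
    by (rule flow_map_image_subflow[OF flow_ords flow_ords])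
  moreover have "?\<psi> ` ords \<subseteq> ords"
    using cont by (rule continuous_map_image_subset_topspace)
  ultimately have "subflow G ords_space oact (?\<psi> ` ords) \<and> ?\<psi> ` ords \<subseteq> ords"
    by (rule conjI)
  then have surj: "?\<psi> ` ords = ords"
    using minimal_flow_ords unfolding minimal_flow_def minimal_subflow_def by simp
  have "pattern F q = pattern F r" if F: "full F" for F
  proof -
    define E where "E = pattern F ` ords"
    (* The map on patterns induced by f \<circ> \<phi>; equal patterns of arguments give equal patterns of values. *)
  define \<theta> where "\<theta> s = pattern F (?\<psi> (SOME u. u \<in> ords \<and> pattern F u = s))" for s
    have \<theta>: "\<theta> (pattern F u) = pattern F (?\<psi> u)" if u: "u \<in> ords" for u
    proof -
      have "\<exists>v. v \<in> ords \<and> pattern F v = pattern F u"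
        using u by blast
      from someI_ex[OF this] show ?thesis
        unfolding \<theta>_def using flow_map_to_ords_determines_pattern[OF f \<phi> aligned F _ u] by simp
    qed
    have "E \<subseteq> Pow (F \<times> F)"
      by (auto simp: E_def pattern_def)
    then have "finite E"
      using F by (auto simp: full_def intro: finite_subset)
    moreover have "E \<subseteq> \<theta> ` E"
    proof
      fix s assume "s \<in> E"
      then obtain v where v: "v \<in> ords" "s = pattern F v"
        unfolding E_def by (elim imageE) (rule that)
      then have "v \<in> ?\<psi> ` ords"
        using surj by simp
      then obtain u where u: "u \<in> ords" "v = ?\<psi> u"
        by (elim imageE) (rule that)
      then have "s = \<theta> (pattern F u)" "pattern F u \<in> E"
        using v(2) \<theta> by (simp_all add: E_def)
      then show "s \<in> \<theta> ` E"
        by (rule image_eqI)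
    qed
    ultimately have inj: "inj_on \<theta> E"
      by (rule finite_surj_inj)
    have eq: "\<theta> (pattern F q) = \<theta> (pattern F r)"
      unfolding \<theta>[OF qr(1)] \<theta>[OF qr(2)] by (simp add: qr(3))
    have "pattern F q \<in> E" "pattern F r \<in> E"
      using qr(1,2) by (simp_all add: E_def)
    with inj eq show ?thesis
      by (rule inj_onD)
  qed
  note full_patterns = this
  have patterns: "pattern F q = pattern F r" if F: "finite F" "F \<subseteq> pts" for F
  proof -
    obtain F' where F': "full F'" "F \<subseteq> F'"
      using ex_full_superset[OF F] by blast
    have "pattern F u = pattern F' u \<inter> F \<times> F" for u
      using F'(2) by (auto simp: pattern_def)
    then show ?thesis
      using full_patterns[OF F'(1)] by simp
  qed
  show "q = r"
  proof (rule oact_eqI[OF qr(1,2)])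
    fix x y assume "x \<in> pts" "y \<in> pts"
    then have "pattern {x, y} q = pattern {x, y} r"
      by (intro patterns) auto
    then have "(x, y) \<in> pattern {x, y} q \<longleftrightarrow> (x, y) \<in> pattern {x, y} r"
      by simp
    then show "(x, y) \<in> flat q \<longleftrightarrow> (x, y) \<in> flat r"
      by (simp add: pattern_def)
  qed
qed

lemma flows_isomorphic_ords:
  assumes min: "minimal_flow G T Y act" and f: "flow_map G Y act ords_space oact f"
  shows "flows_isomorphic G Y act ords_space oact"
proof -
  obtain p where "p \<in> ords"
    using ords_nonempty by blast
  moreover have "minimal_subflow G Y act (topspace Y)"
    using min by (simp add: minimal_flow_def)
  ultimately obtain \<phi> where \<phi>: "flow_map G ords_space oact Y act \<phi>" "\<phi> ` ords = topspace Y"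
      "\<And>q. q \<in> ords \<Longrightarrow> aligned q (\<phi> q)"
    using minimal_subflow_eq_image by metis
  have "inj_on \<phi> ords"
    using aligned_flow_map_injective[OF f \<phi>(1) \<phi>(3)] by blast
  then have "homeomorphic_map ords_space Y \<phi>"
    using \<phi>(1,2) compact_ords Y.Hausdorff_flow
    by (intro continuous_imp_homeomorphic_map) (auto simp: flow_map_def)
  then obtain \<psi> where \<psi>: "homeomorphic_maps ords_space Y \<phi> \<psi>"
    by (auto simp: homeomorphic_map_maps)
  have inv: "\<And>q. q \<in> ords \<Longrightarrow> \<psi> (\<phi> q) = q" "\<And>y. y \<in> topspace Y \<Longrightarrow> \<phi> (\<psi> y) = y"
    and cont: "continuous_map Y ords_space \<psi>"
    using \<psi> by (auto simp: homeomorphic_maps_def)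
  have "\<psi> (act g y) = oact g (\<psi> y)" if "g \<in> carrier G" "y \<in> topspace Y" for g y
  proof -
    have \<psi>y: "\<psi> y \<in> ords"
      using cont that(2) by (auto simp: continuous_map_def)
    have "\<phi> (oact g (\<psi> y)) = act g (\<phi> (\<psi> y))"
      using \<phi>(1) that(1) \<psi>y by (simp add: flow_map_def)
    then have "\<psi> (act g y) = \<psi> (\<phi> (oact g (\<psi> y)))"
      using inv(2)[OF that(2)] by simp
    then show ?thesis
      using inv(1) oact_closed[OF \<psi>y that(1)] by simp
  qed
  then have "flow_map G Y act ords_space oact \<psi>"
    using cont by (simp add: flow_map_def)
  moreover have "homeomorphic_map Y ords_space \<psi>"
    using \<psi> homeomorphic_maps_sym homeomorphic_map_maps by blast
  ultimately show ?thesis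
    unfolding flows_isomorphic_def by blast
qed

end

context dense_subgroup_of_Sym_prod
begin

lemma flow_of_dense_subgroup:
  assumes "flow G T Y act"
  shows "flow_of_dense_subgroup G T I K emb Y act"
  using assms by (simp add: flow_of_dense_subgroup_def dense_subgroup_of_Sym_prod_axioms)

theorem is_CAP: "CAP TYPE('y) G T"
  unfolding CAP_def
  using topological_group flow_of_dense_subgroup.closedin_almost_periodic_points[OF flow_of_dense_subgroup]
  by blast

theorem universal_minimal_flow_ords: "universal_minimal_flow TYPE('z) G T ords_space oact"
  unfolding universal_minimal_flow_def
proof (intro conjI allI impI minimal_flow_ords)
  fix Y :: "'z topology" and act assume Y: "minimal_flow G T Y act"
  interpret Y: flow_of_dense_subgroup G T I K emb Y act
    using Y by (intro flow_of_dense_subgroup) (simp add: minimal_flow_def)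
  obtain p where "p \<in> ords"
    using ords_nonempty by blast
  moreover have "minimal_subflow G Y act (topspace Y)"
    using Y by (simp add: minimal_flow_def)
  ultimately show "\<exists>f. flow_map G ords_space oact Y act f \<and> f ` ords = topspace Y"
    using Y.minimal_subflow_eq_image by metis
qed

theorem universal_minimal_flow_unique:
  assumes "universal_minimal_flow TYPE('i \<Rightarrow> 'k rel) G T M act"
  shows "flows_isomorphic G M act ords_space oact"
proof -
  have M: "minimal_flow G T M act"
    using assms by (simp add: universal_minimal_flow_def)
  then interpret M: flow_of_dense_subgroup G T I K emb M act
    by (intro flow_of_dense_subgroup) (simp add: minimal_flow_def)
  obtain f where "flow_map G M act ords_space oact f"
    using assms minimal_flow_ords unfolding universal_minimal_flow_def by blast
  then show ?thesis
    by (rule M.flows_isomorphic_ords[OF M])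
qed

end

section \<open>Homeomorphism groups of scattered spaces\<close>

lemma continuous_map_into_discrete:
  assumes "h \<in> topspace Z \<rightarrow> D" "\<And>c. c \<in> D \<Longrightarrow> openin Z {z \<in> topspace Z. h z = c}"
  shows "continuous_map Z (discrete_topology D) h"
  unfolding continuous_map
proof (intro conjI allI impI)
  fix U assume U: "openin (discrete_topology D) U"
  then have "openin Z (\<Union>c\<in>U. {z \<in> topspace Z. h z = c})"
    using assms(2) by (intro openin_Union) auto
  moreover have "(\<Union>c\<in>U. {z \<in> topspace Z. h z = c}) = {z \<in> topspace Z. h z \<in> U}"
    by auto
  ultimately show "openin Z {z \<in> topspace Z. h z \<in> U}"
    by simp
qed (use assms(1) in auto)

lemma carrier_Homeo: "carrier (Homeo X) = {f \<in> Bij (topspace X). homeomorphic_map X X f}"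
  by (simp add: Homeo_def)

lemma mult_Homeo: "mult (Homeo X) = mult (BijGroup (topspace X))"
  by (simp add: Homeo_def)

lemma group_Homeo: "group (Homeo X)"
proof -
  let ?H = "{f \<in> Bij (topspace X). homeomorphic_map X X f}"
  have "subgroup ?H (BijGroup (topspace X))"
  proof (rule group.subgroupI[OF group_BijGroup])
    show "?H \<subseteq> carrier (BijGroup (topspace X))"
      by (auto simp: BijGroup_def)
    have "homeomorphic_map X X (\<lambda>x\<in>topspace X. x)"
      by (rule homeomorphic_map_eq[of X X id]) simp_all
    then show "?H \<noteq> {}"
      using id_Bij by blast
    fix f assume f: "f \<in> ?H"
    then obtain f' where f': "homeomorphic_maps X X f f'"
      by (auto simp: homeomorphic_map_maps)
    have inv: "f' y = inv_into (topspace X) f y" if y: "y \<in> topspace X" for y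
    proof -
      have "f' y \<in> topspace X" "f (f' y) = y"
        using f' y by (auto simp: homeomorphic_maps_def continuous_map_def)
      then show ?thesis
        using f homeomorphic_imp_injective_map[of X X f] inv_into_f_f[of f "topspace X" "f' y"] by simp
    qed
    have "homeomorphic_map X X f'"
      using f' homeomorphic_map_maps homeomorphic_maps_sym by blast
    then have "homeomorphic_map X X (\<lambda>x\<in>topspace X. inv_into (topspace X) f x)"
      by (rule homeomorphic_map_eq) (simp add: inv)
    then show "inv\<^bsub>BijGroup (topspace X)\<^esub> f \<in> ?H"
      using f by (simp add: inv_BijGroup restrict_inv_into_Bij)
    fix h assume h: "h \<in> ?H"
    have "homeomorphic_map X X (f \<circ> h)"
      using f h homeomorphic_map_compose by blast
    then have "homeomorphic_map X X (compose (topspace X) f h)"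
      by (rule homeomorphic_map_eq) (simp add: compose_def)
    then show "f \<otimes>\<^bsub>BijGroup (topspace X)\<^esub> h \<in> ?H"
      using f h by (simp add: BijGroup_def compose_Bij)
  qed
  then show ?thesis
    unfolding Homeo_def by (rule subgroup.subgroup_is_group[OF _ group_BijGroup])
qed

lemma CB_deriv_subset: "CB_deriv X \<alpha> \<subseteq> topspace X"
  using CB_deriv_antimono[OF ord_zero_le, of X \<alpha>] by (simp add: CB_deriv_zero)

lemma homeomorphic_map_nonisolated_iff:
  assumes g: "homeomorphic_map X X g" and S: "S \<subseteq> topspace X" "g ` S = S" and x: "x \<in> S"
  shows "g x \<in> nonisolated_points X S \<longleftrightarrow> x \<in> nonisolated_points X S"
proof -
  have "homeomorphic_map (subtopology X S) (subtopology X S) g"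
    using g S homeomorphic_imp_injective_map[OF g]
    by (intro homeomorphic_map_subtopologies[OF g]) (auto simp: inf.absorb2)
  from homeomorphic_map_openness[OF this, of "{x}"]
  have "openin (subtopology X S) {g x} \<longleftrightarrow> openin (subtopology X S) {x}"
    using x S(1) by auto
  then show ?thesis
    using x S(2) by (auto simp: nonisolated_points_def)
qed

text \<open>
  By induction on \<open>\<alpha>\<close>, since a homeomorphism that preserves a subspace preserves its set of isolated points.
\<close>

lemma homeomorphic_map_CB_deriv_iff:
  assumes g: "homeomorphic_map X X g" and x: "x \<in> topspace X"
  shows "g x \<in> CB_deriv X \<alpha> \<longleftrightarrow> x \<in> CB_deriv X \<alpha>"
  using x
proof (induction \<alpha> arbitrary: x rule: less_induct)
  case (less \<alpha>)
  have surj: "g ` topspace X = topspace X"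
    using g by (rule homeomorphic_imp_surjective_map)
  consider "\<alpha> = ord_zero" | \<beta> where "\<alpha> = ord_suc \<beta>" | "\<alpha> \<noteq> ord_zero" "\<nexists>\<beta>. \<alpha> = ord_suc \<beta>"
    by blast
  then show ?case
  proof cases
    case 1
    have "g x \<in> topspace X"
      using less.prems surj by blast
    then show ?thesis
      using less.prems by (simp add: 1 CB_deriv_zero)
  next
    case (2 \<beta>)
    let ?S = "CB_deriv X \<beta>"
    have IH: "g x \<in> ?S \<longleftrightarrow> x \<in> ?S" if "x \<in> topspace X" for x
      using that 2 less_ord_suc by (intro less.IH) simp_all
    have S: "?S \<subseteq> topspace X"
      by (rule CB_deriv_subset)
    have "g ` ?S = ?S"
    proof
      show "g ` ?S \<subseteq> ?S"
        using IH S by blast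
      show "?S \<subseteq> g ` ?S"
      proof
        fix y assume y: "y \<in> ?S"
        then obtain x where "x \<in> topspace X" "y = g x"
          using S surj by blast
        then show "y \<in> g ` ?S"
          using IH y by blast
      qed
    qed
    then have "g x \<in> nonisolated_points X ?S \<longleftrightarrow> x \<in> nonisolated_points X ?S" if "x \<in> ?S"
      using homeomorphic_map_nonisolated_iff[OF g S _ that] by simp
    moreover have "g x \<notin> nonisolated_points X ?S \<and> x \<notin> nonisolated_points X ?S" if "x \<notin> ?S"
      using IH[OF less.prems] that by (simp add: nonisolated_points_def)
    ultimately show ?thesis
      unfolding 2 CB_deriv_suc by (cases "x \<in> ?S") simp_all
  next
    case 3
    have "(\<forall>\<beta>\<in>{..<\<alpha>}. g x \<in> CB_deriv X \<beta>) \<longleftrightarrow> (\<forall>\<beta>\<in>{..<\<alpha>}. x \<in> CB_deriv X \<beta>)"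
      using less.IH less.prems by (intro ball_cong) simp_all
    then show ?thesis
      unfolding CB_deriv_limit[OF 3] by simp
  qed
qed

lemma homeomorphic_map_CB_level_iff:
  "homeomorphic_map X X g \<Longrightarrow> x \<in> topspace X \<Longrightarrow> g x \<in> CB_level X \<alpha> \<longleftrightarrow> x \<in> CB_level X \<alpha>"
  using homeomorphic_map_CB_deriv_iff[of X g x] by (simp add: CB_level_def)

lemma CB_level_subset: "CB_level X \<alpha> \<subseteq> topspace X"
  using CB_deriv_subset[of X \<alpha>] by (auto simp: CB_level_def)

lemma CB_level_unique:
  assumes "x \<in> CB_level X \<alpha>" "x \<in> CB_level X \<beta>"
  shows "\<alpha> = \<beta>"
proof -
  have "\<not> \<alpha> < \<beta>" if "x \<in> CB_level X \<alpha>" "x \<in> CB_level X \<beta>" for \<alpha> \<beta>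
    using that CB_deriv_antimono[of "ord_suc \<alpha>" \<beta> X] by (auto simp: CB_level_def ord_suc_le_iff)
  then show ?thesis
    using assms by (meson linorder_neqE)
qed

text \<open>
  The last derivative has no isolated points, so it is empty in a scattered space. The least \<open>\<alpha>\<close>
  for which the derivative omits \<open>x\<close> is then a successor: at a limit, the derivative is an intersection.
\<close>

lemma scattered_ex_CB_level:
  assumes "scattered_space X" "x \<in> topspace X"
  obtains \<alpha> where "\<alpha> < CB_rank X" "x \<in> CB_level X \<alpha>"
proof -
  have "CB_deriv X (CB_rank X) = {}"
  proof (rule ccontr)
    assume "CB_deriv X (CB_rank X) \<noteq> {}"
    then obtain y where "y \<in> CB_deriv X (CB_rank X)" "openin (subtopology X (CB_deriv X (CB_rank X))) {y}"
      using assms(1) CB_deriv_subset unfolding scattered_space_def by meson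
    then have "y \<notin> CB_deriv X (ord_suc (CB_rank X))"
      by (simp add: CB_deriv_suc nonisolated_points_def)
    then show False
      using \<open>y \<in> CB_deriv X (CB_rank X)\<close> CB_rank_attained[of X] by simp
  qed
  then have ex: "x \<notin> CB_deriv X (CB_rank X)"
    by simp
  define \<alpha> where "\<alpha> = (LEAST \<alpha>. x \<notin> CB_deriv X \<alpha>)"
  have \<alpha>: "x \<notin> CB_deriv X \<alpha>" "\<alpha> \<le> CB_rank X"
    unfolding \<alpha>_def using ex by (rule LeastI, intro Least_le)
  have below: "x \<in> CB_deriv X \<beta>" if "\<beta> < \<alpha>" for \<beta>
    using not_less_Least[of \<beta> "\<lambda>\<alpha>. x \<notin> CB_deriv X \<alpha>"] that unfolding \<alpha>_def by blast
  have "\<alpha> \<noteq> ord_zero"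
    using \<alpha>(1) assms(2) CB_deriv_zero by metis
  then have "\<exists>\<beta>. \<alpha> = ord_suc \<beta>"
    using \<alpha>(1) below CB_deriv_limit[of \<alpha> X] by auto
  then obtain \<beta> where \<beta>: "\<alpha> = ord_suc \<beta>" ..
  then have "\<beta> < \<alpha>"
    by (simp add: less_ord_suc)
  then show ?thesis
    using that[of \<beta>] \<alpha> \<beta> below by (simp add: CB_level_def)
qed

locale levelwise_transitive_space =
  fixes X :: "'a topology" and K :: "'a ordinal \<Rightarrow> 'k set" and b :: "'a ordinal \<Rightarrow> 'a \<Rightarrow> 'k"
  assumes scattered: "scattered_space X"
    and transitive: "\<And>(k :: nat) (\<alpha> :: nat \<Rightarrow> 'a ordinal) (x :: nat \<Rightarrow> 'a) (y :: nat \<Rightarrow> 'a).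
          \<lbrakk>\<forall>i\<in>{1..k}. \<alpha> i < CB_rank X;
           inj_on x {1..k}; inj_on y {1..k};
           \<forall>i\<in>{1..k}. x i \<in> CB_level X (\<alpha> i) \<and> y i \<in> CB_level X (\<alpha> i)\<rbrakk>
          \<Longrightarrow> \<exists>g\<in>carrier (Homeo X). \<forall>i\<in>{1..k}. g (x i) = y i"
    and identification: "\<And>\<alpha>. \<alpha> < CB_rank X \<Longrightarrow> bij_betw (b \<alpha>) (CB_level X \<alpha>) (K \<alpha>)"
begin

abbreviation I :: "'a ordinal set" where
  "I \<equiv> {..<CB_rank X}"

abbreviation emb :: "('a \<Rightarrow> 'a) \<Rightarrow> 'a ordinal \<Rightarrow> 'k \<Rightarrow> 'k" where
  "emb \<equiv> Homeo_embedding X K b"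

definition point :: "'a ordinal \<Rightarrow> 'k \<Rightarrow> 'a" where
  "point \<alpha> = inv_into (CB_level X \<alpha>) (b \<alpha>)"

definition level :: "'a \<Rightarrow> 'a ordinal" where
  "level x = (THE \<alpha>. \<alpha> < CB_rank X \<and> x \<in> CB_level X \<alpha>)"

lemma level_eq: "\<alpha> < CB_rank X \<Longrightarrow> x \<in> CB_level X \<alpha> \<Longrightarrow> level x = \<alpha>"
  unfolding level_def by (rule the_equality) (simp, metis CB_level_unique)

lemma level:
  assumes "x \<in> topspace X"
  shows "level x < CB_rank X" "x \<in> CB_level X (level x)"
  using scattered_ex_CB_level[OF scattered assms] level_eq by metis+

lemma bij_point: "\<alpha> \<in> I \<Longrightarrow> bij_betw (point \<alpha>) (K \<alpha>) (CB_level X \<alpha>)"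
  unfolding point_def by (simp add: bij_betw_inv_into identification)

lemma point_in: "\<alpha> \<in> I \<Longrightarrow> a \<in> K \<alpha> \<Longrightarrow> point \<alpha> a \<in> CB_level X \<alpha>"
  using bij_betwE[OF bij_point] by blast

lemma point_topspace: "\<alpha> \<in> I \<Longrightarrow> a \<in> K \<alpha> \<Longrightarrow> point \<alpha> a \<in> topspace X"
  by (rule subsetD[OF CB_level_subset point_in])

lemma b_in: "\<alpha> \<in> I \<Longrightarrow> x \<in> CB_level X \<alpha> \<Longrightarrow> b \<alpha> x \<in> K \<alpha>"
  using bij_betwE[OF identification] by blast

lemma b_point: "\<alpha> \<in> I \<Longrightarrow> a \<in> K \<alpha> \<Longrightarrow> b \<alpha> (point \<alpha> a) = a"
  using bij_betw_inv_into_right[OF identification, of \<alpha> a] by (simp add: point_def)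

lemma point_b: "\<alpha> \<in> I \<Longrightarrow> x \<in> CB_level X \<alpha> \<Longrightarrow> point \<alpha> (b \<alpha> x) = x"
  using bij_betw_inv_into_left[OF identification, of \<alpha> x] by (simp add: point_def)

lemma topspace_Homeo_topology: "topspace (Homeo_topology X) = carrier (Homeo X)"
  unfolding Homeo_topology_def
  by (auto simp: carrier_Homeo Bij_def bij_betw_def PiE_iff extensional_def)

lemma Homeo_level_iff:
  "g \<in> carrier (Homeo X) \<Longrightarrow> x \<in> topspace X \<Longrightarrow> g x \<in> CB_level X \<alpha> \<longleftrightarrow> x \<in> CB_level X \<alpha>"
  using homeomorphic_map_CB_level_iff[of X g x] by (simp add: carrier_Homeo)

text \<open>
  The point \<open>y\<close> is isolated by some open \<open>U\<close> in the derivative belonging to its level. Homeomorphisms keep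
  \<open>x\<close> at its level, so \<open>g x = y\<close> is equivalent to the open condition \<open>g x \<in> U\<close>.
\<close>

lemma openin_Homeo_value:
  assumes x: "x \<in> topspace X"
  shows "openin (Homeo_topology X) {g \<in> carrier (Homeo X). g x = y}"
proof (cases "y \<in> CB_level X (level x)")
  case True
  let ?S = "CB_deriv X (level x)"
  have "openin (subtopology X ?S) {y}"
    using True by (auto simp: CB_level_def CB_deriv_suc nonisolated_points_def)
  then obtain U where U: "openin X U" "{y} = U \<inter> ?S"
    unfolding openin_subtopology by blast
  have "continuous_map (Homeo_topology X) X (\<lambda>g. g x)"
    unfolding Homeo_topology_def using x
    by (intro continuous_map_from_subtopology continuous_map_product_projection)
  from openin_continuous_map_preimage[OF this U(1)]
  have "openin (Homeo_topology X) {g \<in> carrier (Homeo X). g x \<in> U}"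
    by (simp add: topspace_Homeo_topology)
  moreover have "g x \<in> ?S" if "g \<in> carrier (Homeo X)" for g
    using Homeo_level_iff[OF that x, of "level x"] level(2)[OF x] by (simp add: CB_level_def)
  then have "{g \<in> carrier (Homeo X). g x \<in> U} = {g \<in> carrier (Homeo X). g x = y}"
    using U(2) by blast
  ultimately show ?thesis
    by simp
next
  case False
  then have "{g \<in> carrier (Homeo X). g x = y} = {}"
    using Homeo_level_iff[OF _ x, of _ "level x"] level(2)[OF x] by auto
  then show ?thesis
    by (simp only: openin_empty)
qed

lemma emb_apply: "\<alpha> \<in> I \<Longrightarrow> a \<in> K \<alpha> \<Longrightarrow> emb g \<alpha> a = b \<alpha> (g (point \<alpha> a))"
  by (simp add: Homeo_embedding_def point_def)

lemma Homeo_point_in: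
  assumes "g \<in> carrier (Homeo X)" "\<alpha> \<in> I" "a \<in> K \<alpha>"
  shows "g (point \<alpha> a) \<in> CB_level X \<alpha>"
  using Homeo_level_iff[OF assms(1) point_topspace[OF assms(2,3)]] point_in[OF assms(2,3)] by simp

lemma emb_closed: "g \<in> carrier (Homeo X) \<Longrightarrow> \<alpha> \<in> I \<Longrightarrow> a \<in> K \<alpha> \<Longrightarrow> emb g \<alpha> a \<in> K \<alpha>"
  by (simp add: emb_apply Homeo_point_in b_in)

lemma point_emb: "g \<in> carrier (Homeo X) \<Longrightarrow> \<alpha> \<in> I \<Longrightarrow> a \<in> K \<alpha> \<Longrightarrow> point \<alpha> (emb g \<alpha> a) = g (point \<alpha> a)"
  by (simp add: emb_apply Homeo_point_in point_b)

lemma Homeo_mult_apply: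
  assumes "g \<in> carrier (Homeo X)" "h \<in> carrier (Homeo X)" "x \<in> topspace X"
  shows "(g \<otimes>\<^bsub>Homeo X\<^esub> h) x = g (h x)"
  using assms by (simp add: mult_Homeo carrier_Homeo BijGroup_def compose_def)

lemma emb_mult:
  assumes "g \<in> carrier (Homeo X)" "h \<in> carrier (Homeo X)" "\<alpha> \<in> I" "a \<in> K \<alpha>"
  shows "emb (g \<otimes>\<^bsub>Homeo X\<^esub> h) \<alpha> a = emb g \<alpha> (emb h \<alpha> a)"
proof -
  have "point \<alpha> a \<in> topspace X"
    using assms(3,4) by (rule point_topspace)
  then have "emb (g \<otimes>\<^bsub>Homeo X\<^esub> h) \<alpha> a = b \<alpha> (g (h (point \<alpha> a)))"
    using assms by (simp add: emb_apply Homeo_mult_apply)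
  also have "\<dots> = b \<alpha> (g (point \<alpha> (emb h \<alpha> a)))"
    by (simp only: point_emb[OF assms(2-4)])
  also have "\<dots> = emb g \<alpha> (emb h \<alpha> a)"
    by (rule emb_apply[OF assms(3) emb_closed[OF assms(2-4)], symmetric])
  finally show ?thesis .
qed

lemma emb_Bij:
  assumes g: "g \<in> carrier (Homeo X)" and \<alpha>: "\<alpha> \<in> I"
  shows "emb g \<alpha> \<in> Bij (K \<alpha>)"
proof -
  interpret group "Homeo X" by (rule group_Homeo)
  have one: "emb \<one>\<^bsub>Homeo X\<^esub> \<alpha> a = a" if a: "a \<in> K \<alpha>" for a
  proof -
    have "\<one>\<^bsub>Homeo X\<^esub> (point \<alpha> a) = point \<alpha> a"
      using point_topspace[OF \<alpha> a] by (simp add: Homeo_def BijGroup_def)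
    then show ?thesis
      using \<alpha> a by (simp add: emb_apply b_point)
  qed
  have "emb (inv\<^bsub>Homeo X\<^esub> g) \<alpha> (emb g \<alpha> a) = a" "emb g \<alpha> (emb (inv\<^bsub>Homeo X\<^esub> g) \<alpha> a) = a" if "a \<in> K \<alpha>" for a
    using emb_mult[of "inv\<^bsub>Homeo X\<^esub> g" g \<alpha> a] emb_mult[of g "inv\<^bsub>Homeo X\<^esub> g" \<alpha> a] g \<alpha> that one by simp_all
  then have "bij_betw (emb g \<alpha>) (K \<alpha>) (K \<alpha>)"
    using g \<alpha> emb_closed by (intro bij_betw_byWitness[where f' = "emb (inv\<^bsub>Homeo X\<^esub> g) \<alpha>"]) auto
  moreover have "emb g \<alpha> \<in> extensional (K \<alpha>)"
    using \<alpha> by (simp add: Homeo_embedding_def)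
  ultimately show ?thesis
    by (simp add: Bij_def)
qed

lemma emb_PiE: "g \<in> carrier (Homeo X) \<Longrightarrow> emb g \<in> (\<Pi>\<^sub>E \<alpha>\<in>I. Bij (K \<alpha>))"
  using emb_Bij by (auto simp: PiE_iff Homeo_embedding_def)

lemma emb_hom: "emb \<in> hom (Homeo X) (Sym_prod I K)"
proof (rule homI)
  interpret group "Homeo X" by (rule group_Homeo)
  show "emb g \<in> carrier (Sym_prod I K)" if "g \<in> carrier (Homeo X)" for g
    using emb_PiE[OF that] by (simp add: Sym_prod_def BijGroup_def)
  fix g h assume gh: "g \<in> carrier (Homeo X)" "h \<in> carrier (Homeo X)"
  have "emb (g \<otimes>\<^bsub>Homeo X\<^esub> h) = (\<lambda>\<alpha>\<in>I. compose (K \<alpha>) (emb g \<alpha>) (emb h \<alpha>))"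
  proof (rule PiE_ext[of _ I "\<lambda>\<alpha>. Bij (K \<alpha>)"])
    show "emb (g \<otimes>\<^bsub>Homeo X\<^esub> h) \<in> (\<Pi>\<^sub>E \<alpha>\<in>I. Bij (K \<alpha>))"
      using gh by (intro emb_PiE) simp
    show "(\<lambda>\<alpha>\<in>I. compose (K \<alpha>) (emb g \<alpha>) (emb h \<alpha>)) \<in> (\<Pi>\<^sub>E \<alpha>\<in>I. Bij (K \<alpha>))"
      using gh by (auto intro!: compose_Bij emb_Bij)
    fix \<alpha> assume "\<alpha> \<in> I"
    then show "emb (g \<otimes>\<^bsub>Homeo X\<^esub> h) \<alpha> = (\<lambda>\<alpha>\<in>I. compose (K \<alpha>) (emb g \<alpha>) (emb h \<alpha>)) \<alpha>"
      using gh emb_mult Bij_imp_extensional[OF emb_Bij[of "g \<otimes>\<^bsub>Homeo X\<^esub> h" \<alpha>]]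
      by (intro extensionalityI[of _ "K \<alpha>"]) (simp_all add: compose_def)
  qed
  then show "emb (g \<otimes>\<^bsub>Homeo X\<^esub> h) = emb g \<otimes>\<^bsub>Sym_prod I K\<^esub> emb h"
    using gh emb_Bij by (auto simp: Sym_prod_def BijGroup_def intro!: restrict_ext)
qed

lemma continuous_map_emb: "continuous_map (Homeo_topology X) (Sym_prod_topology I K) emb"
  unfolding Sym_prod_topology_def continuous_map_componentwise
proof (intro conjI ballI)
  show "emb ` topspace (Homeo_topology X) \<subseteq> extensional I"
    by (auto simp: Homeo_embedding_def)
  fix \<alpha> assume \<alpha>: "\<alpha> \<in> I"
  show "continuous_map (Homeo_topology X) (Sym_topology (K \<alpha>)) (\<lambda>g. emb g \<alpha>)"
    unfolding Sym_topology_def continuous_map_in_subtopology continuous_map_componentwise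
  proof (intro conjI ballI)
    show "(\<lambda>g. emb g \<alpha>) \<in> topspace (Homeo_topology X) \<rightarrow> carrier (Sym (K \<alpha>))"
      using emb_Bij[OF _ \<alpha>] by (auto simp: topspace_Homeo_topology BijGroup_def)
    show "(\<lambda>g. emb g \<alpha>) ` topspace (Homeo_topology X) \<subseteq> extensional (K \<alpha>)"
      using \<alpha> by (auto simp: Homeo_embedding_def)
    fix a assume a: "a \<in> K \<alpha>"
    show "continuous_map (Homeo_topology X) (discrete_topology (K \<alpha>)) (\<lambda>g. emb g \<alpha> a)"
    proof (rule continuous_map_into_discrete)
      show "(\<lambda>g. emb g \<alpha> a) \<in> topspace (Homeo_topology X) \<rightarrow> K \<alpha>"
        using \<alpha> a emb_closed by (simp add: topspace_Homeo_topology)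
      fix c assume c: "c \<in> K \<alpha>"
      have "emb g \<alpha> a = c \<longleftrightarrow> g (point \<alpha> a) = point \<alpha> c" if "g \<in> carrier (Homeo X)" for g
        using point_emb[OF that \<alpha> a] b_point[OF \<alpha> c] emb_apply[OF \<alpha> a, of g] by metis
      then have "{g \<in> topspace (Homeo_topology X). emb g \<alpha> a = c} =
          {g \<in> carrier (Homeo X). g (point \<alpha> a) = point \<alpha> c}"
        by (auto simp: topspace_Homeo_topology)
      then show "openin (Homeo_topology X) {g \<in> topspace (Homeo_topology X). emb g \<alpha> a = c}"
        using openin_Homeo_value[OF point_topspace[OF \<alpha> a], of "point \<alpha> c"] by simp
    qed
  qed
qed

text \<open>
  Reassembles a self-map of \<open>X\<close> from a family of permutations of the levels. It need not be a homeomorphism,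
  so this is a left inverse of \<open>emb\<close> only.
\<close>

definition unemb :: "('a ordinal \<Rightarrow> 'k \<Rightarrow> 'k) \<Rightarrow> 'a \<Rightarrow> 'a" where
  "unemb s = (\<lambda>x\<in>topspace X. point (level x) (s (level x) (b (level x) x)))"

text \<open>
  Each coordinate factors through a discrete space, on which every map is continuous.
\<close>

lemma continuous_map_unemb:
  "continuous_map (Sym_prod_topology I K) (product_topology (\<lambda>_. X) (topspace X)) unemb"
  unfolding continuous_map_componentwise
proof (intro conjI ballI)
  show "unemb ` topspace (Sym_prod_topology I K) \<subseteq> extensional (topspace X)"
    by (auto simp: unemb_def)
  fix x assume x: "x \<in> topspace X"
  define \<alpha> where "\<alpha> = level x"
  have \<alpha>: "\<alpha> \<in> I" "x \<in> CB_level X \<alpha>"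
    using level[OF x] by (auto simp: \<alpha>_def)
  have "continuous_map (Sym_prod_topology I K) (discrete_topology (K \<alpha>)) (\<lambda>s. s \<alpha> (b \<alpha> x))"
  proof (rule continuous_map_into_discrete)
    show "(\<lambda>s. s \<alpha> (b \<alpha> x)) \<in> topspace (Sym_prod_topology I K) \<rightarrow> K \<alpha>"
    proof
      fix s assume "s \<in> topspace (Sym_prod_topology I K)"
      then have "s \<alpha> \<in> Bij (K \<alpha>)"
        using \<alpha>(1) by (auto simp: Sym_prod_topology_def PiE_iff)
      then show "s \<alpha> (b \<alpha> x) \<in> K \<alpha>"
        using b_in[OF \<alpha>] Bij_imp_funcset by blast
    qed
  qed (use openin_Sym_prod_value[where K = K, OF \<alpha>(1) b_in[OF \<alpha>]] in blast)
  moreover have "continuous_map (discrete_topology (K \<alpha>)) X (point \<alpha>)"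
    using point_topspace[OF \<alpha>(1)] by (auto simp: continuous_map_def)
  ultimately have "continuous_map (Sym_prod_topology I K) X (point \<alpha> \<circ> (\<lambda>s. s \<alpha> (b \<alpha> x)))"
    by (rule continuous_map_compose)
  then show "continuous_map (Sym_prod_topology I K) X (\<lambda>s. unemb s x)"
    using x by (simp add: unemb_def \<alpha>_def o_def)
qed

lemma unemb_emb:
  assumes g: "g \<in> carrier (Homeo X)"
  shows "unemb (emb g) = g"
proof (rule extensionalityI[of _ "topspace X"])
  show "g \<in> extensional (topspace X)"
    using g by (simp add: carrier_Homeo Bij_imp_extensional)
  fix x assume x: "x \<in> topspace X"
  then have l: "level x \<in> I" "x \<in> CB_level X (level x)"
    using level by auto
  show "unemb (emb g) x = g x"
    using x point_emb[OF g l(1) b_in[OF l]] point_b[OF l] by (simp add: unemb_def)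
qed (simp add: unemb_def)

lemma emb_embedding: "embedding_map (Homeo_topology X) (Sym_prod_topology I K) emb"
proof -
  let ?S = "subtopology (Sym_prod_topology I K) (emb ` topspace (Homeo_topology X))"
  have "continuous_map ?S (Homeo_topology X) unemb"
    unfolding Homeo_topology_def continuous_map_in_subtopology
  proof
    show "continuous_map (subtopology (Sym_prod_topology I K)
        (emb ` topspace (subtopology (product_topology (\<lambda>_. X) (topspace X)) (carrier (Homeo X)))))
        (product_topology (\<lambda>_. X) (topspace X)) unemb"
      by (intro continuous_map_from_subtopology continuous_map_unemb)
  qed (auto simp: unemb_emb topspace_Homeo_topology[unfolded Homeo_topology_def])
  moreover have "continuous_map (Homeo_topology X) ?S emb"
    using continuous_map_emb by (simp add: continuous_map_in_subtopology)
  ultimately have "homeomorphic_maps (Homeo_topology X) ?S emb unemb"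
    by (auto simp: homeomorphic_maps_def topspace_Homeo_topology unemb_emb)
  then show ?thesis
    unfolding embedding_map_def homeomorphic_map_maps by blast
qed

text \<open>
  The transitivity hypothesis is applied to an enumeration of the points that correspond to \<open>F\<close> and their
  prescribed images.
\<close>

lemma emb_realizes_finite_part:
  assumes s: "s \<in> topspace (Sym_prod_topology I K)" and F: "finite F" "F \<subseteq> Sigma I K"
  obtains g where "g \<in> carrier (Homeo X)" "\<And>\<alpha> a. (\<alpha>, a) \<in> F \<Longrightarrow> emb g \<alpha> a = s \<alpha> a"
proof -
  obtain h where h: "bij_betw h {1..card F} F"
    using ex_bij_betw_nat_finite_1[OF F(1)] by blast
  have s_Bij: "s \<alpha> \<in> Bij (K \<alpha>)" if "\<alpha> \<in> I" for \<alpha>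
    using s that by (auto simp: Sym_prod_topology_def PiE_iff)
  (* P (\<lambda>_ a. a) enumerates the points belonging to F and P s their intended images. *)
  define P where "P f = (\<lambda>i. point (fst (h i)) (f (fst (h i)) (snd (h i))))" for f :: "'a ordinal \<Rightarrow> 'k \<Rightarrow> 'k"
  have hF: "h i \<in> F" "fst (h i) \<in> I" "snd (h i) \<in> K (fst (h i))" if "i \<in> {1..card F}" for i
  proof -
    show "h i \<in> F"
      using that bij_betwE[OF h] by blast
    then show "fst (h i) \<in> I" "snd (h i) \<in> K (fst (h i))"
      using F(2) by auto
  qed
  have P_level: "P f i \<in> CB_level X (fst (h i))"
    if "\<And>\<alpha>. \<alpha> \<in> I \<Longrightarrow> f \<alpha> \<in> K \<alpha> \<rightarrow> K \<alpha>" "i \<in> {1..card F}" for f i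
    using that(1)[OF hF(2)[OF that(2)]] hF[OF that(2)] by (auto simp: P_def intro: point_in)
  have P_inj: "inj_on (P f) {1..card F}"
    if f: "\<And>\<alpha>. \<alpha> \<in> I \<Longrightarrow> f \<alpha> \<in> K \<alpha> \<rightarrow> K \<alpha>" "\<And>\<alpha>. \<alpha> \<in> I \<Longrightarrow> inj_on (f \<alpha>) (K \<alpha>)" for f
  proof (rule inj_onI)
    fix i j assume ij: "i \<in> {1..card F}" "j \<in> {1..card F}" "P f i = P f j"
    have "fst (h i) = fst (h j)"
      using CB_level_unique P_level[OF f(1) ij(1)] P_level[OF f(1) ij(2)] ij(3) by metis
    moreover have "f (fst (h i)) (snd (h i)) = f (fst (h i)) (snd (h j))"
      using bij_betw_imp_inj_on[OF bij_point[OF hF(2)[OF ij(1)]]] ij(3) calculation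
        hF[OF ij(1)] hF[OF ij(2)] f(1)[OF hF(2)[OF ij(1)]]
      by (auto simp: P_def dest!: inj_onD)
    then have "snd (h i) = snd (h j)"
      using f(2)[OF hF(2)[OF ij(1)]] hF[OF ij(1)] hF[OF ij(2)] calculation by (auto dest: inj_onD)
    ultimately have "h i = h j"
      by (simp add: prod_eq_iff)
    then show "i = j"
      using bij_betw_imp_inj_on[OF h] ij by (auto dest: inj_onD)
  qed
  have s_fun: "s \<alpha> \<in> K \<alpha> \<rightarrow> K \<alpha>" "inj_on (s \<alpha>) (K \<alpha>)" if "\<alpha> \<in> I" for \<alpha>
    using s_Bij[OF that] by (auto simp: Bij_def bij_betw_def)
  have "\<exists>g\<in>carrier (Homeo X). \<forall>i\<in>{1..card F}. g (P (\<lambda>_ a. a) i) = P s i"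
  proof (rule transitive[of "card F" "\<lambda>i. fst (h i)"])
    show "\<forall>i\<in>{1..card F}. fst (h i) < CB_rank X"
      using hF(2) by blast
    show "inj_on (P (\<lambda>_ a. a)) {1..card F}"
      by (rule P_inj) auto
    show "inj_on (P s) {1..card F}"
      by (rule P_inj) (use s_fun in blast)+
    show "\<forall>i\<in>{1..card F}. P (\<lambda>_ a. a) i \<in> CB_level X (fst (h i)) \<and> P s i \<in> CB_level X (fst (h i))"
      using P_level[of "\<lambda>_ a. a"] P_level[of s] s_fun(1) by auto
  qed
  then obtain g where g: "g \<in> carrier (Homeo X)" "\<And>i. i \<in> {1..card F} \<Longrightarrow> g (P (\<lambda>_ a. a) i) = P s i"
    by blast
  have "emb g \<alpha> a = s \<alpha> a" if "(\<alpha>, a) \<in> F" for \<alpha> a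
  proof -
    obtain i where i: "i \<in> {1..card F}" "h i = (\<alpha>, a)"
      using bij_betw_imp_surj_on[OF h] \<open>(\<alpha>, a) \<in> F\<close> by (metis imageE)
    have \<alpha>: "\<alpha> \<in> I" "a \<in> K \<alpha>"
      using that F(2) by auto
    then have "s \<alpha> a \<in> K \<alpha>"
      using s_fun(1) by blast
    then show ?thesis
      using g(2)[OF i(1)] i(2) \<alpha> by (simp add: P_def emb_apply b_point)
  qed
  with g(1) show ?thesis
    using that by blast
qed

lemma emb_dense:
  "Sym_prod_topology I K closure_of (emb ` carrier (Homeo X)) = topspace (Sym_prod_topology I K)"
proof -
  have "s \<in> Sym_prod_topology I K closure_of (emb ` carrier (Homeo X))"
    if s: "s \<in> topspace (Sym_prod_topology I K)" for s
    unfolding in_closure_of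
  proof (intro conjI allI impI s)
    fix V assume V: "s \<in> V \<and> openin (Sym_prod_topology I K) V"
    obtain F where F: "finite F" "F \<subseteq> Sigma I K"
      "\<And>t. t \<in> topspace (Sym_prod_topology I K) \<Longrightarrow> (\<And>\<alpha> a. (\<alpha>, a) \<in> F \<Longrightarrow> t \<alpha> a = s \<alpha> a) \<Longrightarrow> t \<in> V"
      using Sym_prod_nbhd[of I K V s] V by blast
    obtain g where g: "g \<in> carrier (Homeo X)" "\<And>\<alpha> a. (\<alpha>, a) \<in> F \<Longrightarrow> emb g \<alpha> a = s \<alpha> a"
      using emb_realizes_finite_part[OF s F(1,2)] by blast
    have "emb g \<in> V"
      using emb_PiE[OF g(1)] g(2) by (intro F(3)) (simp_all add: Sym_prod_topology_def)
    then show "\<exists>t. t \<in> emb ` carrier (Homeo X) \<and> t \<in> V"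
      using g(1) by blast
  qed
  then show ?thesis
    by (auto simp: in_closure_of)
qed

lemma dense_subgroup: "dense_subgroup_of_Sym_prod (Homeo X) (Homeo_topology X) I K emb"
  by (intro dense_subgroup_of_Sym_prod.intro dense_subgroup_of_Sym_prod_axioms.intro
      group_Homeo topspace_Homeo_topology emb_hom emb_embedding emb_dense)

end

theorem proposition9p10:
  fixes X :: "'a topology"
    and K :: "'a ordinal \<Rightarrow> 'k set"
    and b :: "'a ordinal \<Rightarrow> 'a \<Rightarrow> 'k"
  assumes Hausdorff: "Hausdorff_space X"
    and scattered: "scattered_space X"
    and transitive: "\<And>(k :: nat) (\<alpha> :: nat \<Rightarrow> 'a ordinal) (x :: nat \<Rightarrow> 'a) (y :: nat \<Rightarrow> 'a).
          \<lbrakk>\<forall>i\<in>{1..k}. \<alpha> i < CB_rank X;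
           inj_on x {1..k}; inj_on y {1..k};
           \<forall>i\<in>{1..k}. x i \<in> CB_level X (\<alpha> i) \<and> y i \<in> CB_level X (\<alpha> i)\<rbrakk>
          \<Longrightarrow> \<exists>g\<in>carrier (Homeo X). \<forall>i\<in>{1..k}. g (x i) = y i"
    and identification: "\<And>\<alpha>. \<alpha> < CB_rank X \<Longrightarrow> bij_betw (b \<alpha>) (CB_level X \<alpha>) (K \<alpha>)"
  shows "CAP TYPE('y) (Homeo X) (Homeo_topology X)
    \<and> (Homeo_embedding X K b \<in> hom (Homeo X) (Sym_prod {..<CB_rank X} K)
       \<and> embedding_map (Homeo_topology X) (Sym_prod_topology {..<CB_rank X} K)
             (Homeo_embedding X K b)
       \<and> Sym_prod_topology {..<CB_rank X} K closure_of
             (Homeo_embedding X K b ` carrier (Homeo X))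
           = topspace (Sym_prod_topology {..<CB_rank X} K))
    \<and> (universal_minimal_flow TYPE('z) (Homeo X) (Homeo_topology X)
           (LO_prod_topology {..<CB_rank X} K) (Homeo_LO_act X K b)
       \<and> (\<forall>(M :: 'm topology) act.
             universal_minimal_flow TYPE('a ordinal \<Rightarrow> 'k rel) (Homeo X) (Homeo_topology X) M act
             \<longrightarrow> flows_isomorphic (Homeo X) M act
                   (LO_prod_topology {..<CB_rank X} K) (Homeo_LO_act X K b)))"
proof -
  interpret levelwise_transitive_space X K b
    using scattered transitive identification by (rule levelwise_transitive_space.intro)
  interpret H: dense_subgroup_of_Sym_prod "Homeo X" "Homeo_topology X" I K emb
    by (rule dense_subgroup)
  have act: "Homeo_LO_act X K b = H.oact"
    by (intro ext) (simp only: Homeo_LO_act_def H.oact_def)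
  show ?thesis
    unfolding act
    by (intro conjI allI impI H.is_CAP emb_hom emb_embedding emb_dense
        H.universal_minimal_flow_ords H.universal_minimal_flow_unique)
qed

end
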